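(* Let $\mathcal{X}=(X_1,X_2,\dots)$ be a stationary and ergodic sequence of real random variables, where each $X_i$ has distribution function $F$ and density $f$, and suppose $\mathbb{P}(X_1=X_2)=0$. Let $\xi_{0,n}$ be the measure on $\Delta$ associated with the $0$-th sublevel set persistence diagram of $X_1,\dots,X_n$, and let $\tilde\xi_{0,n}$ be its restriction to $\tilde\Delta=\Delta\cap\mathbb{R}^2$. Then there exists a (non-random) probability measure $\xi_0$ on $\Delta$ such that, almost surely, \[ \frac{\xi_{0,n}}{\xi_{0,n}(\Delta)}\Rightarrow \xi_0,\qquad n\to\infty . \] Additionally, if $\tilde\xi_0$ is defined by $\tilde\xi_0(A)=\xi_0(A)$ for $A\in\mathcal{B}(\tilde\Delta)$, then, almost surely, \[ \frac{\tilde\xi_{0,n}}{\tilde\xi_{0,n}(\tilde\Delta)}\Rightarrow \tilde\xi_0,\qquad n\to\infty . \]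
   Context: Stationary means strictly stationary (finite-dimensional distributions invariant under shifts); ergodic means every a.s. shift-invariant event has probability $0$ or $1$. $\Rightarrow$ denotes weak convergence of probability measures. Let $\bar{\mathbb{R}}=[-\infty,\infty]$, $\Delta=\{(x,y)\in\bar{\mathbb{R}}^2:-\infty<x<y\le\infty\}$ with the subspace topology from $\bar{\mathbb R}^2$ and its Borel $\sigma$-algebra $\mathcal{B}(\Delta)$, and $\tilde\Delta=\Delta\cap\mathbb{R}^2$ with $\mathcal{B}(\tilde\Delta)$. Let $K$ be the graph (simplicial complex) with vertices $v_0,v_1,v_2,\dots$ and edges $\{v_i,v_{i+1}\}$, $i\ge 0$. For $n\ge1$ put $X_{k,n}=X_k$ for $1\le k\le n$, and $X_{k,n}=\infty$ for $k=0$ and for $k>n$. For $t\in\mathbb{R}$ let $K_n(t)=\{\sigma\in K:\max_{v_i\in\sigma}X_{i,n}\le t\}$. Homology is with $\mathbb{Z}_2$ coefficients. The persistence module $\big(H_0(K_n(t))\big)_{t\in\mathbb R}$ with maps induced by the inclusions $K_n(s)\subset K_n(t)$, $s\le t$, is isomorphic to $\bigoplus_{(b,d)\in PD_0}I(b,d)$ for a unique multiset $PD_0$ of points of $\Delta$ (the $0$-th persistence diagram of the filtration), where $I(b,d)$ is the module equal to $\mathbb{Z}_2$ at $t$ when $b\le t<d$ and $0$ otherwise, with identity maps between the nonzero spaces. Then $\xi_{0,n}=\sum_{(b,d)\in PD_0}\delta_{(b,d)}$ (with multiplicity), and $\tilde\xi_{0,n}(A)=\xi_{0,n}(A)$ for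 $A\in\mathcal{B}(\tilde\Delta)$. The second normalization is considered for $n$ large enough that $\tilde\xi_{0,n}(\tilde\Delta)>0$. *)

theory Defs
  imports
    "HOL-Probability.Probability"
    "HOL-Algebra.Module"
    "HOL-Algebra.AbelCoset"
    "HOL-Library.Z2"
    "HOL-Library.Multiset"
begin

section \<open>Vector spaces over the two-element field\<close>

text \<open>
  A vector space over the field \<open>\<int>\<^sub>2\<close> (the type \<^typ>\<open>bit\<close>) is given by a record of type
  \<open>(bit, 'a) module\<close>. The fields \<open>mult\<close> and \<open>one\<close>, which that record type
  inherits from rings, play no role for vector spaces and are left undefined.
\<close>

definition lin_iso :: "(bit, 'a) module \<Rightarrow> (bit, 'b) module \<Rightarrow> ('a \<Rightarrow> 'b) set" where
  "lin_iso V W = {h. bij_betw h (carrier V) (carrier W) \<and>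
     (\<forall>x \<in> carrier V. \<forall>y \<in> carrier V. h (x \<oplus>\<^bsub>V\<^esub> y) = h x \<oplus>\<^bsub>W\<^esub> h y) \<and>
     (\<forall>a. \<forall>x \<in> carrier V. h (a \<odot>\<^bsub>V\<^esub> x) = a \<odot>\<^bsub>W\<^esub> h x)}"

definition quotient_space :: "(bit, 'a) module \<Rightarrow> 'a set \<Rightarrow> (bit, 'a set) module" where
  "quotient_space V U =
    \<lparr>carrier = a_rcosets\<^bsub>V\<^esub> U, mult = undefined, one = undefined,
     zero = U, add = (\<lambda>C D. C <+>\<^bsub>V\<^esub> D),
     smult = (\<lambda>a C. \<Union>x\<in>C. U +>\<^bsub>V\<^esub> (a \<odot>\<^bsub>V\<^esub> x))\<rparr>"

definition direct_sum :: "'i set \<Rightarrow> ('i \<Rightarrow> (bit, 'a) module) \<Rightarrow> (bit, 'i \<Rightarrow> 'a) module" where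
  "direct_sum J V =
    \<lparr>carrier = {\<phi> \<in> Pi\<^sub>E J (\<lambda>j. carrier (V j)). finite {j \<in> J. \<phi> j \<noteq> \<zero>\<^bsub>V j\<^esub>}},
     mult = undefined, one = undefined,
     zero = (\<lambda>j\<in>J. \<zero>\<^bsub>V j\<^esub>), add = (\<lambda>\<phi> \<psi>. \<lambda>j\<in>J. \<phi> j \<oplus>\<^bsub>V j\<^esub> \<psi> j),
     smult = (\<lambda>a \<phi>. \<lambda>j\<in>J. a \<odot>\<^bsub>V j\<^esub> \<phi> j)\<rparr>"


section \<open>Simplicial homology with coefficients in the two-element field\<close>

text \<open>A simplicial complex is a set of finite nonempty sets of vertices; a \<open>p\<close>-simplex is a
  simplex with \<open>p + 1\<close> vertices.\<close>

definition chain_space :: "nat \<Rightarrow> 'v set set \<Rightarrow> (bit, 'v set \<Rightarrow> bit) module" where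
  "chain_space p L =
    \<lparr>carrier = {c. finite {\<sigma>. c \<sigma> \<noteq> 0} \<and> {\<sigma>. c \<sigma> \<noteq> 0} \<subseteq> {\<sigma> \<in> L. card \<sigma> = p + 1}},
     mult = undefined, one = undefined,
     zero = (\<lambda>_. 0), add = (\<lambda>c d \<sigma>. c \<sigma> + d \<sigma>), smult = (\<lambda>a c \<sigma>. a * c \<sigma>)\<rparr>"

text \<open>The coefficient of \<open>\<partial>c\<close> at \<open>\<tau>\<close> is the sum of the coefficients of \<open>c\<close> at the simplices having
  \<open>\<tau>\<close> as a facet. The empty set is not a simplex (homology is not reduced).\<close>

definition boundary_map :: "('v set \<Rightarrow> bit) \<Rightarrow> 'v set \<Rightarrow> bit" where
  "boundary_map c = (\<lambda>\<tau>. if \<tau> = {} then 0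
     else (\<Sum>\<sigma> | c \<sigma> \<noteq> 0 \<and> \<tau> \<subseteq> \<sigma> \<and> card \<sigma> = card \<tau> + 1. c \<sigma>))"

definition cycles :: "nat \<Rightarrow> 'v set set \<Rightarrow> ('v set \<Rightarrow> bit) set" where
  "cycles p L = {c \<in> carrier (chain_space p L). boundary_map c = (\<lambda>_. 0)}"

definition boundaries :: "nat \<Rightarrow> 'v set set \<Rightarrow> ('v set \<Rightarrow> bit) set" where
  "boundaries p L = boundary_map ` carrier (chain_space (p + 1) L)"

definition homology :: "nat \<Rightarrow> 'v set set \<Rightarrow> (bit, ('v set \<Rightarrow> bit) set) module" where
  "homology p L =
     quotient_space ((chain_space p L)\<lparr>carrier := cycles p L\<rparr>) (boundaries p L)"

text \<open>The map into the homology of a larger complex \<open>L'\<close> that is induced by the inclusion: it sends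
  the class of a cycle \<open>z\<close> to the class of \<open>z\<close>, so it does not depend on the smaller complex.\<close>

definition homology_incl ::
    "nat \<Rightarrow> 'v set set \<Rightarrow> ('v set \<Rightarrow> bit) set \<Rightarrow> ('v set \<Rightarrow> bit) set" where
  "homology_incl p L' C = (\<Union>z\<in>C. boundaries p L' +>\<^bsub>chain_space p L'\<^esub> z)"


section \<open>Persistence modules and persistence diagrams\<close>

text \<open>A persistence module indexed by the real line consists of spaces \<open>V t\<close> and maps
  \<open>v s t\<close> from \<open>V s\<close> to \<open>V t\<close>, which are relevant only for \<open>s \<le> t\<close>.\<close>

definition pers_isomorphic ::
    "(real \<Rightarrow> (bit, 'a) module) \<Rightarrow> (real \<Rightarrow> real \<Rightarrow> 'a \<Rightarrow> 'a) \<Rightarrow>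
     (real \<Rightarrow> (bit, 'b) module) \<Rightarrow> (real \<Rightarrow> real \<Rightarrow> 'b \<Rightarrow> 'b) \<Rightarrow> bool" where
  "pers_isomorphic V v W w \<longleftrightarrow>
     (\<exists>h. (\<forall>t. h t \<in> lin_iso (V t) (W t)) \<and>
          (\<forall>s t. s \<le> t \<longrightarrow> (\<forall>x \<in> carrier (V s). h t (v s t x) = w s t (h s x))))"

definition interval_space :: "ereal \<times> ereal \<Rightarrow> real \<Rightarrow> (bit, bit) module" where
  "interval_space p t =
    \<lparr>carrier = (if fst p \<le> ereal t \<and> ereal t < snd p then UNIV else {0}),
     mult = undefined, one = undefined, zero = 0, add = (+), smult = (*)\<rparr>"

definition interval_map :: "ereal \<times> ereal \<Rightarrow> real \<Rightarrow> real \<Rightarrow> bit \<Rightarrow> bit" where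
  "interval_map p s t = (\<lambda>a. if fst p \<le> ereal s \<and> ereal s < snd p \<and>
     fst p \<le> ereal t \<and> ereal t < snd p then a else 0)"

text \<open>The summands of the interval decomposition given by a multiset \<open>P\<close>: a point \<open>p\<close> of
  multiplicity \<open>m\<close> contributes the indices \<open>(p, 0), \<dots>, (p, m - 1)\<close>.\<close>

definition mset_index :: "'p multiset \<Rightarrow> ('p \<times> nat) set" where
  "mset_index P = {(p, i). i < count P p}"

definition Delta :: "(ereal \<times> ereal) set" where
  "Delta = {(x, y). - \<infinity> < x \<and> x < y \<and> y \<le> \<infinity>}"

definition Delta_fin :: "(ereal \<times> ereal) set" where
  "Delta_fin = Delta \<inter> (range ereal \<times> range ereal)"

definition is_pers_diagram ::
    "nat \<Rightarrow> (real \<Rightarrow> 'v set set) \<Rightarrow> (ereal \<times> ereal) multiset \<Rightarrow> bool" where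
  "is_pers_diagram p L P \<longleftrightarrow> set_mset P \<subseteq> Delta \<and>
     pers_isomorphic
       (\<lambda>t. homology p (L t)) (\<lambda>s t. homology_incl p (L t))
       (\<lambda>t. direct_sum (mset_index P) (\<lambda>j. interval_space (fst j) t))
       (\<lambda>s t \<phi>. \<lambda>j\<in>mset_index P. interval_map (fst j) s t (\<phi> j))"

text \<open>Multisets of type \<open>_ multiset\<close> are finite. This suffices for the sublevel set
  filtrations below, which contain finitely many simplices altogether.\<close>

definition pers_diagram :: "nat \<Rightarrow> (real \<Rightarrow> 'v set set) \<Rightarrow> (ereal \<times> ereal) multiset" where
  "pers_diagram p L = (THE P. is_pers_diagram p L P)"


section \<open>The sublevel set filtration of a finite sequence\<close>

definition path_complex :: "nat set set" where
  "path_complex = {{i} | i. True} \<union> {{i, i + 1} | i. True}"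

definition trunc_seq :: "(nat \<Rightarrow> real) \<Rightarrow> nat \<Rightarrow> nat \<Rightarrow> ereal" where
  "trunc_seq x n k = (if 1 \<le> k \<and> k \<le> n then ereal (x k) else \<infinity>)"

definition sublevel_complex :: "(nat \<Rightarrow> real) \<Rightarrow> nat \<Rightarrow> real \<Rightarrow> nat set set" where
  "sublevel_complex x n t = {\<sigma> \<in> path_complex. Max (trunc_seq x n ` \<sigma>) \<le> ereal t}"

text \<open>The value on \<open>A\<close> is the sum over the diagram, with multiplicity, of the Dirac
  masses \<open>\<delta>\<^sub>p(A)\<close>.\<close>

definition diagram_measure :: "(ereal \<times> ereal) multiset \<Rightarrow> (ereal \<times> ereal) measure" where
  "diagram_measure P = measure_of Delta (sets (restrict_space borel Delta))
     (\<lambda>A. \<Sum>p\<in>#P. indicator A p)"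

definition xi0 :: "(nat \<Rightarrow> real) \<Rightarrow> nat \<Rightarrow> (ereal \<times> ereal) measure" where
  "xi0 x n = diagram_measure (pers_diagram 0 (sublevel_complex x n))"

definition xi0_fin :: "(nat \<Rightarrow> real) \<Rightarrow> nat \<Rightarrow> (ereal \<times> ereal) measure" where
  "xi0_fin x n = restrict_space (xi0 x n) Delta_fin"


section \<open>Probabilistic notions\<close>

definition normalize_measure :: "'a measure \<Rightarrow> 'a measure" where
  "normalize_measure \<mu> = scale_measure (1 / emeasure \<mu> (space \<mu>)) \<mu>"

text \<open>Weak convergence of Borel probability measures on a subset \<open>S\<close> of a topological space,
  with the subspace topology. Finitely many members of the sequence may fail to be probability
  measures, so that normalizations need only be defined from some index on.\<close>

definition weak_conv_on ::
    "'a::topological_space set \<Rightarrow> (nat \<Rightarrow> 'a measure) \<Rightarrow> 'a measure \<Rightarrow> bool" where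
  "weak_conv_on S \<mu> \<nu> \<longleftrightarrow>
     (\<forall>\<^sub>F n in sequentially. prob_space (\<mu> n) \<and> sets (\<mu> n) = sets (restrict_space borel S)) \<and>
     prob_space \<nu> \<and> sets \<nu> = sets (restrict_space borel S) \<and>
     (\<forall>f :: 'a \<Rightarrow> real. continuous_on S f \<longrightarrow> bounded (f ` S) \<longrightarrow>
        (\<lambda>n. integral\<^sup>L (\<mu> n) f) \<longlonglongrightarrow> integral\<^sup>L \<nu> f)"

text \<open>Sequences of random variables are indexed by the positive integers; \<open>X 0\<close> is ignored.\<close>

definition stationary_seq :: "'w measure \<Rightarrow> (nat \<Rightarrow> 'w \<Rightarrow> real) \<Rightarrow> bool" where
  "stationary_seq M X \<longleftrightarrow>
     (\<forall>J h. finite J \<longrightarrow> J \<subseteq> {1..} \<longrightarrow>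
        distr M (Pi\<^sub>M J (\<lambda>_. borel)) (\<lambda>\<omega>. \<lambda>j\<in>J. X (j + h) \<omega>) =
        distr M (Pi\<^sub>M J (\<lambda>_. borel)) (\<lambda>\<omega>. \<lambda>j\<in>J. X j \<omega>))"

text \<open>Every event of the form \<open>{(X\<^sub>1, X\<^sub>2, \<dots>) \<in> B}\<close> that agrees almost surely with its shift
  \<open>{(X\<^sub>2, X\<^sub>3, \<dots>) \<in> B}\<close> has probability zero or one.\<close>

definition ergodic_seq :: "'w measure \<Rightarrow> (nat \<Rightarrow> 'w \<Rightarrow> real) \<Rightarrow> bool" where
  "ergodic_seq M X \<longleftrightarrow>
     (\<forall>B \<in> sets (Pi\<^sub>M (UNIV :: nat set) (\<lambda>_. borel :: real measure)).
        (AE \<omega> in M. (\<lambda>i. X (i + 1) \<omega>) \<in> B \<longleftrightarrow> (\<lambda>i. X (i + 2) \<omega>) \<in> B) \<longrightarrow>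
        measure M {\<omega> \<in> space M. (\<lambda>i. X (i + 1) \<omega>) \<in> B} \<in> {0, 1})"

end

theory Submission
  imports Defs
begin

text \<open>
  The diagram of a path is explicit. Let \<open>merge_height x i j\<close> be the maximum of \<open>x\<close> between \<open>i\<close> and
  \<open>j\<close>. It satisfies the ultrametric inequality, and the component of \<open>i\<close> in the sublevel set at \<open>t\<close>
  consists of the \<open>j\<close> with \<open>merge_height x i j \<le> t\<close>. Order the vertices by value, ties broken by index. A vertex represents its component
  from its own value until the component meets an older vertex, which happens at the level
  \<open>death x {1..n} i\<close>. Summing the coefficients of a chain over the component of \<open>i\<close> just before that
  level gives linear functionals that identify \<open>H\<^sub>0\<close>, compatibly with inclusions, with a sum of
  intervals; the ranks of the inclusion maps determine the intervals. So the diagram consists of the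
  points \<open>(x i, death x {1..n} i)\<close> with \<open>x i < death x {1..n} i\<close>, for every real sequence
  (\<open>path_filtration.pers_diagram_path\<close>).

  Deaths are local: if a window around \<open>i\<close> contains an older vertex on both sides of \<open>i\<close>, then no vertex
  outside it affects the death of \<open>i\<close> (\<open>settled_death_eq\<close>). Up to the vertices near the two ends
  and the vertices that are not settled in their window of radius \<open>R\<close>, the number of diagram points in a
  set \<open>U\<close> is therefore a Birkhoff sum of an indicator depending on \<open>2 R + 1\<close> coordinates
  (\<open>count_lower\<close>, \<open>count_upper\<close>), and the ergodic theorem gives its frequency. The probability of not
  being settled tends to \<open>0\<close> as \<open>R\<close> grows: since the marginal law has no atoms there is a level below
  which a single variable falls with small positive probability, and by ergodicity the sequence falls below it
  again and again (\<open>prob_unsettled_tendsto_0\<close>). Hence, for every Borel set \<open>U\<close>, the number of points in \<open>U\<close> divided by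
  \<open>n\<close> converges almost surely to \<open>\<mu>(U)\<close>, where \<open>\<mu>\<close> is the increasing limit, as \<open>R\<close> grows, of the laws of the
  points settled at radius \<open>R\<close> (\<open>point_count_frequency\<close>).

  The measure \<open>\<mu>\<close> is not zero. Otherwise there would be almost surely no local minima; as neighbouring
  entries differ, a descent would then always be followed by a descent, and by ergodicity the sequence
  would be almost surely monotone, which stationarity forbids (\<open>prob_local_min_pos\<close>). Settled points have a finite death, so \<open>\<mu>\<close> lives on the finite part of
  the half-plane. The limit is \<open>\<mu>\<close> divided by its mass. Convergence on the countably many finite
  unions of members of a countable base is enough for weak convergence (\<open>weak_conv_on_of_basis\<close>); this is
  applied on the half-plane with and without the points at infinity.
\<close>

section \<open>Birkhoff's ergodic theorem\<close>

locale ergodic_system = prob_space +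
  fixes T :: "'a \<Rightarrow> 'a"
  assumes T_measurable [measurable]: "T \<in> measurable M M"
    and T_preserves: "distr M M T = M"
    and T_ergodic: "A \<in> sets M \<Longrightarrow> (AE x in M. x \<in> A \<longleftrightarrow> T x \<in> A) \<Longrightarrow> prob A \<in> {0, 1}"
begin

lemma T_pow_measurable [measurable]: "(T ^^ k) \<in> measurable M M"
  by (induction k) (simp_all add: measurable_comp[OF _ T_measurable])

lemma T_pow_preserves: "distr M M (T ^^ k) = M"
proof (induction k)
  case 0
  show ?case by (simp add: id_def distr_id)
next
  case (Suc k)
  have "distr M M (T ^^ Suc k) = distr (distr M M (T ^^ k)) M T"
    by (simp only: distr_distr[OF T_measurable T_pow_measurable] funpow.simps)
  also have "\<dots> = M" using Suc T_preserves by simp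
  finally show ?case .
qed

lemma prob_vimage_pow:
  assumes "A \<in> sets M"
  shows "prob ((T ^^ k) -` A \<inter> space M) = prob A"
  using measure_distr[OF T_pow_measurable assms, of k] T_pow_preserves by simp

lemma AE_pow:
  assumes "AE x in M. P x"
  shows "AE x in M. P ((T ^^ k) x)"
proof (rule AE_distrD[OF T_pow_measurable])
  show "AE x in distr M M (T ^^ k). P x" unfolding T_pow_preserves by (rule assms)
qed

lemma integrable_comp_T:
  fixes g :: "'a \<Rightarrow> real"
  assumes "integrable M g"
  shows "integrable M (\<lambda>x. g (T x))"
  using integrable_distr[OF T_measurable, of g] assms T_preserves by simp

lemma integral_comp_T:
  fixes g :: "'a \<Rightarrow> real"
  assumes "g \<in> borel_measurable M"
  shows "(\<integral>x. g (T x) \<partial>M) = (\<integral>x. g x \<partial>M)"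
  using integral_distr[OF T_measurable, of g] assms T_preserves by simp

definition birkhoff_sum :: "('a \<Rightarrow> real) \<Rightarrow> nat \<Rightarrow> 'a \<Rightarrow> real" where
  "birkhoff_sum g n x = (\<Sum>k<n. g ((T ^^ k) x))"

lemma birkhoff_sum_Suc: "birkhoff_sum g (Suc n) x = g x + birkhoff_sum g n (T x)"
  unfolding birkhoff_sum_def by (simp add: sum.lessThan_Suc_shift funpow_swap1 del: sum.lessThan_Suc)

lemma birkhoff_sum_measurable [measurable]:
  assumes [measurable]: "g \<in> borel_measurable M"
  shows "birkhoff_sum g n \<in> borel_measurable M"
  unfolding birkhoff_sum_def by measurable

fun max_birkhoff_sum :: "('a \<Rightarrow> real) \<Rightarrow> nat \<Rightarrow> 'a \<Rightarrow> real" where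
  "max_birkhoff_sum g 0 x = 0"
| "max_birkhoff_sum g (Suc n) x = max 0 (g x + max_birkhoff_sum g n (T x))"

lemma max_birkhoff_sum_nonneg: "0 \<le> max_birkhoff_sum g n x"
  by (cases n) auto

lemma max_birkhoff_sum_step: "max_birkhoff_sum g n x \<le> max_birkhoff_sum g (Suc n) x"
proof (induction n arbitrary: x)
  case (Suc n)
  show ?case using Suc[of "T x"] by auto
qed simp

lemma birkhoff_sum_le_max: "birkhoff_sum g n x \<le> max_birkhoff_sum g n x"
proof (induction n arbitrary: x)
  case (Suc n)
  show ?case using Suc[of "T x"] by (auto simp: birkhoff_sum_Suc)
qed (simp add: birkhoff_sum_def)

lemma max_birkhoff_sum_integrable:
  assumes "integrable M g"
  shows "integrable M (max_birkhoff_sum g n)"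
proof (induction n)
  case (Suc n)
  show ?case
    using assms integrable_comp_T[OF Suc] by (simp add: fun_eq_iff[symmetric] integrable_max)
qed simp

text \<open>Where \<open>m = max_birkhoff_sum g (Suc n)\<close> is positive it equals \<open>g x + max_birkhoff_sum g n (T x) \<le> g x + m (T x)\<close>,
  and elsewhere \<open>m x - m (T x) \<le> 0\<close>. So \<open>m - m \<circ> T\<close>, whose integral vanishes, is at most \<open>g\<close> restricted
  to \<open>{m > 0}\<close>.\<close>
lemma maximal_inequality:
  assumes g: "integrable M g"
  shows "0 \<le> (\<integral>x. g x * indicator {x \<in> space M. 0 < max_birkhoff_sum g (Suc n) x} x \<partial>M)"
proof -
  let ?m = "max_birkhoff_sum g (Suc n)"
  have m: "integrable M ?m" by (rule max_birkhoff_sum_integrable[OF g])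
  have [measurable]: "?m \<in> borel_measurable M" using m by (rule borel_measurable_integrable)
  have "0 = (\<integral>x. ?m x - ?m (T x) \<partial>M)"
    using m integrable_comp_T[OF m] integral_comp_T[of ?m]
    by (simp del: max_birkhoff_sum.simps)
  also have "\<dots> \<le> (\<integral>x. g x * indicator {x \<in> space M. 0 < ?m x} x \<partial>M)"
  proof (rule integral_mono)
    show "integrable M (\<lambda>x. ?m x - ?m (T x))"
      using m integrable_comp_T[OF m] by (rule Bochner_Integration.integrable_diff)
    show "integrable M (\<lambda>x. g x * indicator {x \<in> space M. 0 < ?m x} x)"
      by (rule integrable_real_mult_indicator) (use g in measurable)
    fix x assume "x \<in> space M"
    then show "?m x - ?m (T x) \<le> g x * indicator {x \<in> space M. 0 < ?m x} x"
      using max_birkhoff_sum_step[of g n "T x"] max_birkhoff_sum_nonneg[of g "Suc n" "T x"]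
        max_birkhoff_sum_nonneg[of g "n" "T x"]
      by (auto simp: indicator_def max_def split: if_splits)
  qed
  finally show ?thesis .
qed

text \<open>Unboundedness of the Birkhoff sums is an invariant event. If it had probability one, then the sets in the
  maximal inequality would exhaust the space, and the integral of \<open>g\<close> would not be negative.\<close>
lemma birkhoff_sum_bounded_above:
  assumes g: "integrable M g" and neg: "(\<integral>x. g x \<partial>M) < 0"
  shows "AE x in M. \<exists>K::nat. \<forall>n. birkhoff_sum g n x \<le> real K"
proof -
  have [measurable]: "g \<in> borel_measurable M" using g by (rule borel_measurable_integrable)
  define A where "A = {x \<in> space M. \<forall>K::nat. \<exists>n. real K < birkhoff_sum g n x}"
  have [measurable]: "A \<in> sets M" unfolding A_def by measurable
  have inv: "x \<in> A \<longleftrightarrow> T x \<in> A" if x: "x \<in> space M" for x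
  proof -
    have Tx: "T x \<in> space M" using x T_measurable by (rule measurable_space[rotated])
    have "(\<forall>K::nat. \<exists>n. real K < birkhoff_sum g n x) \<longleftrightarrow> (\<forall>K::nat. \<exists>n. real K < birkhoff_sum g n (T x))"
    proof safe
      fix K :: nat assume *: "\<forall>K::nat. \<exists>n. real K < birkhoff_sum g n x"
      obtain K' :: nat where K': "real K + \<bar>g x\<bar> < real K'" using reals_Archimedean2 by blast
      from * obtain n where n: "real K' < birkhoff_sum g n x" by blast
      then obtain m where "n = Suc m" by (cases n) (auto simp: birkhoff_sum_def)
      with n K' show "\<exists>n. real K < birkhoff_sum g n (T x)"
        by (intro exI[of _ m]) (auto simp: birkhoff_sum_Suc)
    next
      fix K :: nat assume *: "\<forall>K::nat. \<exists>n. real K < birkhoff_sum g n (T x)"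
      obtain K' :: nat where K': "real K + \<bar>g x\<bar> < real K'" using reals_Archimedean2 by blast
      from * obtain n where n: "real K' < birkhoff_sum g n (T x)" by blast
      with K' show "\<exists>n. real K < birkhoff_sum g n x"
        by (intro exI[of _ "Suc n"]) (auto simp: birkhoff_sum_Suc)
    qed
    then show ?thesis using x Tx by (simp add: A_def)
  qed
  have "prob A \<in> {0, 1}" by (rule T_ergodic) (auto simp: inv intro!: AE_I2)
  moreover have "prob A \<noteq> 1"
  proof
    assume "prob A = 1"
    then have AA: "AE x in M. x \<in> A" by (simp add: prob_eq_1)
    have "(\<lambda>n. \<integral>x. g x * indicator {x \<in> space M. 0 < max_birkhoff_sum g (Suc n) x} x \<partial>M)
        \<longlonglongrightarrow> (\<integral>x. g x \<partial>M)"
    proof (rule integral_dominated_convergence[where w="\<lambda>x. norm (g x)"])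
      have m: "integrable M (max_birkhoff_sum g n)" for n by (rule max_birkhoff_sum_integrable[OF g])
      have [measurable]: "max_birkhoff_sum g n \<in> borel_measurable M" for n
        using m by (rule borel_measurable_integrable)
      show "(\<lambda>x. g x * indicator {x \<in> space M. 0 < max_birkhoff_sum g (Suc n) x} x) \<in> borel_measurable M" for n
        by measurable
      show "AE x in M. (\<lambda>n. g x * indicator {x \<in> space M. 0 < max_birkhoff_sum g (Suc n) x} x) \<longlonglongrightarrow> g x"
        using AA
      proof eventually_elim
        fix x assume "x \<in> A"
        then have x: "x \<in> space M" and "\<exists>n. real 0 < birkhoff_sum g n x" unfolding A_def by blast+
        then obtain N where N: "0 < birkhoff_sum g N x" by auto
        have "0 < max_birkhoff_sum g n x" if "N \<le> n" for n
          using that N birkhoff_sum_le_max[of g N x]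
            lift_Suc_mono_le[of "\<lambda>n. max_birkhoff_sum g n x", OF max_birkhoff_sum_step that] by linarith
        then have "\<forall>\<^sub>F n in sequentially. g x * indicator {x \<in> space M. 0 < max_birkhoff_sum g (Suc n) x} x = g x"
          using x by (intro eventually_sequentiallyI[of N]) (simp del: max_birkhoff_sum.simps)
        then show "(\<lambda>n. g x * indicator {x \<in> space M. 0 < max_birkhoff_sum g (Suc n) x} x) \<longlonglongrightarrow> g x"
          by (rule tendsto_eventually)
      qed
    qed (use g in \<open>auto simp: indicator_def\<close>)
    then have "0 \<le> (\<integral>x. g x \<partial>M)"
      using maximal_inequality[OF g] by (intro LIMSEQ_le_const) auto
    with neg show False by simp
  qed
  ultimately have "prob A = 0" by auto
  then have "AE x in M. x \<notin> A" by (simp add: prob_eq_0)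
  with AE_space show ?thesis by eventually_elim (force simp: A_def not_less)
qed

text \<open>Subtracting slightly more than the mean from \<open>g\<close> makes the integral negative, so the corrected sums are
  bounded above; dividing by \<open>n\<close> removes the bound.\<close>
lemma birkhoff_limsup:
  assumes g: "integrable M g"
  shows "AE x in M. \<forall>e>0. \<forall>\<^sub>F n in sequentially. birkhoff_sum g n x / real n < (\<integral>x. g x \<partial>M) + e"
proof -
  have "AE x in M. \<exists>K::nat. \<forall>n. birkhoff_sum (\<lambda>x. g x - ((\<integral>x. g x \<partial>M) + 1 / real (Suc j))) n x \<le> real K" for j
    by (rule birkhoff_sum_bounded_above) (use g in \<open>auto simp: prob_space\<close>)
  then have "AE x in M. \<forall>j. \<exists>K::nat. \<forall>n. birkhoff_sum (\<lambda>x. g x - ((\<integral>x. g x \<partial>M) + 1 / real (Suc j))) n x \<le> real K"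
    by (simp add: AE_all_countable)
  then show ?thesis
  proof eventually_elim
    fix x assume *: "\<forall>j. \<exists>K::nat. \<forall>n. birkhoff_sum (\<lambda>x. g x - ((\<integral>x. g x \<partial>M) + 1 / real (Suc j))) n x \<le> real K"
    show "\<forall>e>0. \<forall>\<^sub>F n in sequentially. birkhoff_sum g n x / real n < (\<integral>x. g x \<partial>M) + e"
    proof (intro allI impI)
      fix e :: real assume "0 < e"
      then obtain j where j: "1 / real (Suc j) < e / 2" using nat_approx_posE[of "e/2"] by auto
      from * obtain K where K: "birkhoff_sum (\<lambda>x. g x - ((\<integral>x. g x \<partial>M) + 1 / real (Suc j))) n x \<le> real K" for n
        by blast
      have "(\<lambda>n. real K / real n) \<longlonglongrightarrow> 0" by (rule lim_const_over_n)
      then have "\<forall>\<^sub>F n in sequentially. real K / real n < e / 2"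
        using \<open>0 < e\<close> by (intro order_tendstoD) auto
      with eventually_gt_at_top[of 0]
      show "\<forall>\<^sub>F n in sequentially. birkhoff_sum g n x / real n < (\<integral>x. g x \<partial>M) + e"
      proof eventually_elim
        fix n :: nat assume n: "0 < n" "real K / real n < e / 2"
        have "birkhoff_sum g n x \<le> real K + real n * ((\<integral>x. g x \<partial>M) + 1 / real (Suc j))"
          using K[of n] by (simp add: birkhoff_sum_def sum_subtractf)
        then have "birkhoff_sum g n x / real n
            \<le> (real K + real n * ((\<integral>x. g x \<partial>M) + 1 / real (Suc j))) / real n"
          by (rule divide_right_mono) simp
        also have "\<dots> = real K / real n + ((\<integral>x. g x \<partial>M) + 1 / real (Suc j))"
          using n by (simp add: add_divide_distrib)
        finally show "birkhoff_sum g n x / real n < (\<integral>x. g x \<partial>M) + e" using n j by linarith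
      qed
    qed
  qed
qed

theorem birkhoff_ergodic:
  assumes g: "integrable M g"
  shows "AE x in M. (\<lambda>n. birkhoff_sum g n x / real n) \<longlonglongrightarrow> (\<integral>x. g x \<partial>M)"
proof -
  have "AE x in M. \<forall>e>0. \<forall>\<^sub>F n in sequentially. birkhoff_sum (\<lambda>x. - g x) n x / real n < - (\<integral>x. g x \<partial>M) + e"
    using birkhoff_limsup[of "\<lambda>x. - g x"] g by simp
  with birkhoff_limsup[OF g] show ?thesis
  proof eventually_elim
    case (elim x)
    show ?case
    proof (rule tendstoI)
      fix e :: real assume "0 < e"
      with elim have "\<forall>\<^sub>F n in sequentially. birkhoff_sum g n x / real n < (\<integral>x. g x \<partial>M) + e"
        and "\<forall>\<^sub>F n in sequentially. birkhoff_sum (\<lambda>x. - g x) n x / real n < - (\<integral>x. g x \<partial>M) + e" by auto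
      then show "\<forall>\<^sub>F n in sequentially. dist (birkhoff_sum g n x / real n) (\<integral>x. g x \<partial>M) < e"
        by eventually_elim (auto simp: birkhoff_sum_def sum_negf dist_real_def)
    qed
  qed
qed

text \<open>\<open>A\<close> is almost surely contained in its preimage, which has the same probability, so the two agree almost surely.\<close>
lemma subinvariant_trivial:
  assumes A: "A \<in> sets M" and sub: "AE x in M. x \<in> A \<longrightarrow> T x \<in> A"
  shows "prob A \<in> {0, 1}"
proof (rule T_ergodic[OF A])
  let ?B = "T -` A \<inter> space M"
  have [measurable]: "?B \<in> sets M" using A T_measurable by (rule measurable_sets[rotated])
  have "prob ?B = prob A" using prob_vimage_pow[OF A, of 1] by simp
  moreover have "prob (?B \<inter> A) = prob A"
  proof (rule measure_eq_AE)
    show "AE x in M. (x \<in> ?B \<inter> A) = (x \<in> A)" using sub AE_space by eventually_elim auto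
  qed (use A in auto)
  ultimately have "prob (?B - A) = 0"
    using finite_measure_Diff'[of ?B A] A by simp
  then have "AE x in M. x \<notin> ?B - A" using A by (subst (asm) prob_eq_0) auto
  with sub AE_space show "AE x in M. x \<in> A \<longleftrightarrow> T x \<in> A" by eventually_elim auto
qed

text \<open>The increment \<open>g \<circ> T - g\<close> has integral zero, so it cannot be positive almost surely.\<close>
lemma no_drift:
  fixes g :: "'a \<Rightarrow> real"
  assumes g: "integrable M g" and less: "AE x in M. g x < g (T x)"
  shows False
proof -
  have gm: "g \<in> borel_measurable M" using g by (rule borel_measurable_integrable)
  have int: "integrable M (\<lambda>x. g (T x) - g x)" using g integrable_comp_T[OF g] by simp
  have "(\<integral>x. g (T x) - g x \<partial>M) = 0" using g integrable_comp_T[OF g] integral_comp_T[OF gm] by simp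
  then have "AE x in M. g (T x) - g x = 0"
    using less by (subst (asm) integral_nonneg_eq_0_iff_AE[OF int]) (auto elim: eventually_mono)
  with less have "AE x in M. False" by eventually_elim simp
  then show False by simp
qed

end

section \<open>A criterion for weak convergence\<close>

text \<open>An open set is exhausted, up to small \<open>\<nu>\<close>-mass, by a finite union of basic sets, on which the masses converge.\<close>
lemma open_measure_liminf:
  fixes \<mu> :: "nat \<Rightarrow> 'a::topological_space measure" and B :: "'a set set"
  assumes B: "topological_basis B" "countable B"
    and S: "open S"
    and ps: "\<forall>\<^sub>F n in sequentially. prob_space (\<mu> n) \<and> sets (\<mu> n) = sets (restrict_space borel S)"
    and \<nu>: "prob_space \<nu>" "sets \<nu> = sets (restrict_space borel S)"
    and conv: "\<And>F. finite F \<Longrightarrow> F \<subseteq> B \<Longrightarrow> (\<lambda>n. measure (\<mu> n) (\<Union>F \<inter> S)) \<longlonglongrightarrow> measure \<nu> (\<Union>F \<inter> S)"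
    and G: "open G" "G \<subseteq> S" and e: "0 < e"
  shows "\<forall>\<^sub>F n in sequentially. measure \<nu> G - e < measure (\<mu> n) G"
proof -
  interpret \<nu>: prob_space \<nu> by fact
  obtain B' where B': "B' \<subseteq> B" "\<Union>B' = G" using B(1) G(1) by (auto simp: topological_basis_def)
  have sets_open: "H \<in> sets \<nu>" if "open H" "H \<subseteq> S" for H
    using that \<open>open S\<close> by (simp add: \<nu>(2) sets_restrict_space_iff)
  have openB: "open (\<Union>F)" if "F \<subseteq> B" for F
    using that B(1) by (auto intro!: open_Union simp: topological_basis_open)
  have "\<exists>F. finite F \<and> F \<subseteq> B' \<and> measure \<nu> G - e / 2 < measure \<nu> (\<Union>F)"
  proof (cases "B' = {}")
    case True
    then show ?thesis using B'(2) e by (intro exI[of _ "{}"]) auto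
  next
    case False
    have "countable B'" using B' B(2) countable_subset by blast
    define A where "A k = from_nat_into B' k" for k
    have rA: "range A = B'" unfolding A_def using range_from_nat_into[OF False \<open>countable B'\<close>] .
    define U where "U k = \<Union>(A ` {..k})" for k
    have sub: "U k \<subseteq> G" for k using rA B'(2) by (auto simp: U_def)
    have "open (U k)" for k unfolding U_def using rA B'(1) by (intro openB) auto
    then have "range U \<subseteq> sets \<nu>" using sub G(2) sets_open by blast
    moreover have "incseq U" unfolding incseq_def U_def by (auto intro: order_trans)
    ultimately have "(\<lambda>k. measure \<nu> (U k)) \<longlonglongrightarrow> measure \<nu> (\<Union>k. U k)"
      by (rule \<nu>.finite_Lim_measure_incseq)
    also have "(\<Union>k. U k) = G"
    proof -
      have "(\<Union>k. U k) = \<Union>(range A)" by (auto simp: U_def)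
      then show ?thesis using rA B'(2) by simp
    qed
    finally have "\<forall>\<^sub>F k in sequentially. measure \<nu> G - e / 2 < measure \<nu> (U k)"
      by (rule order_tendstoD) (use e in simp)
    then obtain k where "measure \<nu> G - e / 2 < measure \<nu> (U k)"
      using eventually_happens'[OF sequentially_bot] by blast
    then show ?thesis using rA by (intro exI[of _ "A ` {..k}"]) (auto simp: U_def)
  qed
  then obtain F where F: "finite F" "F \<subseteq> B'" "measure \<nu> G - e / 2 < measure \<nu> (\<Union>F)" by blast
  have FG: "\<Union>F \<subseteq> G" using F(2) B'(2) by blast
  then have "\<Union>F \<inter> S = \<Union>F" using G(2) by blast
  then have "(\<lambda>n. measure (\<mu> n) (\<Union>F)) \<longlonglongrightarrow> measure \<nu> (\<Union>F)"
    using conv[of F] F B'(1) by auto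
  then have "\<forall>\<^sub>F n in sequentially. measure \<nu> (\<Union>F) - e / 2 < measure (\<mu> n) (\<Union>F)"
    by (rule order_tendstoD) (use e in simp)
  with ps show ?thesis
  proof eventually_elim
    case (elim n)
    then interpret prob_space "\<mu> n" by simp
    have "G \<in> sets (\<mu> n)" using sets_open[OF G] elim \<nu>(2) by simp
    then have "measure (\<mu> n) (\<Union>F) \<le> measure (\<mu> n) G" using FG by (intro finite_measure_mono)
    with elim F(3) show ?case by linarith
  qed
qed

text \<open>The number of levels \<open>k / m\<close> with \<open>1 \<le> k \<le> m\<close> that lie below \<open>u\<close> approximates \<open>m u\<close> from below with error at most
  one. Integrated, this approximates the integral of a function by the masses of its superlevel sets.\<close>
lemma layer_sum_bounds:
  fixes u :: real and m :: nat
  assumes "0 \<le> u" "u < 1" "0 < m"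
  shows "(\<Sum>k=1..m. indicator {real k / real m<..} u) \<le> real m * u"
    and "real m * u \<le> (\<Sum>k=1..m. indicator {real k / real m<..} u) + 1"
proof -
  define c where "c = nat (\<lceil>real m * u\<rceil> - 1)"
  have c: "real k < real m * u \<longleftrightarrow> k \<le> c" if "1 \<le> k" for k :: nat
  proof -
    have "real k < real m * u \<longleftrightarrow> int k \<le> \<lceil>real m * u\<rceil> - 1" by linarith
    also have "\<dots> \<longleftrightarrow> k \<le> c" using that unfolding c_def by linarith
    finally show ?thesis .
  qed
  have "real m * u \<le> real m" using assms by simp
  then have cm: "c \<le> m" unfolding c_def by linarith
  have "(\<Sum>k=1..m. indicator {real k / real m<..} u) = (\<Sum>k=1..m. if k \<le> c then 1 else 0 :: real)"
    using assms c by (intro sum.cong) (auto simp: indicator_def field_simps)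
  also have "\<dots> = real (card ({1..m} \<inter> {k. k \<le> c}))" by (simp add: sum.If_cases)
  also have "{1..m} \<inter> {k. k \<le> c} = {1..c}" using cm by auto
  finally have eq: "(\<Sum>k=1..m. indicator {real k / real m<..} u) = real c" by simp
  have "0 \<le> real m * u" using assms by simp
  then show "(\<Sum>k=1..m. indicator {real k / real m<..} u) \<le> real m * u"
    and "real m * u \<le> (\<Sum>k=1..m. indicator {real k / real m<..} u) + 1"
    unfolding eq c_def by linarith+
qed

lemma integral_layer_bounds:
  fixes f :: "'a \<Rightarrow> real" and m :: nat
  assumes "prob_space N" and f: "f \<in> borel_measurable N" "\<And>x. x \<in> space N \<Longrightarrow> 0 \<le> f x \<and> f x < 1" and m: "0 < m"
  shows "(\<Sum>k=1..m. measure N {x \<in> space N. real k / real m < f x}) \<le> real m * integral\<^sup>L N f"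
    and "real m * integral\<^sup>L N f \<le> (\<Sum>k=1..m. measure N {x \<in> space N. real k / real m < f x}) + 1"
proof -
  interpret prob_space N by fact
  note [measurable] = f(1)
  have int: "integrable N f"
    by (rule integrable_const_bound[where B = 1]) (use f in \<open>force intro!: AE_I2\<close>)+
  define s where "s x = (\<Sum>k=1..m. indicator {x \<in> space N. real k / real m < f x} x :: real)" for x :: 'a
  have s: "integrable N s" "integral\<^sup>L N s = (\<Sum>k=1..m. measure N {x \<in> space N. real k / real m < f x})"
  proof -
    have ind: "integrable N (indicat_real {x \<in> space N. c < f x})" for c
      by (rule integrable_real_indicator) (auto simp: emeasure_eq_measure)
    then show "integrable N s" "integral\<^sup>L N s = (\<Sum>k=1..m. measure N {x \<in> space N. real k / real m < f x})"
      unfolding s_def using ind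
      by (auto simp: Bochner_Integration.integral_sum[OF ind] Int_absorb1 intro!: Bochner_Integration.integrable_sum)
  qed
  have sx: "s x \<le> real m * f x" "real m * f x \<le> s x + 1" if x: "x \<in> space N" for x
  proof -
    have "s x = (\<Sum>k=1..m. indicator {real k / real m<..} (f x))"
      unfolding s_def using x by (intro sum.cong) (auto simp: indicator_def)
    then show "s x \<le> real m * f x" "real m * f x \<le> s x + 1"
      using layer_sum_bounds[of "f x" m] f(2)[OF x] m by auto
  qed
  have "integral\<^sup>L N s \<le> integral\<^sup>L N (\<lambda>x. real m * f x)"
    by (rule integral_mono) (use int s sx in auto)
  then show "(\<Sum>k=1..m. measure N {x \<in> space N. real k / real m < f x}) \<le> real m * integral\<^sup>L N f"
    by (simp add: s)
  have "integral\<^sup>L N (\<lambda>x. real m * f x) \<le> integral\<^sup>L N (\<lambda>x. s x + 1)"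
    by (rule integral_mono) (use int s sx in auto)
  then show "real m * integral\<^sup>L N f \<le> (\<Sum>k=1..m. measure N {x \<in> space N. real k / real m < f x}) + 1"
    using s by (simp add: prob_space)
qed

text \<open>Superlevel sets of continuous functions are open, so by the layer sums the lower bound for open sets passes to
  integrals of functions with values in \<open>[0, 1)\<close>. A bounded function \<open>f\<close> and its negative are brought into that
  range by \<open>(\<plusminus> f + b) / (2 b)\<close>, and the two lower bounds together give convergence.\<close>
lemma weak_conv_on_of_basis:
  fixes \<mu> :: "nat \<Rightarrow> 'a::topological_space measure" and B :: "'a set set"
  assumes B: "topological_basis B" "countable B"
    and S: "open S"
    and ps: "\<forall>\<^sub>F n in sequentially. prob_space (\<mu> n) \<and> sets (\<mu> n) = sets (restrict_space borel S)"
    and \<nu>: "prob_space \<nu>" "sets \<nu> = sets (restrict_space borel S)"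
    and conv: "\<And>F. finite F \<Longrightarrow> F \<subseteq> B \<Longrightarrow> (\<lambda>n. measure (\<mu> n) (\<Union>F \<inter> S)) \<longlonglongrightarrow> measure \<nu> (\<Union>F \<inter> S)"
  shows "weak_conv_on S \<mu> \<nu>"
proof -
  interpret \<nu>: prob_space \<nu> by fact
  have meas: "f \<in> borel_measurable N" if "sets N = sets (restrict_space borel S)" "continuous_on S f"
    for N and f :: "'a \<Rightarrow> real"
    using borel_measurable_continuous_on_restrict[OF that(2)] that(1) measurable_cong_sets by blast
  have spc: "space N = S" if "sets N = sets (restrict_space borel S)" for N :: "'a measure"
    using sets_eq_imp_space_eq[OF that] by (simp add: space_restrict_space)
  have unit: "\<forall>\<^sub>F n in sequentially. integral\<^sup>L \<nu> g - e < integral\<^sup>L (\<mu> n) g"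
    if g: "continuous_on S g" "\<And>x. x \<in> S \<Longrightarrow> 0 \<le> g x \<and> g x < 1" and e: "0 < e"
    for g :: "'a \<Rightarrow> real" and e :: real
  proof -
    obtain m :: nat where m: "0 < m" "2 / e < real m"
      by (metis gr0I less_trans reals_Archimedean2 divide_pos_pos e of_nat_0 zero_less_numeral less_asym)
    have opn: "open {x \<in> S. c < g x}" for c
    proof -
      have "{x \<in> S. c < g x} = S \<inter> g -` {c<..}" by auto
      then show ?thesis using continuous_open_preimage[OF g(1) S, of "{c<..}"] by simp
    qed
    define d where "d = (e * real m - 1) / real m"
    have "0 < d" using m e by (simp add: d_def field_simps)
    have "\<forall>\<^sub>F n in sequentially. \<forall>k\<in>{1..m}.
        measure \<nu> {x \<in> S. real k / real m < g x} - d < measure (\<mu> n) {x \<in> S. real k / real m < g x}"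
      using open_measure_liminf[OF B S ps \<nu> conv opn _ \<open>0 < d\<close>]
      by (intro eventually_ball_finite) auto
    with ps show ?thesis
    proof eventually_elim
      case (elim n)
      then have N: "prob_space (\<mu> n)" "sets (\<mu> n) = sets (restrict_space borel S)" by auto
      have "real m * integral\<^sup>L \<nu> g \<le> (\<Sum>k=1..m. measure \<nu> {x \<in> S. real k / real m < g x}) + 1"
        using integral_layer_bounds(2)[OF \<nu>(1) meas[OF \<nu>(2) g(1)] _ m(1)] g(2) by (simp add: spc[OF \<nu>(2)])
      also have "(\<Sum>k=1..m. measure \<nu> {x \<in> S. real k / real m < g x})
          < (\<Sum>k=1..m. measure (\<mu> n) {x \<in> S. real k / real m < g x} + d)"
        using elim m(1) by (intro sum_strict_mono) (auto simp: algebra_simps)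
      also have "\<dots> = (\<Sum>k=1..m. measure (\<mu> n) {x \<in> S. real k / real m < g x}) + (e * real m - 1)"
        using m(1) by (simp add: sum.distrib d_def)
      also have "(\<Sum>k=1..m. measure (\<mu> n) {x \<in> S. real k / real m < g x}) \<le> real m * integral\<^sup>L (\<mu> n) g"
        using integral_layer_bounds(1)[OF N(1) meas[OF N(2) g(1)] _ m(1)] g(2) by (simp add: spc[OF N(2)])
      finally have "real m * integral\<^sup>L \<nu> g < real m * (integral\<^sup>L (\<mu> n) g + e)"
        by (simp add: algebra_simps)
      then show ?case using m(1) by simp
    qed
  qed
  have "(\<lambda>n. integral\<^sup>L (\<mu> n) f) \<longlonglongrightarrow> integral\<^sup>L \<nu> f"
    if f: "continuous_on S f" "bounded (f ` S)" for f :: "'a \<Rightarrow> real"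
  proof -
    obtain b where b: "0 < b" "\<And>x. x \<in> S \<Longrightarrow> \<bar>f x\<bar> < b"
    proof -
      from f(2) obtain b where "\<And>x. x \<in> S \<Longrightarrow> \<bar>f x\<bar> \<le> b" by (auto simp: bounded_iff)
      then show ?thesis using that[of "\<bar>b\<bar> + 1"] by force
    qed
    have affine: "integral\<^sup>L N (\<lambda>x. (c * f x + b) / (2 * b)) = (c * integral\<^sup>L N f + b) / (2 * b)"
      if N: "prob_space N" "sets N = sets (restrict_space borel S)" for N :: "'a measure" and c :: real
    proof -
      interpret N: prob_space N by fact
      have "integrable N f"
        by (rule N.integrable_const_bound[where B = b])
          (use meas[OF N(2) f(1)] b spc[OF N(2)] in \<open>auto intro!: AE_I2 less_imp_le\<close>)
      then show ?thesis using b by (simp add: N.prob_space)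
    qed
    have lower: "\<forall>\<^sub>F n in sequentially. c * integral\<^sup>L \<nu> f - e < c * integral\<^sup>L (\<mu> n) f"
      if c: "\<bar>c\<bar> = 1" and e: "0 < e" for c e :: real
    proof -
      have rng: "0 \<le> (c * f x + b) / (2 * b) \<and> (c * f x + b) / (2 * b) < 1" if "x \<in> S" for x
      proof -
        have "\<bar>c * f x\<bar> < b" using b(2)[OF that] c by (simp add: abs_mult)
        then show ?thesis using b(1) by (auto simp: field_simps abs_less_iff)
      qed
      have "\<forall>\<^sub>F n in sequentially. integral\<^sup>L \<nu> (\<lambda>x. (c * f x + b) / (2 * b)) - e / (2 * b)
          < integral\<^sup>L (\<mu> n) (\<lambda>x. (c * f x + b) / (2 * b))"
        by (rule unit) (use f(1) rng e b(1) in \<open>auto intro!: continuous_intros\<close>)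
      with ps show ?thesis
      proof eventually_elim
        case (elim n)
        have "(c * integral\<^sup>L \<nu> f + b) / (2 * b) - e / (2 * b) < (c * integral\<^sup>L (\<mu> n) f + b) / (2 * b)"
          using elim(2) affine[OF \<nu>, of c] affine[of "\<mu> n" c] elim(1) by metis
        then show ?case using b(1) by (simp add: diff_divide_distrib[symmetric] divide_less_cancel)
      qed
    qed
    show ?thesis
    proof (rule tendstoI)
      fix e :: real assume "0 < e"
      then have "\<forall>\<^sub>F n in sequentially. 1 * integral\<^sup>L \<nu> f - e < 1 * integral\<^sup>L (\<mu> n) f"
        and "\<forall>\<^sub>F n in sequentially. (-1) * integral\<^sup>L \<nu> f - e < (-1) * integral\<^sup>L (\<mu> n) f"
        by (intro lower; simp)+
      then show "\<forall>\<^sub>F n in sequentially. dist (integral\<^sup>L (\<mu> n) f) (integral\<^sup>L \<nu> f) < e"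
        by eventually_elim (auto simp: dist_real_def)
    qed
  qed
  with ps \<nu> show ?thesis by (simp add: weak_conv_on_def)
qed

section \<open>Merge heights and deaths on a path\<close>

text \<open>The level from which on the vertices \<open>i\<close> and \<open>j\<close> of the path lie in the same component.\<close>
definition merge_height :: "(nat \<Rightarrow> real) \<Rightarrow> nat \<Rightarrow> nat \<Rightarrow> real" where
  "merge_height x i j = Max (x ` {min i j..max i j})"

text \<open>Breaking ties by index makes this order linear on vertices, so that every component has exactly one oldest vertex.\<close>
definition older :: "(nat \<Rightarrow> real) \<Rightarrow> nat \<Rightarrow> nat \<Rightarrow> bool" where
  "older x j i \<longleftrightarrow> x j < x i \<or> x j = x i \<and> j < i"

text \<open>The elder rule. The oldest vertex of \<open>A\<close> has death \<open>\<infinity>\<close>, the infimum of the empty set.\<close>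
definition death :: "(nat \<Rightarrow> real) \<Rightarrow> nat set \<Rightarrow> nat \<Rightarrow> ereal" where
  "death x A i = (INF j\<in>{j \<in> A. older x j i}. ereal (merge_height x i j))"

lemma merge_height_le_iff: "merge_height x i j \<le> t \<longleftrightarrow> (\<forall>k\<in>{min i j..max i j}. x k \<le> t)"
  unfolding merge_height_def by (subst Max_le_iff) auto

lemma merge_height_self [simp]: "merge_height x i i = x i"
  by (simp add: merge_height_def)

lemma merge_height_commute: "merge_height x i j = merge_height x j i"
  by (simp add: merge_height_def min.commute max.commute)

lemma merge_height_ge: "x i \<le> merge_height x i j" "x j \<le> merge_height x i j"
  using merge_height_le_iff[of x i j "merge_height x i j"] by auto

lemma merge_height_ultrametric:
  "merge_height x i k \<le> max (merge_height x i j) (merge_height x j k)"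
proof -
  have "x l \<le> max (merge_height x i j) (merge_height x j k)" if "l \<in> {min i k..max i k}" for l
  proof -
    have "l \<in> {min i j..max i j} \<or> l \<in> {min j k..max j k}" using that by auto
    then show ?thesis
      using merge_height_le_iff[of x i j "merge_height x i j"]
        merge_height_le_iff[of x j k "merge_height x j k"] by (auto simp: le_max_iff_disj)
  qed
  then show ?thesis by (subst merge_height_le_iff) blast
qed

lemma merge_height_mono:
  assumes "{min i j..max i j} \<subseteq> {min i k..max i k}"
  shows "merge_height x i j \<le> merge_height x i k"
  using assms merge_height_le_iff[of x i k "merge_height x i k"]
  by (subst merge_height_le_iff) blast

lemma merge_height_shift: "merge_height (\<lambda>k. x (k + m)) i j = merge_height x (i + m) (j + m)"
proof -
  have "x ` {min (i+m) (j+m)..max (i+m) (j+m)} = (\<lambda>k. x (k+m)) ` {min i j..max i j}"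
    unfolding image_image[of x "\<lambda>k. k + m", symmetric] image_add_atLeastAtMost'
    by (simp add: min_def max_def)
  then show ?thesis by (simp add: merge_height_def)
qed

lemma older_irrefl [simp]: "\<not> older x i i"
  by (simp add: older_def)

lemma older_linear: "i \<noteq> j \<Longrightarrow> older x i j \<or> older x j i"
  by (auto simp: older_def)

lemma death_shift: "death (\<lambda>k. x (k + m)) A i = death x ((\<lambda>k. k + m) ` A) (i + m)"
proof -
  have "{j \<in> (\<lambda>k. k + m) ` A. older x j (i + m)} = (\<lambda>k. k + m) ` {j \<in> A. older (\<lambda>k. x (k + m)) j i}"
    by (auto simp: older_def)
  then show ?thesis
    by (simp add: death_def merge_height_shift image_image)
qed

lemma death_le: "j \<in> A \<Longrightarrow> older x j i \<Longrightarrow> death x A i \<le> ereal (merge_height x i j)"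
  unfolding death_def by (rule INF_lower) simp

lemma less_death_iff:
  assumes "finite A"
  shows "ereal t < death x A i \<longleftrightarrow> (\<forall>j\<in>A. older x j i \<longrightarrow> t < merge_height x i j)"
proof (cases "{j \<in> A. older x j i} = {}")
  case True
  show ?thesis unfolding death_def True using True by (auto simp: top_ereal_def)
next
  case False
  then have "death x A i = Min ((\<lambda>j. ereal (merge_height x i j)) ` {j \<in> A. older x j i})"
    unfolding death_def using assms by (subst Min_Inf) auto
  then show ?thesis using assms False by (subst \<open>death x A i = _\<close>, subst Min_gr_iff) auto
qed

text \<open>The asymmetry between \<open>\<le>\<close> on the left and \<open><\<close> on the right is that of \<open>older\<close>: both witnesses are older than \<open>i\<close>.\<close>
definition settled :: "(nat \<Rightarrow> real) \<Rightarrow> nat set \<Rightarrow> nat \<Rightarrow> bool" where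
  "settled y A i \<longleftrightarrow> (\<exists>l\<in>A. l < i \<and> y l \<le> y i) \<and> (\<exists>r\<in>A. i < r \<and> y r < y i)"

lemma settled_mono: "settled y A i \<Longrightarrow> A \<subseteq> B \<Longrightarrow> settled y B i"
  unfolding settled_def by blast

lemma settled_shift: "settled (\<lambda>k. y (k + m)) A i \<longleftrightarrow> settled y ((\<lambda>k. k + m) ` A) (i + m)"
  unfolding settled_def by auto

lemma settled_death_less_infinity:
  assumes "settled y A i"
  shows "death y A i < \<infinity>"
proof -
  obtain r where "r \<in> A" "older y r i" using assms by (auto simp: settled_def older_def)
  from death_le[OF this] show ?thesis by (auto intro: le_less_trans)
qed

text \<open>An older vertex outside \<open>{a..b}\<close> is separated from \<open>i\<close> by one of the two older vertices inside, which merges with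
  \<open>i\<close> no later.\<close>
lemma settled_death_eq:
  assumes s: "settled y {a..b} i" and AB: "{a..b} \<subseteq> B"
  shows "death y B i = death y {a..b} i"
proof (rule antisym)
  show "death y B i \<le> death y {a..b} i"
    unfolding death_def using AB by (intro INF_superset_mono) auto
  show "death y {a..b} i \<le> death y B i"
    unfolding death_def[of y B]
  proof (rule INF_greatest)
    fix j assume j: "j \<in> {j \<in> B. older y j i}"
    obtain l where l: "l \<in> {a..b}" "l < i" "older y l i"
      using s by (auto simp: settled_def older_def order.order_iff_strict)
    obtain r where r: "r \<in> {a..b}" "i < r" "older y r i"
      using s by (auto simp: settled_def older_def)
    consider "j \<in> {a..b}" | "j < a" | "b < j" by force
    then show "death y {a..b} i \<le> ereal (merge_height y i j)"
    proof cases
      case 1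
      then show ?thesis using j by (intro death_le) auto
    next
      case 2
      have "merge_height y i l \<le> merge_height y i j"
        by (rule merge_height_mono) (use 2 l in auto)
      with death_le[OF l(1,3)] show ?thesis by (meson ereal_less_eq(3) order.trans)
    next
      case 3
      have "merge_height y i r \<le> merge_height y i j"
        by (rule merge_height_mono) (use 3 r in auto)
      with death_le[OF r(1,3)] show ?thesis by (meson ereal_less_eq(3) order.trans)
    qed
  qed
qed

text \<open>Every path from \<open>i\<close> to another vertex passes through a neighbour of \<open>i\<close>. The hypotheses also exclude \<open>i = 0\<close>,
  where \<open>i - 1 = i\<close>.\<close>
lemma strict_local_min_less_death:
  assumes A: "finite A" and lm: "y (i - 1) > y i" "y (i + 1) > y i"
  shows "ereal (y i) < death y A i"
proof -
  have "y i < merge_height y i j" if "older y j i" for j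
  proof -
    have "j \<noteq> i" using that by auto
    then have "i - 1 \<in> {min i j..max i j} \<or> i + 1 \<in> {min i j..max i j}" by auto
    then have "y (i - 1) \<le> merge_height y i j \<or> y (i + 1) \<le> merge_height y i j"
      using merge_height_le_iff[of y i j "merge_height y i j"] by auto
    with lm show ?thesis by linarith
  qed
  then show ?thesis using less_death_iff[OF A] by blast
qed

text \<open>A vertex whose death equals its value enters a component that is already there, and contributes no point.\<close>
definition path_births :: "(nat \<Rightarrow> real) \<Rightarrow> nat set \<Rightarrow> nat set" where
  "path_births x A = {i \<in> A. ereal (x i) < death x A i}"

definition pers_point :: "(nat \<Rightarrow> real) \<Rightarrow> nat set \<Rightarrow> nat \<Rightarrow> ereal \<times> ereal" where
  "pers_point x A i = (ereal (x i), death x A i)"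

text \<open>The event, depending on the first \<open>2 R + 1\<close> coordinates only, that the vertex \<open>R\<close> is settled within this window
  and contributes a point in \<open>U\<close>.\<close>
definition settled_in :: "nat \<Rightarrow> (ereal \<times> ereal) set \<Rightarrow> (nat \<Rightarrow> real) set" where
  "settled_in R U = {y. settled y {..2 * R} R \<and> R \<in> path_births y {..2 * R} \<and> pers_point y {..2 * R} R \<in> U}"

lemma shift_settled_in:
  "(\<lambda>i. y (i + k)) \<in> settled_in R U \<longleftrightarrow>
     settled y {k..k + 2 * R} (k + R) \<and> k + R \<in> path_births y {k..k + 2 * R} \<and>
     pers_point y {k..k + 2 * R} (k + R) \<in> U"
proof -
  have "(\<lambda>i. i + k) ` {..2 * R} = {k..k + 2 * R}"
    using image_add_atLeastAtMost'[of k 0 "2 * R"] by (simp add: atMost_atLeast0 add.commute)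
  then show ?thesis
    by (simp add: settled_in_def settled_shift path_births_def pers_point_def death_shift add.commute)
qed

text \<open>Once \<open>k + R\<close> is settled, the diagram of every larger set of vertices has the same point at this vertex.\<close>
lemma shift_settled_in_iff:
  assumes "settled y {k..k + 2 * R} (k + R)" "{k..k + 2 * R} \<subseteq> B"
  shows "(\<lambda>i. y (i + k)) \<in> settled_in R U \<longleftrightarrow> k + R \<in> path_births y B \<and> pers_point y B (k + R) \<in> U"
  using assms settled_death_eq[OF assms]
  by (auto simp: shift_settled_in path_births_def pers_point_def)

text \<open>Only for the last \<open>2 R\<close> values of \<open>k\<close> does the window \<open>{k..k + 2 * R}\<close> leave \<open>{..<n}\<close>.\<close>
lemma count_lower:
  "card {k\<in>{..<n}. (\<lambda>i. y (i + k)) \<in> settled_in R U} \<le>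
   card {i \<in> path_births y {..<n}. pers_point y {..<n} i \<in> U} + 2 * R"
proof -
  let ?C = "{i \<in> path_births y {..<n}. pers_point y {..<n} i \<in> U}"
  have fin: "finite ?C" by (simp add: path_births_def)
  have "{k\<in>{..<n}. (\<lambda>i. y (i + k)) \<in> settled_in R U} \<subseteq> {k. k + R \<in> ?C} \<union> {n - 2 * R..<n}"
  proof
    fix k assume k: "k \<in> {k\<in>{..<n}. (\<lambda>i. y (i + k)) \<in> settled_in R U}"
    show "k \<in> {k. k + R \<in> ?C} \<union> {n - 2 * R..<n}"
    proof (cases "k + 2 * R < n")
      case True
      then have "{k..k + 2 * R} \<subseteq> {..<n}" by auto
      moreover have "settled y {k..k + 2 * R} (k + R)" using k by (auto simp: shift_settled_in)
      ultimately show ?thesis using k shift_settled_in_iff[of y k R "{..<n}" U] by auto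
    qed (use k in auto)
  qed
  moreover have fin': "finite {k. k + R \<in> ?C}"
    using finite_vimageI[OF fin, of "\<lambda>k. k + R"] by (simp add: vimage_def)
  ultimately have "card {k\<in>{..<n}. (\<lambda>i. y (i + k)) \<in> settled_in R U} \<le> card ({k. k + R \<in> ?C} \<union> {n - 2 * R..<n})"
    by (intro card_mono) auto
  also have "\<dots> \<le> card {k. k + R \<in> ?C} + card {n - 2 * R..<n}" by (rule card_Un_le)
  also have "card {k. k + R \<in> ?C} \<le> card ?C"
    by (rule card_inj_on_le[where f="\<lambda>k. k + R"]) (use fin in auto)
  also have "card {n - 2 * R..<n} \<le> 2 * R" by simp
  finally show ?thesis by simp
qed

text \<open>A vertex at distance at least \<open>R\<close> from both ends is the centre of a window inside \<open>{..<n}\<close>, and is counted by one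
  of the first two terms according to whether it is settled there.\<close>
lemma count_upper:
  "card {i \<in> path_births y {..<n}. pers_point y {..<n} i \<in> U} \<le>
   card {k\<in>{..<n}. (\<lambda>i. y (i + k)) \<in> settled_in R U} +
   card {k\<in>{..<n}. \<not> settled (\<lambda>i. y (i + k)) {..2 * R} R} + 2 * R"
proof -
  let ?C = "{i \<in> path_births y {..<n}. pers_point y {..<n} i \<in> U}"
  let ?A = "{k\<in>{..<n}. (\<lambda>i. y (i + k)) \<in> settled_in R U}"
  let ?B = "{k\<in>{..<n}. \<not> settled (\<lambda>i. y (i + k)) {..2 * R} R}"
  have "?C \<subseteq> ((\<lambda>k. k + R) ` (?A \<union> ?B)) \<union> ({..<R} \<union> {n - R..<n})"
  proof
    fix i assume i: "i \<in> ?C"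
    then have "i < n" by (simp add: path_births_def)
    show "i \<in> ((\<lambda>k. k + R) ` (?A \<union> ?B)) \<union> ({..<R} \<union> {n - R..<n})"
    proof (cases "R \<le> i \<and> i + R < n")
      case True
      then obtain k where k: "i = k + R" using le_Suc_ex[of R i] by (auto simp: add.commute)
      have img: "(\<lambda>i. i + k) ` {..2 * R} = {k..k + 2 * R}"
        using image_add_atLeastAtMost'[of k 0 "2 * R"] by (simp add: atMost_atLeast0 add.commute)
      have "k \<in> ?A \<union> ?B"
      proof (cases "settled y {k..k + 2 * R} (k + R)")
        case st: True
        have "{k..k + 2 * R} \<subseteq> {..<n}" using True k by auto
        from shift_settled_in_iff[OF st this] show ?thesis using i k \<open>i < n\<close> by auto
      next
        case False
        then show ?thesis using \<open>i < n\<close> k by (auto simp: settled_shift img add.commute)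
      qed
      then show ?thesis using k by blast
    qed (use \<open>i < n\<close> in auto)
  qed
  then have "card ?C \<le> card (((\<lambda>k. k + R) ` (?A \<union> ?B)) \<union> ({..<R} \<union> {n - R..<n}))"
    by (intro card_mono) auto
  also have "\<dots> \<le> card ((\<lambda>k. k + R) ` (?A \<union> ?B)) + card ({..<R} \<union> {n - R..<n})"
    by (rule card_Un_le)
  also have "card ((\<lambda>k. k + R) ` (?A \<union> ?B)) \<le> card (?A \<union> ?B)" by (rule card_image_le) auto
  also have "card (?A \<union> ?B) \<le> card ?A + card ?B" by (rule card_Un_le)
  also have "card ({..<R} \<union> {n - R..<n}) \<le> card {..<R} + card {n - R..<n}" by (rule card_Un_le)
  also have "\<dots> \<le> R + R" by simp
  finally show ?thesis by simp
qed

section \<open>Homology in degree zero\<close>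

text \<open>These rules rewrite the field operations of \<open>\<int>\<^sub>2\<close> to bit operations, to which the lemmas on finite sums do not apply.\<close>
declare add_bit_eq_xor [simp del] mult_bit_eq_and [simp del]

lemma bit_add_self [simp]: "(a::bit) + a = 0"
  by (cases a) simp_all

lemma bit_add_self_left [simp]: "(a::bit) + (a + b) = b"
  by (simp only: add.assoc[symmetric] bit_add_self add_0_left)

lemma bit_add_eq_0_iff: "(a::bit) + b = 0 \<longleftrightarrow> a = b"
  by (cases a; cases b) simp_all

lemma UNIV_bit: "(UNIV :: bit set) = {0, 1}"
proof (rule UNIV_eq_I)
  fix x :: bit show "x \<in> {0, 1}" by (cases x) simp_all
qed

lemma finite_UNIV_bit [simp]: "finite (UNIV :: bit set)"
  by (simp add: UNIV_bit)

lemma card_UNIV_bit: "card (UNIV :: bit set) = 2"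
  by (simp add: UNIV_bit)

definition chain_class :: "'v set set \<Rightarrow> ('v set \<Rightarrow> bit) \<Rightarrow> ('v set \<Rightarrow> bit) set" where
  "chain_class L z = (\<lambda>b \<sigma>. b \<sigma> + z \<sigma>) ` boundaries 0 L"

abbreviation chains0 :: "'v set set \<Rightarrow> ('v set \<Rightarrow> bit) set" where
  "chains0 L \<equiv> carrier (chain_space 0 L)"

lemma chains0_iff: "c \<in> chains0 L \<longleftrightarrow> finite {\<sigma>. c \<sigma> \<noteq> 0} \<and> {\<sigma>. c \<sigma> \<noteq> 0} \<subseteq> {\<sigma> \<in> L. card \<sigma> = 1}"
  by (simp add: chain_space_def)

lemma chains0_add:
  assumes "c \<in> chains0 L" "d \<in> chains0 L"
  shows "(\<lambda>\<sigma>. c \<sigma> + d \<sigma>) \<in> chains0 L"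
proof -
  have sub: "{\<sigma>. c \<sigma> + d \<sigma> \<noteq> 0} \<subseteq> {\<sigma>. c \<sigma> \<noteq> 0} \<union> {\<sigma>. d \<sigma> \<noteq> 0}" by auto
  moreover have "finite ({\<sigma>. c \<sigma> \<noteq> 0} \<union> {\<sigma>. d \<sigma> \<noteq> 0})"
    and "{\<sigma>. c \<sigma> \<noteq> 0} \<union> {\<sigma>. d \<sigma> \<noteq> 0} \<subseteq> {\<sigma> \<in> L. card \<sigma> = 1}"
    using assms unfolding chains0_iff by blast+
  ultimately show ?thesis unfolding chains0_iff by (intro conjI finite_subset[OF sub] order_trans[OF sub])
qed

lemma chains0_smult: "c \<in> chains0 L \<Longrightarrow> (\<lambda>\<sigma>. a * c \<sigma>) \<in> chains0 L"
  by (cases a) (auto simp: chains0_iff)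

lemma chains0_mono: "L \<subseteq> L' \<Longrightarrow> chains0 L \<subseteq> chains0 L'"
  unfolding chains0_iff subset_iff by blast

text \<open>The empty set is not a simplex, so the boundary of a \<open>0\<close>-chain vanishes.\<close>
lemma cycles_0: "cycles 0 L = chains0 L"
proof -
  have "boundary_map c \<tau> = 0" if c: "c \<in> chains0 L" for c \<tau>
  proof (cases "\<tau> = {}")
    case False
    have "{\<sigma>. c \<sigma> \<noteq> 0 \<and> \<tau> \<subseteq> \<sigma> \<and> card \<sigma> = card \<tau> + 1} = {}"
    proof (intro equals0I)
      fix \<sigma> assume *: "\<sigma> \<in> {\<sigma>. c \<sigma> \<noteq> 0 \<and> \<tau> \<subseteq> \<sigma> \<and> card \<sigma> = card \<tau> + 1}"
      then have "card \<sigma> = 1" using c unfolding chains0_iff by blast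
      then have "card \<tau> = 0" "finite \<sigma>" using * by (auto intro: card_ge_0_finite)
      moreover have "finite \<tau>" using * \<open>finite \<sigma>\<close> finite_subset by blast
      ultimately show False using False by simp
    qed
    then show ?thesis by (simp only: boundary_map_def) simp
  qed (simp add: boundary_map_def)
  then show ?thesis by (auto simp: cycles_def)
qed

lemma homology_0_carrier: "carrier (homology 0 L) = chain_class L ` chains0 L"
  by (auto simp: homology_def quotient_space_def A_RCOSETS_def' a_r_coset_def' chain_class_def
      cycles_0 chain_space_def)

lemma homology_0_add: "C \<oplus>\<^bsub>homology 0 L\<^esub> D = {\<lambda>\<sigma>. c \<sigma> + d \<sigma> | c d. c \<in> C \<and> d \<in> D}"
  by (auto simp: homology_def quotient_space_def set_add_def' chain_space_def)

lemma homology_0_smult: "a \<odot>\<^bsub>homology 0 L\<^esub> C = (\<Union>x\<in>C. chain_class L (\<lambda>\<sigma>. a * x \<sigma>))"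
  by (auto simp: homology_def quotient_space_def a_r_coset_def' chain_class_def chain_space_def)

lemma homology_incl_0: "homology_incl 0 L' C = (\<Union>z\<in>C. chain_class L' z)"
  by (auto simp: homology_incl_def a_r_coset_def' chain_class_def chain_space_def)

text \<open>A linear map from the \<open>0\<close>-chains onto \<open>W\<close> whose kernel consists of the boundaries: an isomorphism from \<open>H\<^sub>0\<close> to
  \<open>W\<close> before passing to classes. Over \<open>\<int>\<^sub>2\<close> differences are sums, and stating the kernel condition for pairs makes no
  appeal to the group laws of \<open>W\<close>.\<close>
locale homology_0_presentation =
  fixes L :: "'v set set" and W :: "(bit, 'b) module" and \<Psi> :: "('v set \<Rightarrow> bit) \<Rightarrow> 'b"
  assumes boundaries_sub: "boundaries 0 L \<subseteq> chains0 L"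
    and image: "\<Psi> ` chains0 L = carrier W"
    and kernel: "\<And>z z'. z \<in> chains0 L \<Longrightarrow> z' \<in> chains0 L \<Longrightarrow>
      \<Psi> z = \<Psi> z' \<longleftrightarrow> (\<lambda>\<sigma>. z \<sigma> + z' \<sigma>) \<in> boundaries 0 L"
    and add: "\<And>z z'. z \<in> chains0 L \<Longrightarrow> z' \<in> chains0 L \<Longrightarrow> \<Psi> (\<lambda>\<sigma>. z \<sigma> + z' \<sigma>) = \<Psi> z \<oplus>\<^bsub>W\<^esub> \<Psi> z'"
    and smult: "\<And>z a. z \<in> chains0 L \<Longrightarrow> \<Psi> (\<lambda>\<sigma>. a * z \<sigma>) = a \<odot>\<^bsub>W\<^esub> \<Psi> z"
begin

lemma mem_chain_class_iff:
  assumes z: "z \<in> chains0 L"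
  shows "c \<in> chain_class L z \<longleftrightarrow> c \<in> chains0 L \<and> \<Psi> c = \<Psi> z"
proof
  assume "c \<in> chain_class L z"
  then obtain b where b: "b \<in> boundaries 0 L" "c = (\<lambda>\<sigma>. b \<sigma> + z \<sigma>)" by (auto simp: chain_class_def)
  then have c: "c \<in> chains0 L" using boundaries_sub z chains0_add by blast
  have "(\<lambda>\<sigma>. c \<sigma> + z \<sigma>) = b" unfolding b(2) by (simp only: add.assoc bit_add_self add_0_right)
  then show "c \<in> chains0 L \<and> \<Psi> c = \<Psi> z" using kernel[OF c z] b(1) c by simp
next
  assume c: "c \<in> chains0 L \<and> \<Psi> c = \<Psi> z"
  then have "(\<lambda>\<sigma>. c \<sigma> + z \<sigma>) \<in> boundaries 0 L" using kernel z by blast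
  then have "(\<lambda>\<sigma>. (c \<sigma> + z \<sigma>) + z \<sigma>) \<in> chain_class L z"
    unfolding chain_class_def by (rule image_eqI[rotated]) simp
  then show "c \<in> chain_class L z" by (simp only: add.assoc bit_add_self add_0_right)
qed

lemma chain_class_eq:
  assumes "z \<in> chains0 L"
  shows "chain_class L z = {c \<in> chains0 L. \<Psi> c = \<Psi> z}"
  using mem_chain_class_iff[OF assms] by blast

definition induced :: "('v set \<Rightarrow> bit) set \<Rightarrow> 'b" where
  "induced C = \<Psi> (SOME c. c \<in> C)"

lemma induced_class: "z \<in> chains0 L \<Longrightarrow> induced (chain_class L z) = \<Psi> z"
  unfolding induced_def using someI[of "\<lambda>c. c \<in> chain_class L z" z] mem_chain_class_iff[of z] by blast

lemma induced_lin_iso: "induced \<in> lin_iso (homology 0 L) W"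
proof -
  have "inj_on induced (carrier (homology 0 L))"
    by (rule inj_onI) (auto simp: homology_0_carrier induced_class, auto simp: chain_class_eq)
  moreover have "induced ` carrier (homology 0 L) = carrier W"
    unfolding homology_0_carrier image[symmetric] by (force simp: induced_class image_image)
  moreover have "induced (C \<oplus>\<^bsub>homology 0 L\<^esub> D) = induced C \<oplus>\<^bsub>W\<^esub> induced D"
    if CD: "C \<in> carrier (homology 0 L)" "D \<in> carrier (homology 0 L)" for C D
  proof -
    obtain z z' where z: "z \<in> chains0 L" "C = chain_class L z" "z' \<in> chains0 L" "D = chain_class L z'"
      using CD unfolding homology_0_carrier by blast
    have "C \<oplus>\<^bsub>homology 0 L\<^esub> D = chain_class L (\<lambda>\<sigma>. z \<sigma> + z' \<sigma>)"
    proof (intro Set.set_eqI iffI)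
      fix e assume "e \<in> C \<oplus>\<^bsub>homology 0 L\<^esub> D"
      then obtain c d where "c \<in> C" "d \<in> D" "e = (\<lambda>\<sigma>. c \<sigma> + d \<sigma>)" by (auto simp: homology_0_add)
      then show "e \<in> chain_class L (\<lambda>\<sigma>. z \<sigma> + z' \<sigma>)"
        using z by (simp add: mem_chain_class_iff chains0_add add)
    next
      fix e assume "e \<in> chain_class L (\<lambda>\<sigma>. z \<sigma> + z' \<sigma>)"
      then obtain b where b: "b \<in> boundaries 0 L" "e = (\<lambda>\<sigma>. b \<sigma> + (z \<sigma> + z' \<sigma>))"
        by (auto simp: chain_class_def)
      have "(\<lambda>\<sigma>. b \<sigma> + z \<sigma>) \<in> C" using z(2) b(1) unfolding chain_class_def by blast
      moreover have "z' \<in> D" using z by (simp add: mem_chain_class_iff)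
      ultimately show "e \<in> C \<oplus>\<^bsub>homology 0 L\<^esub> D"
        unfolding homology_0_add b(2) add.assoc[symmetric]
        by (intro CollectI exI[of _ "\<lambda>\<sigma>. b \<sigma> + z \<sigma>"] exI[of _ z'] conjI refl)
    qed
    then show ?thesis using z by (simp add: induced_class add chains0_add)
  qed
  moreover have "induced (a \<odot>\<^bsub>homology 0 L\<^esub> C) = a \<odot>\<^bsub>W\<^esub> induced C"
    if C: "C \<in> carrier (homology 0 L)" for a C
  proof -
    obtain z where z: "z \<in> chains0 L" "C = chain_class L z" using C by (auto simp: homology_0_carrier)
    have "chain_class L (\<lambda>\<sigma>. a * x \<sigma>) = chain_class L (\<lambda>\<sigma>. a * z \<sigma>)" if "x \<in> C" for x
      using that z by (auto simp: chain_class_eq chains0_smult smult)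
    moreover have "z \<in> C" using z by (simp add: mem_chain_class_iff)
    ultimately have "a \<odot>\<^bsub>homology 0 L\<^esub> C = chain_class L (\<lambda>\<sigma>. a * z \<sigma>)"
      unfolding homology_0_smult by blast
    then show ?thesis using z by (simp add: induced_class chains0_smult smult)
  qed
  ultimately show ?thesis by (auto simp: lin_iso_def bij_betw_def)
qed

end

lemma homology_incl_class:
  assumes L: "homology_0_presentation L W \<Psi>" and L': "homology_0_presentation L' W' \<Psi>'"
    and sub: "L \<subseteq> L'" and nat: "\<And>z. z \<in> chains0 L \<Longrightarrow> \<Psi>' z = w (\<Psi> z)"
    and z: "z \<in> chains0 L"
  shows "homology_incl 0 L' (chain_class L z) = chain_class L' z"
proof -
  interpret A: homology_0_presentation L W \<Psi> by fact
  interpret B: homology_0_presentation L' W' \<Psi>' by fact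
  have "chain_class L' x = chain_class L' z" if "x \<in> chain_class L z" for x
  proof -
    have "x \<in> chains0 L" "\<Psi> x = \<Psi> z" using that z by (auto simp: A.mem_chain_class_iff)
    then have "x \<in> chains0 L'" "z \<in> chains0 L'" "\<Psi>' x = \<Psi>' z"
      using chains0_mono[OF sub] z nat by auto
    then show ?thesis by (simp add: B.chain_class_eq)
  qed
  moreover have "z \<in> chain_class L z" using z by (simp add: A.mem_chain_class_iff)
  ultimately show ?thesis unfolding homology_incl_0 by blast
qed

text \<open>Presentations of all the spaces that commute with the inclusions of chains assemble to an isomorphism of persistence
  modules.\<close>
lemma pers_isomorphic_homology_0:
  assumes pres: "\<And>t. homology_0_presentation (L t) (W t) (\<Psi> t)"
    and mono: "\<And>s t. s \<le> t \<Longrightarrow> L s \<subseteq> L t"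
    and nat: "\<And>s t z. s \<le> t \<Longrightarrow> z \<in> chains0 (L s) \<Longrightarrow> \<Psi> t z = w s t (\<Psi> s z)"
  shows "pers_isomorphic (\<lambda>t. homology 0 (L t)) (\<lambda>s t. homology_incl 0 (L t)) W w"
    and "s \<le> t \<Longrightarrow> C \<in> carrier (homology 0 (L s)) \<Longrightarrow>
      homology_incl 0 (L t) C \<in> carrier (homology 0 (L t))"
proof -
  have incl: "homology_incl 0 (L t) (chain_class (L s) z) = chain_class (L t) z"
    if "s \<le> t" "z \<in> chains0 (L s)" for s t z
    by (rule homology_incl_class[OF pres[of s] pres[of t] mono[OF that(1)] nat[OF that(1)] that(2)])
  show "pers_isomorphic (\<lambda>t. homology 0 (L t)) (\<lambda>s t. homology_incl 0 (L t)) W w"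
    unfolding pers_isomorphic_def
  proof (intro exI[of _ "\<lambda>t. homology_0_presentation.induced (\<Psi> t)"] conjI allI impI ballI)
    show "homology_0_presentation.induced (\<Psi> t) \<in> lin_iso (homology 0 (L t)) (W t)" for t
      using homology_0_presentation.induced_lin_iso[OF pres] .
    fix s t x assume st: "s \<le> t" and x: "x \<in> carrier (homology 0 (L s))"
    then obtain z where z: "z \<in> chains0 (L s)" "x = chain_class (L s) z" by (auto simp: homology_0_carrier)
    then have "z \<in> chains0 (L t)" using chains0_mono[OF mono[OF st]] by blast
    then show "homology_0_presentation.induced (\<Psi> t) (homology_incl 0 (L t) x) =
        w s t (homology_0_presentation.induced (\<Psi> s) x)"
      using z st nat by (simp add: incl homology_0_presentation.induced_class[OF pres])
  qed
  show "homology_incl 0 (L t) C \<in> carrier (homology 0 (L t))"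
    if "s \<le> t" "C \<in> carrier (homology 0 (L s))"
    using that chains0_mono[OF mono[OF that(1)]] by (auto simp: homology_0_carrier incl)
qed

section \<open>Uniqueness of interval decompositions\<close>

lemma mset_index_add: "mset_index (add_mset p P) = insert (p, count P p) (mset_index P)"
  by (auto simp: mset_index_def less_Suc_eq split: if_splits)

lemma mset_index_empty [simp]: "mset_index {#} = {}"
  by (simp add: mset_index_def)

lemma finite_mset_index [simp]: "finite (mset_index P)"
  by (induction P) (simp_all add: mset_index_add)

lemma card_mset_index_filter: "card {j \<in> mset_index P. R (fst j)} = size (filter_mset R P)"
proof (induction P)
  case (add p P)
  have "{j \<in> mset_index (add_mset p P). R (fst j)} =
      (if R p then insert (p, count P p) {j \<in> mset_index P. R (fst j)} else {j \<in> mset_index P. R (fst j)})"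
    by (auto simp: mset_index_add)
  moreover have "(p, count P p) \<notin> mset_index P" by (simp add: mset_index_def)
  ultimately show ?case using add by simp
qed simp

text \<open>Listing a multiset as the image of a finite set \<open>B\<close> labels the summands of its interval decomposition by \<open>B\<close>.\<close>
lemma mset_index_bij:
  assumes "finite B"
  shows "\<exists>\<beta>. bij_betw \<beta> B (mset_index (image_mset f (mset_set B))) \<and> (\<forall>b\<in>B. fst (\<beta> b) = f b)"
  using assms
proof (induction B)
  case empty
  then show ?case by (simp add: bij_betw_def)
next
  case (insert a B)
  let ?P = "image_mset f (mset_set B)"
  from insert obtain \<beta> where \<beta>: "bij_betw \<beta> B (mset_index ?P)" "\<forall>b\<in>B. fst (\<beta> b) = f b" by blast
  let ?\<gamma> = "\<beta>(a := (f a, count ?P (f a)))"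
  have new: "(f a, count ?P (f a)) \<notin> mset_index ?P" by (simp add: mset_index_def)
  have "bij_betw ?\<gamma> B (mset_index ?P)"
    using \<beta>(1) by (rule bij_betw_cong[THEN iffD2, rotated]) (use insert.hyps(2) in auto)
  then have "bij_betw ?\<gamma> (B \<union> {a}) (mset_index ?P \<union> {?\<gamma> a})"
    by (rule notIn_Un_bij_betw[rotated 2]) (use new insert.hyps(2) in simp_all)
  then have "bij_betw ?\<gamma> (insert a B) (mset_index (image_mset f (mset_set (insert a B))))"
    using insert.hyps by (simp add: mset_index_add)
  moreover have "\<forall>b\<in>insert a B. fst (?\<gamma> b) = f b" using \<beta>(2) by auto
  ultimately show ?case by blast
qed

abbreviation interval_sum :: "(ereal \<times> ereal) multiset \<Rightarrow> real \<Rightarrow> (bit, (ereal \<times> ereal) \<times> nat \<Rightarrow> bit) module" where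
  "interval_sum P t \<equiv> direct_sum (mset_index P) (\<lambda>j. interval_space (fst j) t)"

abbreviation interval_sum_map ::
  "(ereal \<times> ereal) multiset \<Rightarrow> real \<Rightarrow> real \<Rightarrow> ((ereal \<times> ereal) \<times> nat \<Rightarrow> bit) \<Rightarrow> (ereal \<times> ereal) \<times> nat \<Rightarrow> bit" where
  "interval_sum_map P s t \<phi> \<equiv> \<lambda>j\<in>mset_index P. interval_map (fst j) s t (\<phi> j)"

lemma interval_sum_carrier:
  "carrier (interval_sum P t) =
     {\<phi> \<in> mset_index P \<rightarrow>\<^sub>E UNIV. \<forall>j\<in>mset_index P. \<phi> j \<noteq> 0 \<longrightarrow> fst (fst j) \<le> ereal t \<and> ereal t < snd (fst j)}"
  by (auto simp: direct_sum_def interval_space_def PiE_iff split: if_splits)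

text \<open>The image of the map from \<open>s\<close> to \<open>t\<close> is spanned by the intervals that contain both \<open>s\<close> and \<open>t\<close>; over a field with
  two elements its dimension can be read off its cardinality.\<close>
lemma interval_sum_rank:
  assumes st: "s \<le> t"
  shows "card (interval_sum_map P s t ` carrier (interval_sum P s)) =
    2 ^ size {#p \<in># P. fst p \<le> ereal s \<and> ereal t < snd p#}"
proof -
  let ?J = "mset_index P"
  define K where "K = {j \<in> ?J. fst (fst j) \<le> ereal s \<and> ereal t < snd (fst j)}"
  let ?ext = "\<lambda>\<phi>. \<lambda>j\<in>?J. if j \<in> K then \<phi> j else (0::bit)"
  have K: "interval_map (fst j) s t a = (if j \<in> K then a else 0)" if "j \<in> ?J" for j a
  proof -
    have "fst p \<le> ereal s \<and> ereal s < snd p \<and> fst p \<le> ereal t \<and> ereal t < snd p \<longleftrightarrow>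
        fst p \<le> ereal s \<and> ereal t < snd p" for p :: "ereal \<times> ereal"
      using st by (meson ereal_less_eq(3) order.trans le_less_trans)
    then show ?thesis using that by (simp add: interval_map_def K_def)
  qed
  have fin: "finite K" by (simp add: K_def)
  have "interval_sum_map P s t ` carrier (interval_sum P s) = ?ext ` (K \<rightarrow>\<^sub>E UNIV)"
  proof (intro equalityI subsetI)
    fix \<psi> assume "\<psi> \<in> interval_sum_map P s t ` carrier (interval_sum P s)"
    then obtain \<phi> where "\<psi> = interval_sum_map P s t \<phi>" by blast
    then have "\<psi> = ?ext (restrict \<phi> K)" by (simp add: K cong: restrict_cong if_cong)
    then show "\<psi> \<in> ?ext ` (K \<rightarrow>\<^sub>E UNIV)" by (rule image_eqI[where x = "restrict \<phi> K"]) simp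
  next
    fix \<psi> assume "\<psi> \<in> ?ext ` (K \<rightarrow>\<^sub>E UNIV)"
    then obtain \<phi> where "\<psi> = ?ext \<phi>" by blast
    then have "\<psi> = interval_sum_map P s t (?ext \<phi>)" by (simp add: K cong: restrict_cong if_cong)
    moreover have "?ext \<phi> \<in> carrier (interval_sum P s)"
    proof -
      have "ereal s < snd (fst j)" if "j \<in> K" for j
        using that st unfolding K_def by (auto intro: le_less_trans[of "ereal s" "ereal t"])
      then show ?thesis unfolding interval_sum_carrier by (auto simp: K_def)
    qed
    ultimately show "\<psi> \<in> interval_sum_map P s t ` carrier (interval_sum P s)" by (rule image_eqI)
  qed
  moreover have "inj_on ?ext (K \<rightarrow>\<^sub>E UNIV)"
  proof (rule inj_onI)
    fix \<phi> \<psi> assume *: "\<phi> \<in> K \<rightarrow>\<^sub>E UNIV" "\<psi> \<in> K \<rightarrow>\<^sub>E UNIV" "?ext \<phi> = ?ext \<psi>"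
    show "\<phi> = \<psi>"
    proof (rule PiE_ext[OF *(1,2)])
      fix j assume "j \<in> K"
      then show "\<phi> j = \<psi> j" using fun_cong[OF *(3), of j] by (simp add: K_def)
    qed
  qed
  ultimately have "card (interval_sum_map P s t ` carrier (interval_sum P s)) = card (K \<rightarrow>\<^sub>E (UNIV :: bit set))"
    by (simp add: card_image)
  also have "\<dots> = 2 ^ card K" using fin by (simp add: card_PiE card_UNIV_bit)
  also have "card K = size {#p \<in># P. fst p \<le> ereal s \<and> ereal t < snd p#}"
    unfolding K_def by (rule card_mset_index_filter)
  finally show ?thesis .
qed

lemma pers_isomorphic_rank:
  assumes iso: "pers_isomorphic V v W w" and st: "s \<le> t"
    and v: "v s t ` carrier (V s) \<subseteq> carrier (V t)"
  shows "card (v s t ` carrier (V s)) = card (w s t ` carrier (W s))"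
proof -
  from iso obtain h where h: "\<forall>t. h t \<in> lin_iso (V t) (W t)"
    and h_nat: "\<forall>s t. s \<le> t \<longrightarrow> (\<forall>x\<in>carrier (V s). h t (v s t x) = w s t (h s x))"
    unfolding pers_isomorphic_def by (elim exE conjE)
  have nat: "h t (v s t x) = w s t (h s x)" if "x \<in> carrier (V s)" for x
    using h_nat st that by blast
  have bij: "bij_betw (h r) (carrier (V r)) (carrier (W r))" for r using h by (simp add: lin_iso_def)
  have "w s t ` carrier (W s) = w s t ` h s ` carrier (V s)"
    using bij[of s] by (simp add: bij_betw_def)
  also have "\<dots> = h t ` v s t ` carrier (V s)" using nat by (force simp: image_image)
  finally show ?thesis
    using bij[of t] v by (metis bij_betw_def card_image inj_on_subset)
qed

text \<open>After cancelling common points, take among the remaining points of both multisets one with minimal first coordinate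
  \<open>b\<close> and, for this \<open>b\<close>, maximal second coordinate \<open>d\<close>. For \<open>s = b\<close> and \<open>t\<close> slightly below \<open>d\<close> the quadrant contains no
  other remaining point, so \<open>(b, d)\<close> has the same multiplicity in both and would have been cancelled.\<close>
lemma mset_eq_of_quadrant_counts:
  fixes P Q :: "(ereal \<times> ereal) multiset"
  assumes PQ: "set_mset P \<subseteq> Delta" "set_mset Q \<subseteq> Delta"
    and eq: "\<And>s t. s \<le> t \<Longrightarrow> size {#p \<in># P. fst p \<le> ereal s \<and> ereal t < snd p#} =
      size {#p \<in># Q. fst p \<le> ereal s \<and> ereal t < snd p#}"
  shows "P = Q"
proof (rule ccontr)
  assume "P \<noteq> Q"
  define P' where "P' = P - Q"
  define Q' where "Q' = Q - P"
  define C where "C = P \<inter># Q"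
  have P: "P = C + P'" and Q: "Q = C + Q'"
    by (simp_all add: P'_def Q'_def C_def multiset_eq_iff min_def)
  have disj: "count P' p = 0 \<or> count Q' p = 0" for p by (auto simp: P'_def Q'_def)
  have eq': "size {#p \<in># P'. fst p \<le> ereal s \<and> ereal t < snd p#} =
      size {#p \<in># Q'. fst p \<le> ereal s \<and> ereal t < snd p#}" if "s \<le> t" for s t
    using eq[OF that] unfolding P Q by simp
  let ?A = "set_mset P' \<union> set_mset Q'"
  have "?A \<noteq> {}" using \<open>P \<noteq> Q\<close> P Q by auto
  have AD: "?A \<subseteq> Delta" using PQ P Q by auto
  define b where "b = Min (fst ` ?A)"
  have bA: "b \<in> fst ` ?A" unfolding b_def using \<open>?A \<noteq> {}\<close> by (intro Min_in) auto
  have b_le: "b \<le> fst p" if "p \<in> ?A" for p unfolding b_def using that by (intro Min_le) auto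
  let ?D = "{d. (b, d) \<in> ?A}"
  have "?D \<subseteq> snd ` ?A" by force
  then have finD: "finite ?D" by (rule finite_subset) auto
  have "?D \<noteq> {}" using bA by force
  define d where "d = Max ?D"
  have dA: "(b, d) \<in> ?A" unfolding d_def using Max_in[OF finD \<open>?D \<noteq> {}\<close>] by blast
  have d_ge: "d' \<le> d" if "(b, d') \<in> ?A" for d' unfolding d_def using that finD by (intro Max_ge) auto
  have bd: "-\<infinity> < b" "b < d" using dA AD by (auto simp: Delta_def)
  obtain s where s: "b = ereal s" using bd by (cases b) auto
  define m where "m = Max (insert b {d' \<in> ?D. d' < d})"
  have "m < d" unfolding m_def using finD bd by (subst Max_less_iff) auto
  have "b \<le> m" unfolding m_def using finD by (intro Max_ge) auto
  obtain t where t: "m \<le> ereal t" "ereal t < d"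
    using ereal_dense2[OF \<open>m < d\<close>] less_imp_le by blast
  have st: "s \<le> t" using \<open>b \<le> m\<close> t(1) s by (metis ereal_less_eq(3) order.trans)
  have only: "p = (b, d)" if "p \<in> ?A" "fst p \<le> ereal s" "ereal t < snd p" for p
  proof -
    have "fst p = b" using b_le[OF that(1)] that(2) s by (simp add: antisym)
    then have pb: "p = (b, snd p)" by (metis prod.collapse)
    then have D: "snd p \<in> ?D" using that(1) by simp
    have "snd p \<le> d" using d_ge pb that(1) by metis
    moreover have "\<not> snd p < d"
    proof
      assume "snd p < d"
      then have "snd p \<le> m" unfolding m_def using D finD by (intro Max_ge) auto
      with t(1) that(3) show False by simp
    qed
    ultimately show ?thesis using pb by (simp add: antisym)
  qed
  have cnt: "size {#p \<in># R. fst p \<le> ereal s \<and> ereal t < snd p#} = count R (b, d)"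
    if R: "set_mset R \<subseteq> ?A" for R
  proof -
    have "{#p \<in># R. fst p \<le> ereal s \<and> ereal t < snd p#} = {#p \<in># R. p = (b, d)#}"
      using only R t(2) s by (intro filter_mset_cong refl) auto
    then show ?thesis by (simp add: filter_eq_replicate_mset)
  qed
  have "count P' (b, d) = count Q' (b, d)" using eq'[OF st] cnt[of P'] cnt[of Q'] by simp
  with disj[of "(b, d)"] have "count P' (b, d) = 0" "count Q' (b, d) = 0" by auto
  with dA show False by (auto simp: count_eq_zero_iff)
qed

lemma interval_decomposition_unique:
  assumes "pers_isomorphic V v (interval_sum P) (interval_sum_map P)"
    and "pers_isomorphic V v (interval_sum Q) (interval_sum_map Q)"
    and v: "\<And>s t. s \<le> t \<Longrightarrow> v s t ` carrier (V s) \<subseteq> carrier (V t)"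
    and "set_mset P \<subseteq> Delta" "set_mset Q \<subseteq> Delta"
  shows "P = Q"
proof (rule mset_eq_of_quadrant_counts)
  fix s t :: real assume st: "s \<le> t"
  have "(2::nat) ^ size {#p \<in># P. fst p \<le> ereal s \<and> ereal t < snd p#} =
      2 ^ size {#p \<in># Q. fst p \<le> ereal s \<and> ereal t < snd p#}"
    using pers_isomorphic_rank[OF assms(1) st v[OF st]] pers_isomorphic_rank[OF assms(2) st v[OF st]]
    by (simp add: interval_sum_rank[OF st])
  then show "size {#p \<in># P. fst p \<le> ereal s \<and> ereal t < snd p#} =
      size {#p \<in># Q. fst p \<le> ereal s \<and> ereal t < snd p#}" by simp
qed fact+

section \<open>The persistence diagram of a path\<close>

locale path_filtration =
  fixes x :: "nat \<Rightarrow> real" and n :: nat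
begin

abbreviation "A \<equiv> {1..n}"
abbreviation "mh \<equiv> merge_height x"
abbreviation "D \<equiv> death x A"
abbreviation "L \<equiv> sublevel_complex x n"

definition verts :: "real \<Rightarrow> nat set" where
  "verts t = {i \<in> A. x i \<le> t}"

text \<open>The vertices that are the oldest ones of their components at level \<open>t\<close> (\<open>alive_unique\<close>, \<open>ex_oldest\<close>).\<close>
definition alive :: "real \<Rightarrow> nat set" where
  "alive t = {i \<in> A. x i \<le> t \<and> ereal t < D i}"

text \<open>The component of \<open>i\<close> immediately before its death. Within every level below the death it is a union of components,
  and it contains no vertex older than \<open>i\<close>; hence the sum of the coefficients over it is a functional on homology that
  vanishes before the birth of \<open>i\<close>.\<close>
definition basin :: "nat \<Rightarrow> nat set" where
  "basin i = {v \<in> A. ereal (mh i v) < D i}"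

lemma finite_verts [simp]: "finite (verts t)" and finite_alive [simp]: "finite (alive t)"
  and finite_basin [simp]: "finite (basin i)"
  by (simp_all add: verts_def alive_def basin_def)

lemma trunc_seq_le_iff: "trunc_seq x n i \<le> ereal t \<longleftrightarrow> i \<in> verts t"
  by (auto simp: trunc_seq_def verts_def)

lemma vertex_mem: "{i} \<in> L t \<longleftrightarrow> i \<in> verts t"
  by (auto simp: sublevel_complex_def path_complex_def trunc_seq_le_iff)

lemma edge_mem: "{k, Suc k} \<in> L t \<longleftrightarrow> k \<in> verts t \<and> Suc k \<in> verts t"
  by (auto simp: sublevel_complex_def path_complex_def trunc_seq_le_iff)

lemma complex_cases:
  assumes "\<sigma> \<in> L t"
  obtains i where "\<sigma> = {i}" "i \<in> verts t" | k where "\<sigma> = {k, Suc k}" "k \<in> verts t" "Suc k \<in> verts t"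
proof -
  have "\<sigma> \<in> path_complex" using assms by (simp add: sublevel_complex_def)
  then consider i where "\<sigma> = {i}" | k where "\<sigma> = {k, Suc k}" by (auto simp: path_complex_def)
  then show ?thesis
  proof cases
    case 1
    then show ?thesis using assms vertex_mem that(1) by blast
  next
    case 2
    then show ?thesis using assms edge_mem that(2) by blast
  qed
qed

lemma complex_mono: "s \<le> t \<Longrightarrow> L s \<subseteq> L t"
  by (auto simp: sublevel_complex_def intro: order_trans[of _ "ereal s" "ereal t"])

lemma chain_vertices:
  assumes "c \<in> chains0 (L t)" "c \<sigma> \<noteq> 0"
  obtains v where "\<sigma> = {v}" "v \<in> verts t"
proof -
  have "\<sigma> \<in> L t" "card \<sigma> = 1" using assms unfolding chains0_iff by blast+
  then show ?thesis using that by (cases rule: complex_cases) auto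
qed

lemma chain_vertex_zero: "c \<in> chains0 (L t) \<Longrightarrow> v \<notin> verts t \<Longrightarrow> c {v} = 0"
  using chain_vertices[of c t "{v}"] by blast

lemma chains0I:
  assumes "\<And>\<sigma>. c \<sigma> \<noteq> 0 \<Longrightarrow> \<exists>v\<in>verts t. \<sigma> = {v}"
  shows "c \<in> chains0 (L t)"
proof -
  have sub: "{\<sigma>. c \<sigma> \<noteq> 0} \<subseteq> (\<lambda>v. {v}) ` verts t" using assms by blast
  moreover have "finite ((\<lambda>v. {v}) ` verts t)" by simp
  moreover have "(\<lambda>v. {v}) ` verts t \<subseteq> {\<sigma> \<in> L t. card \<sigma> = 1}" by (auto simp: vertex_mem)
  ultimately show ?thesis unfolding chains0_iff by (intro conjI finite_subset[OF sub] order_trans[OF sub])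
qed

lemma edge_chain_support:
  assumes "e \<in> carrier (chain_space 1 (L t))" "e \<sigma> \<noteq> 0"
  obtains k where "\<sigma> = {k, Suc k}" "k \<in> verts t" "Suc k \<in> verts t" "card \<sigma> = 2"
proof -
  have "\<sigma> \<in> L t" "card \<sigma> = 2" using assms by (auto simp: chain_space_def)
  then show ?thesis using that by (cases rule: complex_cases) auto
qed

text \<open>For \<open>u = 0\<close> the second term is the coefficient of the singleton \<open>{0}\<close>, which is not an edge, and vanishes.\<close>
lemma boundary_map_vertex:
  assumes e: "e \<in> carrier (chain_space 1 (L t))"
  shows "boundary_map e {u} = e {u, Suc u} + e {u - 1, u}"
proof -
  \<comment> \<open>An edge containing \<open>u\<close> joins it to one of its two neighbours.\<close>
  have sub: "{\<sigma>. e \<sigma> \<noteq> 0 \<and> {u} \<subseteq> \<sigma> \<and> card \<sigma> = card {u} + 1} \<subseteq> {{u, Suc u}, {u - 1, u}}"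
  proof
    fix \<sigma> assume "\<sigma> \<in> {\<sigma>. e \<sigma> \<noteq> 0 \<and> {u} \<subseteq> \<sigma> \<and> card \<sigma> = card {u} + 1}"
    then have "e \<sigma> \<noteq> 0" "u \<in> \<sigma>" by simp_all
    from e this(1) obtain k where "\<sigma> = {k, Suc k}" by (rule edge_chain_support)
    then show "\<sigma> \<in> {{u, Suc u}, {u - 1, u}}" using \<open>u \<in> \<sigma>\<close> by auto
  qed
  have zero: "e \<sigma> = 0" if "\<sigma> \<in> {{u, Suc u}, {u - 1, u}} - {\<sigma>. e \<sigma> \<noteq> 0 \<and> {u} \<subseteq> \<sigma> \<and> card \<sigma> = card {u} + 1}" for \<sigma>
  proof (rule ccontr)
    assume ne: "e \<sigma> \<noteq> 0"
    from e this have "card \<sigma> = 2" by (rule edge_chain_support)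
    with ne that show False by auto
  qed
  have "boundary_map e {u} = (\<Sum>\<sigma> | e \<sigma> \<noteq> 0 \<and> {u} \<subseteq> \<sigma> \<and> card \<sigma> = card {u} + 1. e \<sigma>)"
    by (simp only: boundary_map_def) simp
  also have "\<dots> = (\<Sum>\<sigma>\<in>{{u, Suc u}, {u - 1, u}}. e \<sigma>)"
    by (rule sum.mono_neutral_left[OF _ sub]) (use zero in blast)+
  also have "\<dots> = e {u, Suc u} + e {u - 1, u}"
  proof -
    have "{u, Suc u} \<noteq> {u - 1, u}" by (auto simp: doubleton_eq_iff)
    then show ?thesis by simp
  qed
  finally show ?thesis .
qed

lemma boundary_map_other:
  assumes e: "e \<in> carrier (chain_space 1 (L t))" and "\<And>u. \<tau> \<noteq> {u}"
  shows "boundary_map e \<tau> = 0"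
proof (cases "\<tau> = {}")
  case False
  have "{\<sigma>. e \<sigma> \<noteq> 0 \<and> \<tau> \<subseteq> \<sigma> \<and> card \<sigma> = card \<tau> + 1} = {}"
  proof (intro equals0I)
    fix \<sigma> assume *: "\<sigma> \<in> {\<sigma>. e \<sigma> \<noteq> 0 \<and> \<tau> \<subseteq> \<sigma> \<and> card \<sigma> = card \<tau> + 1}"
    then have "e \<sigma> \<noteq> 0" by simp
    from e this have "card \<sigma> = 2" by (rule edge_chain_support)
    then have "card \<tau> = 1" using * by simp
    then show False using assms(2) by (metis card_1_singletonE)
  qed
  then show ?thesis by (simp only: boundary_map_def) simp
qed (simp add: boundary_map_def)

lemma merge_height_le_trans: "mh i j \<le> t \<Longrightarrow> mh j k \<le> t \<Longrightarrow> mh i k \<le> t"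
  using merge_height_ultrametric[of x i k j] by linarith

lemma merge_height_less_trans:
  assumes "ereal (mh i j) < d" "ereal (mh j k) < d"
  shows "ereal (mh i k) < d"
proof -
  have "ereal (mh i k) \<le> max (ereal (mh i j)) (ereal (mh j k))"
    using merge_height_ultrametric[of x i k j] by (auto simp: max_def split: if_splits)
  then show ?thesis using assms by (simp add: le_less_trans)
qed

lemma verts_component: "mh i j \<le> t \<Longrightarrow> j \<in> A \<Longrightarrow> j \<in> verts t"
  using merge_height_ge(2)[of x j i] by (simp add: verts_def)

lemma not_older_in_basin: "v \<in> basin i \<Longrightarrow> \<not> older x v i"
  using death_le[of v A x i] by (auto simp: basin_def)

lemma basin_value: "v \<in> basin i \<Longrightarrow> x i \<le> x v"
  using not_older_in_basin[of v i] by (auto simp: older_def)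

lemma alive_unique:
  assumes "i \<in> alive t" "j \<in> alive t" "mh i j \<le> t"
  shows "i = j"
proof (rule ccontr)
  assume "i \<noteq> j"
  have *: False if "i \<in> alive t" "j \<in> alive t" "mh i j \<le> t" "older x j i" for i j
  proof -
    have "D i \<le> ereal (mh i j)" using that by (intro death_le) (auto simp: alive_def)
    also have "\<dots> \<le> ereal t" using that by simp
    finally show False using that(1) by (auto simp: alive_def dest: leD)
  qed
  from \<open>i \<noteq> j\<close> have "older x i j \<or> older x j i" by (rule older_linear)
  then show False using *[of i j] *[of j i] assms by (auto simp: merge_height_commute)
qed

lemma older_asymp: "asymp_on S (older x)" and older_transp: "transp_on S (older x)"
  by (auto simp: asymp_on_def transp_on_def older_def)

lemma ex_oldest:
  assumes v: "v \<in> verts t"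
  shows "\<exists>j\<in>alive t. mh v j \<le> t"
proof -
  let ?C = "{j \<in> A. mh v j \<le> t}"
  have "v \<in> ?C" using v by (simp add: verts_def)
  then have "?C \<noteq> {}" by blast
  then have "\<exists>j\<in>?C. \<forall>k\<in>?C. k \<noteq> j \<longrightarrow> \<not> older x k j"
    by (intro Finite_Set.bex_min_element older_asymp older_transp) simp_all
  then obtain j where j: "j \<in> ?C" "\<forall>k\<in>?C. k \<noteq> j \<longrightarrow> \<not> older x k j" by blast
  have "t < mh j k" if k: "k \<in> A" "older x k j" for k
  proof (rule ccontr)
    assume "\<not> t < mh j k"
    then have "k \<in> ?C" using j(1) k merge_height_le_trans[of v j t k] by auto
    then show False using j(2) k by auto
  qed
  then have "ereal t < D j" by (simp add: less_death_iff)
  moreover have "x j \<le> t" using j(1) verts_component[of v j t] by (auto simp: verts_def)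
  ultimately show ?thesis using j(1) by (auto simp: alive_def)
qed

definition oldest :: "real \<Rightarrow> nat \<Rightarrow> nat" where
  "oldest t v = (SOME j. j \<in> alive t \<and> mh v j \<le> t)"

lemma oldest: "v \<in> verts t \<Longrightarrow> oldest t v \<in> alive t" "v \<in> verts t \<Longrightarrow> mh v (oldest t v) \<le> t"
  unfolding oldest_def using someI_ex[of "\<lambda>j. j \<in> alive t \<and> mh v j \<le> t"] ex_oldest[of v t] by blast+

lemma oldest_eq:
  assumes "v \<in> verts t" "j \<in> alive t" "mh j v \<le> t"
  shows "oldest t v = j"
  using alive_unique[of "oldest t v" t j] oldest[OF assms(1)] assms
    merge_height_le_trans[of "oldest t v" v t j] by (auto simp: merge_height_commute)

lemma alive_in_basin: "i \<in> alive t \<Longrightarrow> i \<in> basin i"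
  by (auto simp: alive_def basin_def intro: le_less_trans[of "ereal (x i)" "ereal t"])

lemma basin_component:
  assumes "i \<in> alive t" "v \<in> basin i" "mh v w \<le> t" "w \<in> A"
  shows "w \<in> basin i"
proof -
  have "ereal (mh v w) < D i" using assms by (auto simp: alive_def intro: le_less_trans[of _ "ereal t"])
  then show ?thesis using assms merge_height_less_trans[of i v "D i" w] by (auto simp: basin_def)
qed

text \<open>The basin of \<open>i\<close> contains, besides \<open>i\<close>, only younger vertices. So the matrix relating values at the alive vertices to
  sums over their basins is unitriangular for the order by age: the youngest vertex at which \<open>a\<close> and \<open>b\<close> differ would be
  seen by its own basin.\<close>
lemma basin_sums_determine:
  fixes a b :: "nat \<Rightarrow> bit"
  assumes eq: "\<And>i. i \<in> alive t \<Longrightarrow> (\<Sum>j\<in>alive t \<inter> basin i. a j) = (\<Sum>j\<in>alive t \<inter> basin i. b j)"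
    and j: "j \<in> alive t"
  shows "a j = b j"
proof (rule ccontr)
  assume "a j \<noteq> b j"
  define E where "E = {j \<in> alive t. a j \<noteq> b j}"
  have "finite E" "E \<noteq> {}" using j \<open>a j \<noteq> b j\<close> unfolding E_def by auto
  then have "\<exists>i\<in>E. \<forall>k\<in>E. k \<noteq> i \<longrightarrow> \<not> older x i k"
    by (intro Finite_Set.bex_max_element older_asymp older_transp)
  then obtain i where i: "i \<in> E" "\<forall>k\<in>E. k \<noteq> i \<longrightarrow> \<not> older x i k" by blast
  have al: "i \<in> alive t" using i by (simp add: E_def)
  have "a k = b k" if k: "k \<in> alive t \<inter> basin i - {i}" for k
  proof (rule ccontr)
    assume "a k \<noteq> b k"
    then have "\<not> older x i k" using i k by (auto simp: E_def)
    then have "older x k i" using older_linear[of i k x] k by auto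
    then show False using not_older_in_basin k by blast
  qed
  then have "(\<Sum>k\<in>alive t \<inter> basin i - {i}. a k) = (\<Sum>k\<in>alive t \<inter> basin i - {i}. b k)"
    by (rule sum.cong[OF refl])
  moreover have "(\<Sum>k\<in>alive t \<inter> basin i. c k) = c i + (\<Sum>k\<in>alive t \<inter> basin i - {i}. c k)" for c :: "nat \<Rightarrow> bit"
    using al alive_in_basin[OF al] by (intro sum.remove) auto
  ultimately have "a i = b i" using eq[OF al] by simp
  with i show False by (simp add: E_def)
qed

definition basin_sum :: "nat \<Rightarrow> (nat set \<Rightarrow> bit) \<Rightarrow> bit" where
  "basin_sum i c = (\<Sum>v\<in>basin i. c {v})"

definition component_sum :: "real \<Rightarrow> nat \<Rightarrow> (nat set \<Rightarrow> bit) \<Rightarrow> bit" where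
  "component_sum t j c = (\<Sum>v | v \<in> A \<and> mh j v \<le> t. c {v})"

lemma basin_sum_components:
  assumes c: "c \<in> chains0 (L t)" and i: "i \<in> alive t"
  shows "basin_sum i c = (\<Sum>j\<in>alive t \<inter> basin i. component_sum t j c)"
proof -
  let ?S = "basin i \<inter> verts t"
  have img: "oldest t ` ?S \<subseteq> alive t \<inter> basin i"
    using oldest basin_component[OF i] by (auto simp: alive_def)
  have "basin_sum i c = (\<Sum>v\<in>?S. c {v})"
    unfolding basin_sum_def using chain_vertex_zero[OF c] by (intro sum.mono_neutral_right) auto
  also have "\<dots> = (\<Sum>j\<in>alive t \<inter> basin i. \<Sum>v | v \<in> ?S \<and> oldest t v = j. c {v})"
    by (rule sum.group[OF _ _ img, symmetric]) auto
  also have "\<dots> = (\<Sum>j\<in>alive t \<inter> basin i. component_sum t j c)"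
  proof (rule sum.cong[OF refl])
    fix j assume j: "j \<in> alive t \<inter> basin i"
    have "{v. v \<in> ?S \<and> oldest t v = j} = {v. v \<in> A \<and> mh j v \<le> t}"
    proof (intro equalityI subsetI)
      fix v assume "v \<in> {v. v \<in> ?S \<and> oldest t v = j}"
      then show "v \<in> {v. v \<in> A \<and> mh j v \<le> t}"
        using oldest(2)[of v t] by (auto simp: merge_height_commute verts_def)
    next
      fix v assume v: "v \<in> {v. v \<in> A \<and> mh j v \<le> t}"
      then have "v \<in> verts t" using verts_component[of j v t] by blast
      moreover have "v \<in> basin i" using basin_component[OF i, of j v] j v by blast
      ultimately show "v \<in> {v. v \<in> ?S \<and> oldest t v = j}" using oldest_eq[of v t j] j v by blast
    qed
    then show "(\<Sum>v | v \<in> ?S \<and> oldest t v = j. c {v}) = component_sum t j c"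
      by (simp add: component_sum_def)
  qed
  finally show ?thesis .
qed

lemma component_sum_eq:
  assumes "mh i j \<le> t"
  shows "component_sum t i c = component_sum t j c"
proof -
  have "mh i v \<le> t \<longleftrightarrow> mh j v \<le> t" for v
    using assms merge_height_le_trans[of i j t v] merge_height_le_trans[of j i t v]
    by (auto simp: merge_height_commute)
  then show ?thesis by (simp add: component_sum_def)
qed

text \<open>An edge present at level \<open>t\<close> has both or none of its ends in the basin, so it contributes twice or not at all.\<close>
lemma basin_sum_boundary:
  assumes e: "e \<in> carrier (chain_space 1 (L t))" and i: "i \<in> alive t"
  shows "basin_sum i (boundary_map e) = 0"
proof -
  have basinA: "basin i \<subseteq> {1..n}" by (auto simp: basin_def)
  have step: "u \<in> basin i \<longleftrightarrow> Suc u \<in> basin i" if "e {u, Suc u} \<noteq> 0" for u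
  proof -
    from e that obtain k where "{u, Suc u} = {k, Suc k}" "k \<in> verts t" "Suc k \<in> verts t"
      by (rule edge_chain_support)
    then have "u \<in> verts t" "Suc u \<in> verts t" by (auto simp: doubleton_eq_iff)
    moreover from this have "mh u (Suc u) \<le> t"
      unfolding merge_height_le_iff by (auto simp: verts_def le_Suc_eq)
    ultimately show ?thesis
      using basin_component[OF i, of u "Suc u"] basin_component[OF i, of "Suc u" u]
      by (auto simp: merge_height_commute verts_def)
  qed
  have "(\<Sum>v\<in>basin i. e {v - 1, v}) = (\<Sum>v\<in>{1..n}. if v \<in> basin i then e {v - 1, v} else 0)"
    using basinA by (simp add: sum.If_cases Int_absorb1)
  also have "\<dots> = (\<Sum>u\<in>{0..<n}. if Suc u \<in> basin i then e {u, Suc u} else 0)"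
    by (rule sum.reindex_bij_witness[of _ Suc "\<lambda>v. v - 1"]) auto
  also have "\<dots> = (\<Sum>u\<in>{0..<n}. if u \<in> basin i then e {u, Suc u} else 0)"
  proof (rule sum.cong[OF refl])
    show "(if Suc u \<in> basin i then e {u, Suc u} else 0) = (if u \<in> basin i then e {u, Suc u} else 0)" for u
      using step[of u] by (cases "e {u, Suc u} = 0") auto
  qed
  also have "\<dots> = (\<Sum>u\<in>{0..n}. if u \<in> basin i then e {u, Suc u} else 0)"
  proof (rule sum.mono_neutral_left)
    have "Suc n \<notin> verts t" by (simp add: verts_def)
    have "e {n, Suc n} = 0"
    proof (rule ccontr)
      assume "e {n, Suc n} \<noteq> 0"
      from e this obtain k where "{n, Suc n} = {k, Suc k}" "k \<in> verts t" "Suc k \<in> verts t"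
        by (rule edge_chain_support)
      then show False using \<open>Suc n \<notin> verts t\<close> by (auto simp: doubleton_eq_iff)
    qed
    then show "\<forall>u\<in>{0..n} - {0..<n}. (if u \<in> basin i then e {u, Suc u} else 0) = 0" by auto
  qed auto
  also have "\<dots> = (\<Sum>v\<in>basin i. e {v, Suc v})"
  proof -
    have "{0..n} \<inter> basin i = basin i" using basinA by auto
    then show ?thesis by (simp add: sum.If_cases)
  qed
  finally show ?thesis
    unfolding basin_sum_def boundary_map_vertex[OF e] sum.distrib by simp
qed

text \<open>By triangularity the coefficients of \<open>c\<close> sum to zero over every component. Give the edge from \<open>k\<close> to \<open>Suc k\<close> the sum \<open>S k\<close>
  of the coefficients over the part of the component of \<open>k\<close> up to \<open>k\<close>. The boundary at \<open>u\<close> is then the difference of two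
  consecutive partial sums, that is \<open>c {u}\<close>, and nothing is left at the right end of a component because the
  total vanishes there.\<close>
lemma boundary_of_zero_sums:
  assumes c: "c \<in> chains0 (L t)" and zero: "\<And>i. i \<in> alive t \<Longrightarrow> basin_sum i c = 0"
  shows "c \<in> boundaries 0 (L t)"
proof -
  have "component_sum t j c = 0" if "j \<in> alive t" for j
    by (rule basin_sums_determine[where b = "\<lambda>_. 0", OF _ that])
      (use zero basin_sum_components[OF c] in simp)
  then have comp: "component_sum t u c = 0" if "u \<in> verts t" for u
    using component_sum_eq[of u "oldest t u" t c] oldest[OF that] by simp
  define S where "S u = (\<Sum>v | v \<in> A \<and> mh u v \<le> t \<and> v \<le> u. c {v})" for u
  define e where "e \<sigma> = (if \<exists>k\<in>verts t. Suc k \<in> verts t \<and> \<sigma> = {k, Suc k} then S (Min \<sigma>) else 0)" for \<sigma>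
  have e_edge: "e {k, Suc k} = (if k \<in> verts t \<and> Suc k \<in> verts t then S k else 0)" for k
  proof -
    have "(\<exists>k'\<in>verts t. Suc k' \<in> verts t \<and> {k, Suc k} = {k', Suc k'}) \<longleftrightarrow> k \<in> verts t \<and> Suc k \<in> verts t"
      by (auto simp: doubleton_eq_iff)
    then show ?thesis by (simp add: e_def)
  qed
  have e: "e \<in> carrier (chain_space 1 (L t))"
  proof -
    have sub: "{\<sigma>. e \<sigma> \<noteq> 0} \<subseteq> (\<lambda>k. {k, Suc k}) ` {k \<in> verts t. Suc k \<in> verts t}"
      by (auto simp: e_def split: if_splits)
    moreover have "finite ((\<lambda>k. {k, Suc k}) ` {k \<in> verts t. Suc k \<in> verts t})" by simp
    ultimately have "finite {\<sigma>. e \<sigma> \<noteq> 0}" by (rule finite_subset)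
    moreover have "(\<lambda>k. {k, Suc k}) ` {k \<in> verts t. Suc k \<in> verts t} \<subseteq> {\<sigma> \<in> L t. card \<sigma> = 1 + 1}"
      by (auto simp: edge_mem)
    ultimately show ?thesis using sub by (simp add: chain_space_def)
  qed
  have split_S: "S u = (if u - 1 \<in> verts t then S (u - 1) else 0) + c {u}" if u: "u \<in> verts t" for u
  proof -
    have "1 \<le> u" "u \<in> A" "x u \<le> t" using u by (auto simp: verts_def)
    \<comment> \<open>A vertex to the left of \<open>u\<close> is connected to \<open>u\<close> exactly through \<open>u - 1\<close>.\<close>
    have seg: "mh u v \<le> t \<longleftrightarrow> u - 1 \<in> verts t \<and> mh (u - 1) v \<le> t" if "v \<in> A" "v < u" for v
    proof -
      have "mh u v \<le> t \<longleftrightarrow> (\<forall>k\<in>{v..u}. x k \<le> t)" using that by (simp add: merge_height_le_iff)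
      also have "{v..u} = insert u {v..u - 1}" using that by auto
      also have "(\<forall>k\<in>insert u {v..u - 1}. x k \<le> t) \<longleftrightarrow> (\<forall>k\<in>{v..u - 1}. x k \<le> t)"
        using \<open>x u \<le> t\<close> by simp
      also have "\<dots> \<longleftrightarrow> mh (u - 1) v \<le> t"
      proof -
        have "v \<le> u - 1" using that by simp
        then show ?thesis by (simp add: merge_height_le_iff min_absorb2 max_absorb1)
      qed
      also have "\<dots> \<longleftrightarrow> u - 1 \<in> verts t \<and> mh (u - 1) v \<le> t"
        using merge_height_ge(1)[of x "u - 1" v] that u by (auto simp: verts_def)
      finally show ?thesis .
    qed
    have "{v. v \<in> A \<and> mh u v \<le> t \<and> v \<le> u} = insert u {v. v \<in> A \<and> mh u v \<le> t \<and> v < u}"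
      using \<open>u \<in> A\<close> \<open>x u \<le> t\<close> by auto
    then have "S u = c {u} + (\<Sum>v | v \<in> A \<and> mh u v \<le> t \<and> v < u. c {v})"
      unfolding S_def by simp
    also have "{v. v \<in> A \<and> mh u v \<le> t \<and> v < u} =
        (if u - 1 \<in> verts t then {v. v \<in> A \<and> mh (u - 1) v \<le> t \<and> v \<le> u - 1} else {})"
      using seg \<open>1 \<le> u\<close> by (auto simp: less_eq_Suc_le)
    finally show ?thesis by (simp add: S_def add.commute)
  qed
  have last_S: "S u = 0" if u: "u \<in> verts t" "Suc u \<notin> verts t" for u
  proof -
    have "v \<le> u" if v: "v \<in> A" "mh u v \<le> t" for v
    proof (rule ccontr)
      assume "\<not> v \<le> u"
      then have "Suc u \<in> {min u v..max u v}" by auto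
      then have "x (Suc u) \<le> t" using v(2) unfolding merge_height_le_iff by blast
      then show False using u v \<open>\<not> v \<le> u\<close> by (auto simp: verts_def)
    qed
    then have "{v. v \<in> A \<and> mh u v \<le> t \<and> v \<le> u} = {v. v \<in> A \<and> mh u v \<le> t}" by blast
    then show ?thesis using comp[OF u(1)] by (simp add: S_def component_sum_def)
  qed
  have "boundary_map e = c"
  proof
    fix \<tau>
    show "boundary_map e \<tau> = c \<tau>"
    proof (cases "\<exists>u. \<tau> = {u}")
      case False
      then have "c \<tau> = 0" using chain_vertices[OF c, of \<tau>] by blast
      then show ?thesis using boundary_map_other[OF e] False by auto
    next
      case True
      then obtain u where u: "\<tau> = {u}" by blast
      have bd: "boundary_map e \<tau> = e {u, Suc u} + e {u - 1, u}"
        unfolding u by (rule boundary_map_vertex[OF e])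
      show ?thesis
      proof (cases "u \<in> verts t")
        case True
        then have "Suc (u - 1) = u" by (auto simp: verts_def)
        then have "e {u - 1, u} = (if u - 1 \<in> verts t then S (u - 1) else 0)"
          using e_edge[of "u - 1"] True by simp
        moreover have "e {u, Suc u} = S u" using e_edge[of u] True last_S[of u] by auto
        ultimately show ?thesis using bd split_S[OF True] unfolding u
          by (simp add: add.commute[of _ "c {u}"] add.assoc)
      next
        case False
        then have "e {u, Suc u} = 0" using e_edge[of u] by simp
        moreover have "e {u - 1, u} = 0"
        proof (rule ccontr)
          assume "e {u - 1, u} \<noteq> 0"
          from e this obtain k where "{u - 1, u} = {k, Suc k}" "k \<in> verts t" "Suc k \<in> verts t"
            by (rule edge_chain_support)
          then show False using False by (auto simp: doubleton_eq_iff)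
        qed
        ultimately show ?thesis using bd chain_vertex_zero[OF c False] unfolding u by simp
      qed
    qed
  qed
  then show ?thesis using e unfolding boundaries_def by (intro image_eqI[of _ _ e]) auto
qed

lemma boundaries_subset: "boundaries 0 (L t) \<subseteq> chains0 (L t)"
proof
  fix c assume "c \<in> boundaries 0 (L t)"
  then obtain e where e: "e \<in> carrier (chain_space 1 (L t))" and c: "c = boundary_map e"
    by (auto simp: boundaries_def)
  show "c \<in> chains0 (L t)"
  proof (rule chains0I)
    fix \<sigma> assume nz: "c \<sigma> \<noteq> 0"
    then obtain u where u: "\<sigma> = {u}" using boundary_map_other[OF e, of \<sigma>] c by blast
    have "u \<in> verts t"
    proof (rule ccontr)
      assume "u \<notin> verts t"
      have "e {u, Suc u} = 0"
        using edge_chain_support[OF e, of "{u, Suc u}"] \<open>u \<notin> verts t\<close> by (metis doubleton_eq_iff)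
      moreover have "e {u - 1, u} = 0"
        using edge_chain_support[OF e, of "{u - 1, u}"] \<open>u \<notin> verts t\<close> by (metis doubleton_eq_iff)
      ultimately show False using nz u c boundary_map_vertex[OF e, of u] by simp
    qed
    then show "\<exists>v\<in>verts t. \<sigma> = {v}" using u by blast
  qed
qed

lemma boundaries_iff:
  assumes "c \<in> chains0 (L t)"
  shows "c \<in> boundaries 0 (L t) \<longleftrightarrow> (\<forall>i\<in>alive t. basin_sum i c = 0)"
  using boundary_of_zero_sums[OF assms] basin_sum_boundary by (auto simp: boundaries_def)

text \<open>Prescribe coefficients at the alive vertices only. Passing to basin sums is then an injective map of a finite set to
  itself, by triangularity, hence surjective.\<close>
lemma ex_chain_basin_sums:
  fixes a :: "nat \<Rightarrow> bit"
  shows "\<exists>c\<in>chains0 (L t). \<forall>i\<in>alive t. basin_sum i c = a i"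
proof -
  let ?F = "alive t \<rightarrow>\<^sub>E (UNIV :: bit set)"
  let ?E = "\<lambda>b. \<lambda>i\<in>alive t. \<Sum>j\<in>alive t \<inter> basin i. b j"
  have "?E ` ?F = ?F"
  proof (rule endo_inj_surj)
    show "finite ?F" by (intro finite_PiE) auto
    show "?E ` ?F \<subseteq> ?F" by auto
    show "inj_on ?E ?F"
    proof (rule inj_onI)
      fix b b' assume *: "b \<in> ?F" "b' \<in> ?F" "?E b = ?E b'"
      show "b = b'"
      proof (rule PiE_ext[OF *(1,2)])
        fix j assume j: "j \<in> alive t"
        show "b j = b' j"
        proof (rule basin_sums_determine[OF _ j])
          fix i assume "i \<in> alive t"
          then show "(\<Sum>j\<in>alive t \<inter> basin i. b j) = (\<Sum>j\<in>alive t \<inter> basin i. b' j)"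
            using fun_cong[OF *(3), of i] by simp
        qed
      qed
    qed
  qed
  moreover have "restrict a (alive t) \<in> ?F" by simp
  ultimately obtain b where b: "restrict a (alive t) = ?E b" by (metis (no_types, lifting) imageE)
  define c where "c \<sigma> = (if \<exists>j\<in>alive t. \<sigma> = {j} then b (THE j. \<sigma> = {j}) else 0)" for \<sigma>
  have c_vertex: "c {v} = (if v \<in> alive t then b v else 0)" for v by (simp add: c_def)
  have "c \<in> chains0 (L t)"
  proof (rule chains0I)
    fix \<sigma> assume "c \<sigma> \<noteq> 0"
    then show "\<exists>v\<in>verts t. \<sigma> = {v}" by (auto simp: c_def alive_def verts_def split: if_splits)
  qed
  moreover have "basin_sum i c = a i" if i: "i \<in> alive t" for i
  proof -
    have "basin_sum i c = (\<Sum>j\<in>alive t \<inter> basin i. b j)"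
      by (simp add: basin_sum_def c_vertex sum.If_cases Int_commute)
    also have "\<dots> = a i" using fun_cong[OF b, of i] i by simp
    finally show ?thesis .
  qed
  ultimately show ?thesis by blast
qed

definition diagram :: "(ereal \<times> ereal) multiset" where
  "diagram = image_mset (pers_point x A) (mset_set (path_births x A))"

lemma basin_sum_early:
  assumes c: "c \<in> chains0 (L s)" and "s < x i"
  shows "basin_sum i c = 0"
  unfolding basin_sum_def
proof (rule sum.neutral, rule ballI)
  fix v assume "v \<in> basin i"
  then have "v \<notin> verts s" using basin_value[of v i] assms(2) by (auto simp: verts_def)
  then show "c {v} = 0" by (rule chain_vertex_zero[OF c])
qed

lemma basin_sum_add: "basin_sum i (\<lambda>\<sigma>. c \<sigma> + d \<sigma>) = basin_sum i c + basin_sum i d"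
  by (simp add: basin_sum_def sum.distrib)

lemma basin_sum_smult: "basin_sum i (\<lambda>\<sigma>. a * c \<sigma>) = a * basin_sum i c"
  by (simp add: basin_sum_def sum_distrib_left)

text \<open>The coordinates of the isomorphism are the basin sums of the vertices alive at \<open>t\<close>.\<close>
lemma diagram_pers_isomorphic:
  "pers_isomorphic (\<lambda>t. homology 0 (L t)) (\<lambda>s t. homology_incl 0 (L t))
     (interval_sum diagram) (interval_sum_map diagram)" (is ?iso)
  and homology_incl_carrier: "s \<le> t \<Longrightarrow> C \<in> carrier (homology 0 (L s)) \<Longrightarrow>
     homology_incl 0 (L t) C \<in> carrier (homology 0 (L t))"
proof -
  let ?B = "path_births x A" and ?J = "mset_index diagram"
  have "finite ?B" by (simp add: path_births_def)
  from mset_index_bij[OF this, of "pers_point x A"]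
  obtain \<beta> where \<beta>: "bij_betw \<beta> ?B ?J" and fst_\<beta>: "\<And>i. i \<in> ?B \<Longrightarrow> fst (\<beta> i) = pers_point x A i"
    unfolding diagram_def by blast
  define idx where "idx = inv_into ?B \<beta>"
  have idx: "idx j \<in> ?B" "\<beta> (idx j) = j" "fst j = pers_point x A (idx j)" if "j \<in> ?J" for j
  proof -
    show "idx j \<in> ?B" "\<beta> (idx j) = j"
      using that \<beta> unfolding idx_def by (metis bij_betw_def inv_into_into, metis bij_betw_inv_into_right)
    then show "fst j = pers_point x A (idx j)" using fst_\<beta> by metis
  qed
  have idx_\<beta>: "idx (\<beta> i) = i" "\<beta> i \<in> ?J" if "i \<in> ?B" for i
    using \<beta> that unfolding idx_def by (metis bij_betw_inv_into_left, metis bij_betwE)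
  have alive_births: "alive t \<subseteq> ?B" for t
    by (auto simp: alive_def path_births_def intro: le_less_trans[of _ "ereal t"])
  have alive_iff: "fst (fst j) \<le> ereal t \<and> ereal t < snd (fst j) \<longleftrightarrow> idx j \<in> alive t" if "j \<in> ?J" for j t
    using idx[OF that] by (auto simp: pers_point_def alive_def path_births_def)
  define \<Psi> where "\<Psi> t c = (\<lambda>j\<in>?J. if idx j \<in> alive t then basin_sum (idx j) c else 0)" for t c
  have \<Psi>_eq: "\<Psi> t c = \<Psi> t d \<longleftrightarrow> (\<forall>i\<in>alive t. basin_sum i c = basin_sum i d)" for t c d
  proof
    assume eq: "\<Psi> t c = \<Psi> t d"
    show "\<forall>i\<in>alive t. basin_sum i c = basin_sum i d"
    proof
      fix i assume i: "i \<in> alive t"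
      then have "i \<in> ?B" using alive_births by blast
      then show "basin_sum i c = basin_sum i d"
        using fun_cong[OF eq, of "\<beta> i"] i by (simp add: \<Psi>_def idx_\<beta>)
    qed
  qed (auto simp: \<Psi>_def fun_eq_iff)
  have pres: "homology_0_presentation (L t) (interval_sum diagram t) (\<Psi> t)" for t
  proof
    show "boundaries 0 (L t) \<subseteq> chains0 (L t)" by (rule boundaries_subset)
    show "\<Psi> t ` chains0 (L t) = carrier (interval_sum diagram t)"
    proof (intro equalityI subsetI)
      fix \<phi> assume "\<phi> \<in> \<Psi> t ` chains0 (L t)"
      then show "\<phi> \<in> carrier (interval_sum diagram t)"
        unfolding interval_sum_carrier \<Psi>_def using alive_iff by (auto split: if_splits)
    next
      fix \<phi> assume \<phi>: "\<phi> \<in> carrier (interval_sum diagram t)"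
      obtain c where c: "c \<in> chains0 (L t)" "\<forall>i\<in>alive t. basin_sum i c = \<phi> (\<beta> i)"
        using ex_chain_basin_sums[of t "\<lambda>i. \<phi> (\<beta> i)"] by blast
      have "\<phi> = \<Psi> t c"
      proof
        fix j
        show "\<phi> j = \<Psi> t c j"
        proof (cases "j \<in> ?J")
          case True
          show ?thesis
          proof (cases "idx j \<in> alive t")
            case False
            then have "\<phi> j = 0" using \<phi> alive_iff[OF True] True unfolding interval_sum_carrier by blast
            then show ?thesis using True False by (simp add: \<Psi>_def)
          qed (use True c(2) idx(2)[OF True] in \<open>simp add: \<Psi>_def\<close>)
        next
          case False
          have "\<phi> \<in> ?J \<rightarrow>\<^sub>E UNIV" using \<phi> unfolding interval_sum_carrier by blast
          from PiE_arb[OF this False] show ?thesis using False by (simp add: \<Psi>_def)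
        qed
      qed
      then show "\<phi> \<in> \<Psi> t ` chains0 (L t)" using c(1) by blast
    qed
    fix z z' assume z: "z \<in> chains0 (L t)" "z' \<in> chains0 (L t)"
    show "\<Psi> t z = \<Psi> t z' \<longleftrightarrow> (\<lambda>\<sigma>. z \<sigma> + z' \<sigma>) \<in> boundaries 0 (L t)"
      unfolding \<Psi>_eq boundaries_iff[OF chains0_add[OF z]] basin_sum_add bit_add_eq_0_iff ..
    show "\<Psi> t (\<lambda>\<sigma>. z \<sigma> + z' \<sigma>) = \<Psi> t z \<oplus>\<^bsub>interval_sum diagram t\<^esub> \<Psi> t z'"
      by (auto simp: \<Psi>_def direct_sum_def interval_space_def basin_sum_add fun_eq_iff)
  next
    fix z a
    show "\<Psi> t (\<lambda>\<sigma>. a * z \<sigma>) = a \<odot>\<^bsub>interval_sum diagram t\<^esub> \<Psi> t z"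
      by (auto simp: \<Psi>_def direct_sum_def interval_space_def basin_sum_smult fun_eq_iff)
  qed
  have nat: "\<Psi> t z = interval_sum_map diagram s t (\<Psi> s z)" if st: "s \<le> t" and z: "z \<in> chains0 (L s)" for s t z
  proof
    fix j
    show "\<Psi> t z j = interval_sum_map diagram s t (\<Psi> s z) j"
    proof (cases "j \<in> ?J")
      case True
      have im: "interval_map (fst j) s t a = (if idx j \<in> alive s \<and> idx j \<in> alive t then a else 0)" for a
        using alive_iff[OF True, of s] alive_iff[OF True, of t] by (auto simp: interval_map_def)
      have "basin_sum (idx j) z = 0" if al: "idx j \<in> alive t" "idx j \<notin> alive s"
      proof (rule basin_sum_early[OF z])
        have "ereal s < D (idx j)" using al(1) st by (auto simp: alive_def intro: le_less_trans[of _ "ereal t"])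
        then show "s < x (idx j)" using al by (auto simp: alive_def)
      qed
      then show ?thesis using True by (simp add: \<Psi>_def im)
    qed (simp add: \<Psi>_def)
  qed
  show ?iso by (rule pers_isomorphic_homology_0(1)[OF pres complex_mono nat])
  show "s \<le> t \<Longrightarrow> C \<in> carrier (homology 0 (L s)) \<Longrightarrow>
     homology_incl 0 (L t) C \<in> carrier (homology 0 (L t))"
    by (rule pers_isomorphic_homology_0(2)[OF pres complex_mono nat])
qed

lemma diagram_subset: "set_mset diagram \<subseteq> Delta"
  by (auto simp: diagram_def path_births_def pers_point_def Delta_def)

theorem pers_diagram_path: "pers_diagram 0 L = diagram"
  unfolding pers_diagram_def
proof (rule the_equality)
  show "is_pers_diagram 0 L diagram"
    unfolding is_pers_diagram_def using diagram_subset diagram_pers_isomorphic by simp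
  fix P assume "is_pers_diagram 0 L P"
  then have P: "set_mset P \<subseteq> Delta"
    "pers_isomorphic (\<lambda>t. homology 0 (L t)) (\<lambda>s t. homology_incl 0 (L t)) (interval_sum P) (interval_sum_map P)"
    by (simp_all add: is_pers_diagram_def)
  show "P = diagram"
    by (rule interval_decomposition_unique[OF P(2) diagram_pers_isomorphic _ P(1) diagram_subset])
      (use homology_incl_carrier in blast)
qed

end

section \<open>Diagrams as counting measures\<close>

lemma space_diagram_measure: "space (diagram_measure P) = Delta"
  and sets_diagram_measure: "sets (diagram_measure P) = sets (restrict_space borel Delta)"
proof -
  have *: "sets (restrict_space borel Delta) \<subseteq> Pow Delta"
    using sets.space_closed[of "restrict_space borel Delta"] by (simp add: space_restrict_space)
  show "space (diagram_measure P) = Delta"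
    unfolding diagram_measure_def by (rule space_measure_of[OF *])
  have "sigma_sets Delta (sets (restrict_space borel Delta)) = sets (restrict_space borel Delta)"
    using sets.sigma_sets_eq[of "restrict_space borel Delta"] by (simp add: space_restrict_space)
  then show "sets (diagram_measure P) = sets (restrict_space borel Delta)"
    unfolding diagram_measure_def by (simp add: sets_measure_of[OF *])
qed

text \<open>Countable additivity of the sum of point masses, which makes \<open>diagram_measure\<close> the measure it is meant to be.\<close>
lemma emeasure_diagram_measure:
  assumes fin: "finite B" and A: "A \<in> sets (restrict_space borel Delta)"
  shows "emeasure (diagram_measure (image_mset f (mset_set B))) A = of_nat (card {i \<in> B. f i \<in> A})"
proof -
  let ?S = "sets (restrict_space borel Delta)" and ?P = "image_mset f (mset_set B)"
  let ?\<mu> = "\<lambda>A. \<Sum>p\<in>#?P. indicator A p :: ennreal"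
  have sum: "?\<mu> A = (\<Sum>i\<in>B. indicator A (f i))" for A
    by (simp add: image_mset.compositionality sum_unfold_sum_mset o_def)
  have sub: "?S \<subseteq> Pow Delta"
    using sets.space_closed[of "restrict_space borel Delta"] by (simp add: space_restrict_space)
  have "emeasure (diagram_measure ?P) A = ?\<mu> A"
  proof (rule emeasure_measure_of[OF diagram_measure_def[of ?P] sub])
    show "A \<in> sets (diagram_measure ?P)" using A by (simp add: sets_diagram_measure)
    show "positive (sets (diagram_measure ?P)) ?\<mu>" by (simp add: positive_def)
    show "countably_additive (sets (diagram_measure ?P)) ?\<mu>"
    proof (rule countably_additiveI)
      fix E :: "nat \<Rightarrow> (ereal \<times> ereal) set" assume "disjoint_family E"
      then have "(\<Sum>k. indicator (E k) (f i)) = (indicator (\<Union>k. E k) (f i) :: ennreal)" for i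
        by (rule suminf_indicator)
      then show "(\<Sum>k. ?\<mu> (E k)) = ?\<mu> (\<Union>k. E k)"
        unfolding sum by (subst suminf_sum) auto
    qed
  qed
  also have "\<dots> = of_nat (card {i \<in> B. f i \<in> A})"
    unfolding sum using fin by (simp add: indicator_def Int_def)
  finally show ?thesis .
qed

definition point_count :: "(nat \<Rightarrow> real) \<Rightarrow> nat \<Rightarrow> (ereal \<times> ereal) set \<Rightarrow> nat" where
  "point_count y n U = card {i \<in> path_births y {..<n}. pers_point y {..<n} i \<in> U}"

lemma open_Delta: "open Delta"
proof -
  have "Delta = {p. - \<infinity> < fst p} \<inter> {p. fst p < snd p}" by (auto simp: Delta_def)
  moreover have "open {p :: ereal \<times> ereal. - \<infinity> < fst p}" "open {p :: ereal \<times> ereal. fst p < snd p}"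
    by (intro open_Collect_less continuous_intros)+
  ultimately show ?thesis by (metis open_Int)
qed

lemma Delta_fin_eq: "Delta_fin = Delta \<inter> {p. snd p < \<infinity>}"
proof -
  have "(a, b) \<in> Delta_fin \<longleftrightarrow> (a, b) \<in> Delta \<inter> {p. snd p < \<infinity>}" for a b
    by (cases a; cases b) (auto simp: Delta_fin_def Delta_def)
  then show ?thesis by auto
qed

lemma open_Delta_fin: "open Delta_fin"
proof -
  have "open {p :: ereal \<times> ereal. snd p < \<infinity>}" by (intro open_Collect_less continuous_intros)
  then show ?thesis unfolding Delta_fin_eq using open_Delta by (rule open_Int[rotated])
qed

text \<open>The vertices of the path that carry finite values are \<open>1, \<dots>, n\<close>, the coordinates of a sequence start at \<open>0\<close>.\<close>
lemma xi0_emeasure: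
  assumes U: "U \<in> sets borel" "U \<subseteq> Delta"
  shows "emeasure (xi0 x n) U = of_nat (point_count (\<lambda>i. x (Suc i)) n U)"
proof -
  let ?y = "\<lambda>i. x (Suc i)"
  have img: "(\<lambda>k. k + 1) ` {..<n} = {1..n}"
    using image_add_atLeastLessThan'[of 1 0 n] by (simp add: lessThan_atLeast0 atLeastLessThanSuc_atLeastAtMost)
  have death: "death ?y {..<n} i = death x {1..n} (Suc i)" for i
    using death_shift[of x 1 "{..<n}" i] img by simp
  have "{i \<in> path_births x {1..n}. pers_point x {1..n} i \<in> U} =
      Suc ` {i \<in> path_births ?y {..<n}. pers_point ?y {..<n} i \<in> U}" (is "?R = Suc ` ?S")
  proof (intro equalityI subsetI)
    fix i assume i: "i \<in> ?R"
    then obtain k where "i = Suc k" by (cases i) (auto simp: path_births_def)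
    then show "i \<in> Suc ` ?S" using i by (auto simp: path_births_def pers_point_def death)
  qed (auto simp: path_births_def pers_point_def death)
  then have "card ?R = point_count ?y n U" by (simp add: point_count_def card_image)
  moreover have "emeasure (xi0 x n) U = of_nat (card ?R)"
    unfolding xi0_def path_filtration.pers_diagram_path path_filtration.diagram_def
    by (rule emeasure_diagram_measure) (use U in \<open>auto simp: path_births_def sets_restrict_space_iff open_Delta\<close>)
  ultimately show ?thesis by simp
qed

lemma space_xi0: "space (xi0 x n) = Delta" and sets_xi0: "sets (xi0 x n) = sets (restrict_space borel Delta)"
  by (simp_all add: xi0_def space_diagram_measure sets_diagram_measure)

lemma xi0_fin_emeasure:
  assumes U: "U \<in> sets borel" "U \<subseteq> Delta_fin"
  shows "emeasure (xi0_fin x n) U = of_nat (point_count (\<lambda>i. x (Suc i)) n U)"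
proof -
  have "Delta_fin \<subseteq> Delta" by (auto simp: Delta_fin_def)
  moreover have "Delta_fin \<in> sets (xi0 x n)"
    using open_Delta_fin open_Delta calculation by (auto simp: sets_xi0 sets_restrict_space_iff)
  ultimately show ?thesis
    unfolding xi0_fin_def using U xi0_emeasure[of U x n]
    by (subst emeasure_restrict_space) (auto simp: space_xi0 Int_absorb2)
qed

lemma space_xi0_fin: "space (xi0_fin x n) = Delta_fin"
  and sets_xi0_fin: "sets (xi0_fin x n) = sets (restrict_space borel Delta_fin)"
proof -
  have sub: "Delta_fin \<subseteq> Delta" by (auto simp: Delta_fin_def)
  then show "space (xi0_fin x n) = Delta_fin"
    by (auto simp: xi0_fin_def space_restrict_space space_xi0)
  have "sets (xi0_fin x n) = sets (restrict_space (restrict_space borel Delta) Delta_fin)"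
    unfolding xi0_fin_def by (rule sets_restrict_space_cong) (rule sets_xi0)
  also have "\<dots> = sets (restrict_space borel Delta_fin)"
    using sub by (subst sets_restrict_restrict_space) (simp add: Int_absorb1 sets_restrict_space)
  finally show "sets (xi0_fin x n) = sets (restrict_space borel Delta_fin)" .
qed

lemma normalize_counting:
  fixes N :: "'a::topological_space measure" and c :: "'a set \<Rightarrow> nat"
  assumes S: "S \<in> sets borel" "space N = S" "sets N = sets (restrict_space borel S)"
    and c: "\<And>U. U \<in> sets borel \<Longrightarrow> U \<subseteq> S \<Longrightarrow> emeasure N U = of_nat (c U)" and pos: "0 < c S"
  shows "prob_space (normalize_measure N)"
    and "U \<in> sets borel \<Longrightarrow> U \<subseteq> S \<Longrightarrow> measure (normalize_measure N) U = real (c U) / real (c S)"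
proof -
  have NS: "emeasure N (space N) = of_nat (c S)" using c[OF S(1)] S(2) by simp
  have em: "emeasure (normalize_measure N) U = ennreal (real (c U) / real (c S))"
    if "U \<in> sets borel" "U \<subseteq> S" for U
  proof -
    have "emeasure (normalize_measure N) U = 1 / of_nat (c S) * of_nat (c U)"
      unfolding normalize_measure_def NS using c[OF that] by simp
    also have "\<dots> = ennreal (1 / real (c S)) * ennreal (real (c U))"
      using pos by (simp add: ennreal_of_nat_eq_real_of_nat flip: divide_ennreal ennreal_1)
    also have "\<dots> = ennreal (real (c U) / real (c S))" by (simp flip: ennreal_mult)
    finally show ?thesis .
  qed
  show "prob_space (normalize_measure N)"
  proof
    have "space (normalize_measure N) = S" by (simp add: normalize_measure_def space_scale_measure S)
    then show "emeasure (normalize_measure N) (space (normalize_measure N)) = 1"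
      using em[OF S(1)] pos by simp
  qed
  show "measure (normalize_measure N) U = real (c U) / real (c S)" if "U \<in> sets borel" "U \<subseteq> S"
    using em[OF that] by (simp add: measure_def)
qed

section \<open>Ergodic sequences without atoms\<close>

definition shift_seq :: "(nat \<Rightarrow> real) \<Rightarrow> nat \<Rightarrow> real" where
  "shift_seq y = (\<lambda>i. y (Suc i))"

lemma shift_seq_apply [simp]: "shift_seq y i = y (Suc i)"
  by (simp add: shift_seq_def)

lemma shift_seq_pow: "(shift_seq ^^ k) y = (\<lambda>i. y (i + k))"
  by (induction k arbitrary: y) (simp_all add: shift_seq_def)

text \<open>An infimum over an index set that does not depend on \<open>y\<close>, which shows that the death is measurable in \<open>y\<close>.\<close>
lemma death_eq_INF: "death y A i = (INF j\<in>A. if older y j i then ereal (merge_height y i j) else \<infinity>)"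
proof (rule antisym)
  show "death y A i \<le> (INF j\<in>A. if older y j i then ereal (merge_height y i j) else \<infinity>)"
  proof (rule INF_greatest)
    fix j assume "j \<in> A"
    then show "death y A i \<le> (if older y j i then ereal (merge_height y i j) else \<infinity>)"
      by (simp add: death_le)
  qed
  show "(INF j\<in>A. if older y j i then ereal (merge_height y i j) else \<infinity>) \<le> death y A i"
    unfolding death_def
  proof (rule INF_greatest)
    fix j assume "j \<in> {j \<in> A. older y j i}"
    then show "(INF j\<in>A. if older y j i then ereal (merge_height y i j) else \<infinity>) \<le> ereal (merge_height y i j)"
      by (intro INF_lower2[of j]) simp_all
  qed
qed

text \<open>The law of a stationary and ergodic real sequence, started at index \<open>0\<close>, whose marginals have no atoms and whose
  neighbouring entries differ.\<close>
locale ergodic_sequence = ergodic_system Q shift_seq for Q :: "(nat \<Rightarrow> real) measure" +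
  assumes sets_Q: "sets Q = sets (Pi\<^sub>M UNIV (\<lambda>_. borel))"
    and no_atoms: "prob {y \<in> space Q. y 0 = a} = 0"
    and distinct: "prob {y \<in> space Q. y 0 = y 1} = 0"
begin

lemma space_Q: "space Q = UNIV"
  using sets_eq_imp_space_eq[OF sets_Q] by (simp add: space_PiM)

lemma coordinate_measurable [measurable (raw)]: "(\<lambda>y. y i) \<in> borel_measurable Q"
  unfolding measurable_cong_sets[OF sets_Q refl] by (rule measurable_component_singleton) simp

lemma merge_height_measurable [measurable]: "(\<lambda>y. merge_height y i j) \<in> borel_measurable Q"
  unfolding merge_height_def by (rule borel_measurable_Max) auto

lemma coordinate_order_measurable [measurable]:
  "Measurable.pred Q (\<lambda>y. y i < y j)" "Measurable.pred Q (\<lambda>y. y i \<le> y j)"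
  unfolding pred_def by (intro borel_measurable_less borel_measurable_le coordinate_measurable)+

lemma older_measurable [measurable]: "Measurable.pred Q (\<lambda>y. older y j i)"
proof -
  have *: "(\<lambda>y. older y j i) = (if j < i then (\<lambda>y. y j \<le> y i) else (\<lambda>y. y j < y i))"
    by (auto simp: fun_eq_iff older_def)
  show ?thesis unfolding * using coordinate_order_measurable by simp
qed

lemma death_measurable [measurable]: "(\<lambda>y. death y A i) \<in> borel_measurable Q"
  unfolding death_eq_INF by (rule borel_measurable_INF) auto

lemma settled_measurable [measurable]: "Measurable.pred Q (\<lambda>y. settled y {a..b} i)"
  "Measurable.pred Q (\<lambda>y. settled y {..b} i)"
  unfolding settled_def by measurable

lemma birth_measurable [measurable]: "Measurable.pred Q (\<lambda>y. i \<in> path_births y A)"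
  unfolding path_births_def mem_Collect_eq by measurable

lemma pers_point_measurable [measurable]: "(\<lambda>y. pers_point y A i) \<in> borel_measurable Q"
  unfolding pers_point_def by (intro borel_measurable_Pair) auto

lemma settled_in_measurable [measurable]:
  assumes [measurable]: "U \<in> sets borel"
  shows "settled_in R U \<in> sets Q"
proof -
  have "settled_in R U = {y \<in> space Q. settled y {..2 * R} R \<and> R \<in> path_births y {..2 * R} \<and>
      pers_point y {..2 * R} R \<in> U}" by (simp add: settled_in_def space_Q)
  also have "\<dots> \<in> sets Q" by measurable
  finally show ?thesis .
qed

text \<open>The distribution function is continuous because the law has no atoms, so it takes every value between \<open>0\<close> and \<open>1\<close>.\<close>
lemma ex_low_level:
  assumes "0 < e"
  shows "\<exists>a. 0 < prob {y. y 0 \<le> a} \<and> prob {y. y 0 \<le> a} < e"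
proof -
  let ?N = "distr Q borel (\<lambda>y. y 0)"
  interpret N: real_distribution ?N by (rule real_distribution_distr) simp
  have cdf: "cdf ?N a = prob {y. y 0 \<le> a}" for a
    by (simp add: cdf_def measure_distr vimage_def space_Q)
  define c where "c = min e 1 / 2"
  have c: "0 < c" "c < e" "c < 1" using assms by (auto simp: c_def)
  have "\<forall>\<^sub>F a in at_bot. cdf ?N a < c" using N.cdf_lim_at_bot c by (intro order_tendstoD)
  then obtain lo where lo: "cdf ?N lo < c" by (auto simp: eventually_at_bot_linorder)
  have "\<forall>\<^sub>F a in at_top. c < cdf ?N a" using N.cdf_lim_at_top_prob c by (intro order_tendstoD)
  then obtain hi where hi: "c < cdf ?N hi" by (auto simp: eventually_at_top_linorder)
  have "lo \<le> hi" using lo hi N.cdf_nondecreasing[of hi lo] by linarith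
  have "isCont (cdf ?N) a" for a
    using no_atoms[of a] by (simp add: N.isCont_cdf measure_distr vimage_def space_Q)
  then obtain a where "cdf ?N a = c"
    using IVT[of "cdf ?N" lo c hi] lo hi \<open>lo \<le> hi\<close> by auto
  then show ?thesis using c cdf by auto
qed

text \<open>Let \<open>a\<close> be a level with \<open>0 < prob {y. y 0 \<le> a} < e / 2\<close>. If the centre of the window is above \<open>a\<close> and the sequence
  falls to \<open>a\<close> or below on both sides of the centre, then the centre is settled. The event that the sequence stays above
  \<open>a\<close> forever is contained in its preimage under the shift, so by ergodicity it has probability zero.\<close>
lemma prob_unsettled_tendsto_0:
  "(\<lambda>R. prob {y. \<not> settled y {..2 * R} R}) \<longlonglongrightarrow> 0"
proof (rule order_tendstoI)
  fix e :: real assume "e < 0"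
  then show "\<forall>\<^sub>F R in sequentially. e < prob {y. \<not> settled y {..2 * R} R}"
    by (intro always_eventually) (auto intro: less_le_trans)
next
  fix e :: real assume "0 < e"
  then obtain a where a: "0 < prob {y. y 0 \<le> a}" "prob {y. y 0 \<le> a} < e / 2"
    using ex_low_level[of "e / 2"] by auto
  define H where "H n = {y :: nat \<Rightarrow> real. \<forall>l<n. a < y l}" for n :: nat
  have H_eq: "H n = {y \<in> space Q. \<forall>l<n. a < y l}" for n by (simp add: H_def space_Q)
  have [measurable]: "H n \<in> sets Q" for n unfolding H_eq by measurable
  have IntH: "(\<Inter>n. H n) = {y. \<forall>l. a < y l}" by (auto simp: H_def)
  have "prob (\<Inter>n. H n) \<in> {0, 1}"
  proof (rule subinvariant_trivial)
    show "(\<Inter>n. H n) \<in> sets Q" by measurable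
    show "AE y in Q. y \<in> (\<Inter>n. H n) \<longrightarrow> shift_seq y \<in> (\<Inter>n. H n)"
      by (auto simp: IntH intro!: AE_I2)
  qed
  moreover have "prob (\<Inter>n. H n) < 1"
  proof -
    have "(\<Inter>n. H n) \<subseteq> space Q - {y. y 0 \<le> a}" by (auto simp: IntH space_Q simp flip: not_less)
    moreover have *: "{y. y 0 \<le> a} \<in> sets Q"
    proof -
      have "{y. y 0 \<le> a} = {y \<in> space Q. y 0 \<le> a}" by (simp add: space_Q)
      also have "\<dots> \<in> sets Q" by measurable
      finally show ?thesis .
    qed
    ultimately have "prob (\<Inter>n. H n) \<le> prob (space Q - {y. y 0 \<le> a})"
      by (intro finite_measure_mono) auto
    also have "\<dots> = 1 - prob {y. y 0 \<le> a}" using * by (rule prob_compl)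
    finally show ?thesis using a by simp
  qed
  ultimately have "prob (\<Inter>n. H n) = 0" by auto
  moreover have "(\<lambda>n. prob (H n)) \<longlonglongrightarrow> prob (\<Inter>n. H n)"
  proof (rule finite_Lim_measure_decseq)
    show "decseq H" by (auto simp: decseq_def H_def)
  qed auto
  ultimately have "(\<lambda>n. prob (H n)) \<longlonglongrightarrow> 0" by simp
  then have "\<forall>\<^sub>F n in sequentially. prob (H n) < e / 4"
    by (rule order_tendstoD) (use \<open>0 < e\<close> in simp)
  then show "\<forall>\<^sub>F R in sequentially. prob {y. \<not> settled y {..2 * R} R} < e"
  proof eventually_elim
    case (elim R)
    let ?low = "{y \<in> space Q. y 0 \<le> a}"
    have [measurable]: "?low \<in> sets Q" "H R \<in> sets Q" by measurable
    have meas: "(shift_seq ^^ k) -` A \<inter> space Q \<in> sets Q" if "A \<in> sets Q" for k A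
      using T_pow_measurable that by (rule measurable_sets)
    have "{y. \<not> settled y {..2 * R} R} \<subseteq> ((shift_seq ^^ R) -` ?low \<inter> space Q) \<union>
        (H R \<union> ((shift_seq ^^ (Suc R)) -` H R \<inter> space Q))"
    proof
      fix y assume y: "y \<in> {y. \<not> settled y {..2 * R} R}"
      show "y \<in> ((shift_seq ^^ R) -` ?low \<inter> space Q) \<union> (H R \<union> ((shift_seq ^^ (Suc R)) -` H R \<inter> space Q))"
      proof (rule ccontr)
        assume "\<not> ?thesis"
        then have *: "a < y R" "y \<notin> H R" "(\<lambda>i. y (i + Suc R)) \<notin> H R"
          by (auto simp: shift_seq_pow space_Q simp del: funpow.simps)
        then obtain l k where "l < R" "y l \<le> a" "k < R" "y (k + Suc R) \<le> a"
          by (auto simp: H_def not_less)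
        with *(1) have "settled y {..2 * R} R"
          unfolding settled_def
          by (intro conjI bexI[of _ l] bexI[of _ "k + Suc R"]) auto
        with y show False by simp
      qed
    qed
    then have "prob {y. \<not> settled y {..2 * R} R} \<le> prob (((shift_seq ^^ R) -` ?low \<inter> space Q) \<union>
        (H R \<union> ((shift_seq ^^ (Suc R)) -` H R \<inter> space Q)))"
      by (rule finite_measure_mono) (intro sets.Un meas; measurable)
    also have "\<dots> \<le> prob ((shift_seq ^^ R) -` ?low \<inter> space Q) +
        prob (H R \<union> ((shift_seq ^^ (Suc R)) -` H R \<inter> space Q))"
      by (rule measure_Un_le[OF meas sets.Un[OF _ meas]]) measurable
    also have "prob (H R \<union> ((shift_seq ^^ (Suc R)) -` H R \<inter> space Q)) \<le>
        prob (H R) + prob ((shift_seq ^^ (Suc R)) -` H R \<inter> space Q)"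
      by (rule measure_Un_le[OF _ meas]) measurable
    finally have "prob {y. \<not> settled y {..2 * R} R} \<le> prob ?low + (prob (H R) + prob (H R))"
      using prob_vimage_pow[of ?low R, OF \<open>?low \<in> sets Q\<close>]
        prob_vimage_pow[of "H R" "Suc R", OF \<open>H R \<in> sets Q\<close>] by linarith
    then show ?case using a elim by (simp add: space_Q)
  qed
qed

text \<open>Otherwise, since neighbouring entries differ, every descent is almost surely followed by a descent, and by ergodicity the sequence almost surely starts
  with a descent or almost surely with an ascent. Both contradict stationarity; \<open>arctan\<close> provides a strictly
  increasing integrable function of the entries.\<close>
lemma prob_local_min_pos: "0 < prob {y. y 1 < y 0 \<and> y 1 < y 2}"
proof (rule ccontr)
  assume "\<not> 0 < prob {y. y 1 < y 0 \<and> y 1 < y 2}"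
  then have "prob {y \<in> space Q. y 1 < y 0 \<and> y 1 < y 2} = 0"
    by (simp add: not_less measure_le_0_iff space_Q)
  then have no_min: "AE y in Q. \<not> (y 1 < y 0 \<and> y 1 < y 2)"
    by (subst (asm) prob_eq_0) auto
  have neq: "AE y in Q. y 0 \<noteq> y 1"
    using distinct by (subst (asm) prob_eq_0) auto
  then have neq': "AE y in Q. y 1 \<noteq> y 2"
    using AE_pow[OF neq, of 1] by (simp add: numeral_2_eq_2)
  have "prob {y \<in> space Q. y 1 < y 0} \<in> {0, 1}"
  proof (rule subinvariant_trivial)
    show "AE y in Q. y \<in> {y \<in> space Q. y 1 < y 0} \<longrightarrow> shift_seq y \<in> {y \<in> space Q. y 1 < y 0}"
      using no_min neq' by eventually_elim (auto simp: numeral_2_eq_2 space_Q)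
  qed measurable
  then consider "AE y in Q. \<not> y 1 < y 0" | "AE y in Q. y 1 < y 0"
    by (auto simp: prob_eq_1 prob_eq_0)
  moreover have arctan_int: "integrable Q (\<lambda>y. c * arctan (y 0))" for c :: real
  proof (intro integrable_mult_right integrable_const_bound[where B = "pi / 2"] AE_I2)
    show "norm (arctan (y 0)) \<le> pi / 2" for y :: "nat \<Rightarrow> real"
      using arctan_lbound[of "y 0"] arctan_ubound[of "y 0"] by (simp add: abs_le_iff)
  qed measurable
  ultimately show False
  proof cases
    case 1
    have "AE y in Q. 1 * arctan (y 0) < 1 * arctan (shift_seq y 0)"
      using 1 neq by eventually_elim (auto simp: arctan_less_iff)
    from no_drift[OF arctan_int this] show False .
  next
    case 2
    have "AE y in Q. (-1) * arctan (y 0) < (-1) * arctan (shift_seq y 0)"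
      using 2 by eventually_elim (auto simp: arctan_less_iff)
    from no_drift[OF arctan_int this] show False .
  qed
qed

section \<open>The limiting diagram\<close>

lemma birkhoff_sum_indicator:
  "birkhoff_sum (indicator A) n y = real (card {k \<in> {..<n}. (\<lambda>i. y (i + k)) \<in> A})"
  by (simp add: birkhoff_sum_def shift_seq_pow indicator_def Int_def)

lemma frequency_tendsto:
  assumes "A \<in> sets Q"
  shows "AE y in Q. (\<lambda>n. real (card {k \<in> {..<n}. (\<lambda>i. y (i + k)) \<in> A}) / real n) \<longlonglongrightarrow> prob A"
proof -
  have "integrable Q (indicat_real A)"
    using assms by (intro integrable_real_indicator) (auto simp: emeasure_eq_measure)
  from birkhoff_ergodic[OF this] show ?thesis
    using assms by (simp add: birkhoff_sum_indicator)
qed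

definition settled_measure :: "nat \<Rightarrow> (ereal \<times> ereal) measure" where
  "settled_measure R =
     distr (density Q (indicator (settled_in R UNIV))) borel (\<lambda>y. pers_point y {..2 * R} R)"

text \<open>The measures \<open>settled_measure R\<close> increase with \<open>R\<close>, so this supremum of measures is their limit on every Borel set.\<close>
definition limit_measure :: "(ereal \<times> ereal) measure" where
  "limit_measure = (SUP R. settled_measure R)"

lemma sets_settled_measure [simp]: "sets (settled_measure R) = sets borel"
  by (simp add: settled_measure_def)

lemma emeasure_settled_measure:
  assumes [measurable]: "U \<in> sets borel"
  shows "emeasure (settled_measure R) U = ennreal (prob (settled_in R U))"
proof -
  let ?\<Phi> = "\<lambda>y. pers_point y {..2 * R} R"
  have "emeasure (settled_measure R) U =
      emeasure (density Q (indicator (settled_in R UNIV))) (?\<Phi> -` U \<inter> space Q)"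
    unfolding settled_measure_def by (subst emeasure_distr) auto
  also have "\<dots> = emeasure Q (settled_in R UNIV \<inter> (?\<Phi> -` U \<inter> space Q))"
    by (rule emeasure_restricted) auto
  also have "settled_in R UNIV \<inter> (?\<Phi> -` U \<inter> space Q) = settled_in R U"
    by (auto simp: settled_in_def space_Q)
  finally show ?thesis by (simp add: emeasure_eq_measure)
qed

text \<open>By stationarity both events may be centred at \<open>R'\<close>; a vertex settled in the smaller window keeps its point in the
  larger one.\<close>
lemma settled_in_mono:
  assumes "R \<le> R'" and [measurable]: "U \<in> sets borel"
  shows "prob (settled_in R U) \<le> prob (settled_in R' U)"
proof -
  define k where "k = R' - R"
  have k: "k + R = R'" using assms(1) by (simp add: k_def)
  have "prob (settled_in R U) = prob ((shift_seq ^^ k) -` settled_in R U \<inter> space Q)"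
    by (rule prob_vimage_pow[symmetric]) simp
  also have "\<dots> \<le> prob (settled_in R' U)"
  proof (rule finite_measure_mono)
    show "(shift_seq ^^ k) -` settled_in R U \<inter> space Q \<subseteq> settled_in R' U"
    proof
      fix y assume "y \<in> (shift_seq ^^ k) -` settled_in R U \<inter> space Q"
      then have y: "(\<lambda>i. y (i + k)) \<in> settled_in R U" by (simp add: shift_seq_pow)
      then have st: "settled y {k..k + 2 * R} (k + R)" by (simp add: shift_settled_in)
      have sub: "{k..k + 2 * R} \<subseteq> {..2 * R'}" using k by auto
      from shift_settled_in_iff[OF st sub] y settled_mono[OF st sub]
      show "y \<in> settled_in R' U" by (simp add: settled_in_def k)
    qed
  qed simp
  finally show ?thesis .
qed

lemma sets_limit_measure [simp]: "sets limit_measure = sets borel"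
  unfolding limit_measure_def by (rule sets_SUP) auto

lemma emeasure_limit_measure:
  assumes U: "U \<in> sets borel"
  shows "emeasure limit_measure U = (SUP R. ennreal (prob (settled_in R U)))"
proof -
  have "settled_measure R \<le> settled_measure R'" if "R \<le> R'" for R R'
  proof -
    have "emeasure (settled_measure R) A \<le> emeasure (settled_measure R') A" for A
    proof (cases "A \<in> sets borel")
      case True
      then show ?thesis using settled_in_mono[OF that True] by (simp add: emeasure_settled_measure)
    qed (simp add: emeasure_notin_sets)
    moreover have "space (settled_measure R) = UNIV" for R by (simp add: settled_measure_def)
    ultimately show ?thesis by (simp add: le_measure_iff le_fun_def)
  qed
  then have "Complete_Partial_Order.chain (\<le>) (range settled_measure)"
    by (auto simp: Complete_Partial_Order.chain_def) (metis nat_le_linear)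
  then have "emeasure limit_measure U = (SUP R. emeasure (settled_measure R) U)"
    unfolding limit_measure_def using U by (intro emeasure_SUP_chain[where N = borel]) auto
  then show ?thesis using U by (simp add: emeasure_settled_measure)
qed

lemma finite_limit_measure: "finite_measure limit_measure"
proof
  have "emeasure limit_measure UNIV \<le> 1"
    by (subst emeasure_limit_measure) (auto intro!: SUP_least)
  then have "emeasure limit_measure UNIV < \<infinity>" by (rule le_less_trans) simp
  then show "emeasure limit_measure (space limit_measure) \<noteq> \<infinity>"
    using sets_eq_imp_space_eq[OF sets_limit_measure] by simp
qed

lemma prob_settled_in_tendsto:
  assumes U: "U \<in> sets borel"
  shows "(\<lambda>R. prob (settled_in R U)) \<longlonglongrightarrow> measure limit_measure U"
proof -
  interpret finite_measure limit_measure by (rule finite_limit_measure)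
  have "incseq (\<lambda>R. ennreal (prob (settled_in R U)))"
    using settled_in_mono[OF _ U] by (auto simp: incseq_def)
  then have "(\<lambda>R. ennreal (prob (settled_in R U))) \<longlonglongrightarrow> emeasure limit_measure U"
    unfolding emeasure_limit_measure[OF U] by (rule LIMSEQ_SUP)
  then show ?thesis by (simp add: emeasure_eq_measure)
qed

text \<open>Fix \<open>R\<close> for which the settled frequency is close to its limit and unsettled vertices are rare. The counts then
  differ from a Birkhoff sum by the unsettled vertices and at most \<open>2 R\<close> further ones.\<close>
lemma point_count_frequency:
  assumes U: "U \<in> sets borel"
  shows "AE y in Q. (\<lambda>n. real (point_count y n U) / real n) \<longlonglongrightarrow> measure limit_measure U"
proof -
  let ?bad = "\<lambda>R. {y. \<not> settled y {..2 * R} R}"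
  have bad: "?bad R \<in> sets Q" for R
  proof -
    have "?bad R = {y \<in> space Q. \<not> settled y {..2 * R} R}" by (simp add: space_Q)
    also have "\<dots> \<in> sets Q" by measurable
    finally show ?thesis .
  qed
  have "AE y in Q. \<forall>R. (\<lambda>n. real (card {k \<in> {..<n}. (\<lambda>i. y (i + k)) \<in> settled_in R U}) / real n)
      \<longlonglongrightarrow> prob (settled_in R U)"
    unfolding AE_all_countable using U by (intro allI frequency_tendsto) simp
  moreover have "AE y in Q. \<forall>R. (\<lambda>n. real (card {k \<in> {..<n}. (\<lambda>i. y (i + k)) \<in> ?bad R}) / real n)
      \<longlonglongrightarrow> prob (?bad R)"
    unfolding AE_all_countable by (intro allI frequency_tendsto bad)
  ultimately show ?thesis
  proof eventually_elim
    case (elim y)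
    show ?case
    proof (rule tendstoI)
      fix e :: real assume e: "0 < e"
      have "\<forall>\<^sub>F R in sequentially. dist (prob (settled_in R U)) (measure limit_measure U) < e / 4"
        using prob_settled_in_tendsto[OF U] e by (intro tendstoD) auto
      moreover have "\<forall>\<^sub>F R in sequentially. prob (?bad R) < e / 4"
        using prob_unsettled_tendsto_0 e by (intro order_tendstoD) auto
      ultimately have "\<forall>\<^sub>F R in sequentially.
          dist (prob (settled_in R U)) (measure limit_measure U) < e / 4 \<and> prob (?bad R) < e / 4"
        by (rule eventually_conj)
      then obtain R where R: "dist (prob (settled_in R U)) (measure limit_measure U) < e / 4"
        "prob (?bad R) < e / 4" using eventually_happens'[OF sequentially_bot] by blast
      let ?a = "\<lambda>n. real (card {k \<in> {..<n}. (\<lambda>i. y (i + k)) \<in> settled_in R U})"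
      let ?b = "\<lambda>n. real (card {k \<in> {..<n}. (\<lambda>i. y (i + k)) \<in> ?bad R})"
      have "\<forall>\<^sub>F n in sequentially. dist (?a n / real n) (prob (settled_in R U)) < e / 4"
        using elim e by (intro tendstoD) auto
      moreover have "\<forall>\<^sub>F n in sequentially. ?b n / real n < e / 4"
        using elim(2) R(2) by (intro order_tendstoD) auto
      moreover have "(\<lambda>n. real (2 * R) / real n) \<longlonglongrightarrow> 0" by (rule lim_const_over_n)
      then have "\<forall>\<^sub>F n in sequentially. real (2 * R) / real n < e / 4"
        by (rule order_tendstoD) (use e in simp)
      ultimately show "\<forall>\<^sub>F n in sequentially.
          dist (real (point_count y n U) / real n) (measure limit_measure U) < e"
      proof eventually_elim
        case (elim n)
        have "?a n \<le> real (point_count y n U) + real (2 * R)"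
          using count_lower[of n y R U] unfolding point_count_def by linarith
        then have "?a n / real n \<le> real (point_count y n U) / real n + real (2 * R) / real n"
          unfolding add_divide_distrib[symmetric] by (rule divide_right_mono) simp
        moreover have "real (point_count y n U) \<le> ?a n + ?b n + real (2 * R)"
          using count_upper[of y n U R] unfolding point_count_def mem_Collect_eq by linarith
        then have "real (point_count y n U) / real n \<le> ?a n / real n + ?b n / real n + real (2 * R) / real n"
          unfolding add_divide_distrib[symmetric] by (rule divide_right_mono) simp
        ultimately show ?case using elim R unfolding dist_real_def abs_less_iff by linarith
      qed
    qed
  qed
qed

text \<open>A strict local minimum at the centre of a window contributes a point once it is settled.\<close>
lemma limit_measure_pos: "0 < measure limit_measure UNIV"
proof -
  let ?min = "{y. y 1 < y 0 \<and> y 1 < (y 2 :: real)}"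
  have min_sets: "?min \<in> sets Q"
  proof -
    have "?min = {y \<in> space Q. y 1 < y 0 \<and> y 1 < y 2}" by (simp add: space_Q)
    also have "\<dots> \<in> sets Q" by measurable
    finally show ?thesis .
  qed
  have "\<forall>\<^sub>F R in sequentially. prob {y. \<not> settled y {..2 * R} R} < prob ?min"
    using prob_unsettled_tendsto_0 prob_local_min_pos by (intro order_tendstoD)
  with eventually_ge_at_top[of 1]
  have "\<forall>\<^sub>F R in sequentially. 1 \<le> R \<and> prob {y. \<not> settled y {..2 * R} R} < prob ?min"
    by (rule eventually_conj)
  then obtain R where R: "1 \<le> R" "prob {y. \<not> settled y {..2 * R} R} < prob ?min"
    using eventually_happens'[OF sequentially_bot] by blast
  have bad: "{y. \<not> settled y {..2 * R} R} \<in> sets Q"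
  proof -
    have "{y. \<not> settled y {..2 * R} R} = {y \<in> space Q. \<not> settled y {..2 * R} R}" by (simp add: space_Q)
    also have "\<dots> \<in> sets Q" by measurable
    finally show ?thesis .
  qed
  have "(shift_seq ^^ (R - 1)) -` ?min \<inter> space Q \<subseteq> settled_in R UNIV \<union> {y. \<not> settled y {..2 * R} R}"
  proof
    fix y assume "y \<in> (shift_seq ^^ (R - 1)) -` ?min \<inter> space Q"
    then have "y R < y (R - 1)" "y R < y (R + 1)"
      using R(1) by (auto simp: shift_seq_pow numeral_2_eq_2)
    then have "ereal (y R) < death y {..2 * R} R" by (intro strict_local_min_less_death) auto
    then show "y \<in> settled_in R UNIV \<union> {y. \<not> settled y {..2 * R} R}"
      by (auto simp: settled_in_def path_births_def)
  qed
  then have "prob ((shift_seq ^^ (R - 1)) -` ?min \<inter> space Q) \<le>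
      prob (settled_in R UNIV \<union> {y. \<not> settled y {..2 * R} R})"
    using bad by (intro finite_measure_mono) auto
  also have "\<dots> \<le> prob (settled_in R UNIV) + prob {y. \<not> settled y {..2 * R} R}"
    using bad by (intro measure_Un_le) auto
  finally have "0 < prob (settled_in R UNIV)"
    using R(2) prob_vimage_pow[OF min_sets, of "R - 1"] by linarith
  also have "\<dots> \<le> measure limit_measure UNIV"
    by (rule LIMSEQ_le_const[OF prob_settled_in_tendsto]) (auto intro!: exI[of _ R] settled_in_mono)
  finally show ?thesis .
qed

lemma Delta_borel: "Delta \<in> sets borel" "Delta_fin \<in> sets borel"
  using open_Delta open_Delta_fin by auto

text \<open>A settled vertex has a finite death, so no mass sits at infinity although the diagram of every
  nonempty finite sequence has a point there.\<close>
lemma limit_measure_Delta_fin: "measure limit_measure Delta_fin = measure limit_measure UNIV"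
proof -
  have "settled_in R Delta_fin = settled_in R UNIV" for R
  proof -
    have "pers_point y {..2 * R} R \<in> Delta_fin" if "settled y {..2 * R} R" "R \<in> path_births y {..2 * R}" for y
      using settled_death_less_infinity[OF that(1)] that(2)
      by (auto simp: Delta_fin_eq Delta_def pers_point_def path_births_def)
    then show ?thesis by (auto simp: settled_in_def)
  qed
  then show ?thesis
    using prob_settled_in_tendsto[of Delta_fin] prob_settled_in_tendsto[of UNIV] Delta_borel
    by (auto intro: LIMSEQ_unique)
qed

lemma limit_measure_Delta: "measure limit_measure Delta = measure limit_measure UNIV"
proof -
  interpret finite_measure limit_measure by (rule finite_limit_measure)
  have "Delta_fin \<subseteq> Delta" by (auto simp: Delta_fin_def)
  then have "measure limit_measure Delta_fin \<le> measure limit_measure Delta"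
    using Delta_borel by (intro finite_measure_mono) auto
  moreover have "measure limit_measure Delta \<le> measure limit_measure UNIV"
    by (intro finite_measure_mono) auto
  ultimately show ?thesis using limit_measure_Delta_fin by linarith
qed

definition limit_diagram :: "(ereal \<times> ereal) measure" where
  "limit_diagram = restrict_space (scale_measure (1 / emeasure limit_measure UNIV) limit_measure) Delta"

lemma sets_limit_diagram: "sets limit_diagram = sets (restrict_space borel Delta)"
  unfolding limit_diagram_def by (rule sets_restrict_space_cong) simp

lemma space_limit_diagram: "space limit_diagram = Delta"
  using sets_eq_imp_space_eq[OF sets_limit_diagram] by (simp add: space_restrict_space)

lemma emeasure_limit_diagram:
  assumes U: "U \<in> sets borel" "U \<subseteq> Delta"
  shows "emeasure limit_diagram U = ennreal (measure limit_measure U / measure limit_measure UNIV)"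
proof -
  interpret finite_measure limit_measure by (rule finite_limit_measure)
  have "emeasure limit_diagram U = 1 / emeasure limit_measure UNIV * emeasure limit_measure U"
    unfolding limit_diagram_def using U Delta_borel
    by (subst emeasure_restrict_space)
      (auto simp: space_scale_measure sets_eq_imp_space_eq[OF sets_limit_measure])
  also have "\<dots> = ennreal (1 / measure limit_measure UNIV) * ennreal (measure limit_measure U)"
    using limit_measure_pos by (simp add: emeasure_eq_measure flip: divide_ennreal ennreal_1)
  also have "\<dots> = ennreal (measure limit_measure U / measure limit_measure UNIV)"
    using limit_measure_pos by (simp flip: ennreal_mult)
  finally show ?thesis .
qed

lemma measure_limit_diagram:
  assumes "U \<in> sets borel" "U \<subseteq> Delta"
  shows "measure limit_diagram U = measure limit_measure U / measure limit_measure UNIV"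
  using emeasure_limit_diagram[OF assms] by (simp add: measure_def)

lemma prob_space_limit_diagram: "prob_space limit_diagram"
  by (rule prob_spaceI)
    (use emeasure_limit_diagram[of Delta] limit_measure_Delta limit_measure_pos Delta_borel
      in \<open>simp add: space_limit_diagram\<close>)

lemma prob_space_limit_diagram_fin: "prob_space (restrict_space limit_diagram Delta_fin)"
proof (rule prob_spaceI)
  have sub: "Delta_fin \<subseteq> Delta" by (auto simp: Delta_fin_def)
  then have "space (restrict_space limit_diagram Delta_fin) = Delta_fin"
    by (auto simp: space_restrict_space space_limit_diagram)
  moreover have "emeasure limit_diagram Delta_fin = 1"
    using emeasure_limit_diagram[OF Delta_borel(2) sub] limit_measure_Delta_fin limit_measure_pos by simp
  moreover have "Delta_fin \<in> sets limit_diagram"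
    using sub Delta_borel by (auto simp: sets_limit_diagram sets_restrict_space_iff)
  ultimately show "emeasure (restrict_space limit_diagram Delta_fin)
      (space (restrict_space limit_diagram Delta_fin)) = 1"
    using sub by (subst emeasure_restrict_space) (auto simp: space_limit_diagram Int_absorb2)
qed

text \<open>The null set in \<open>point_count_frequency\<close> depends on \<open>U\<close>. A countable base has only countably many finite unions,
  which leaves a single null set outside of which the criterion for weak convergence applies.\<close>
lemma normalized_counts_weak_conv:
  assumes S: "open S" "S \<subseteq> Delta" "measure limit_measure S = measure limit_measure UNIV"
    and \<nu>: "prob_space \<nu>" "sets \<nu> = sets (restrict_space borel S)"
      "\<And>U. U \<in> sets borel \<Longrightarrow> U \<subseteq> S \<Longrightarrow>
        measure \<nu> U = measure limit_measure U / measure limit_measure UNIV"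
    and N: "\<And>y n. space (N y n) = S" "\<And>y n. sets (N y n) = sets (restrict_space borel S)"
      "\<And>y n U. U \<in> sets borel \<Longrightarrow> U \<subseteq> S \<Longrightarrow> emeasure (N y n) U = of_nat (point_count y n U)"
  shows "AE y in Q. weak_conv_on S (\<lambda>n. normalize_measure (N y n)) \<nu>"
proof -
  obtain B :: "(ereal \<times> ereal) set set" where B: "countable B" "topological_basis B"
    using ex_countable_basis by blast
  have Ssets: "S \<in> sets borel" using S(1) by simp
  define \<F> where "\<F> = {F. finite F \<and> F \<subseteq> B}"
  have "countable \<F>" unfolding \<F>_def using B(1) by (rule countable_Collect_finite_subset)
  have U: "\<Union>F \<inter> S \<in> sets borel" if "F \<in> \<F>" for F
  proof -
    have "open (\<Union>F)" using that B(2) by (auto simp: \<F>_def intro!: open_Union dest: topological_basis_open)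
    then show ?thesis using S(1) by (intro borel_open open_Int)
  qed
  have "AE y in Q. \<forall>F\<in>\<F>. (\<lambda>n. real (point_count y n (\<Union>F \<inter> S)) / real n) \<longlonglongrightarrow> measure limit_measure (\<Union>F \<inter> S)"
    using U point_count_frequency \<open>countable \<F>\<close> by (subst AE_ball_countable) auto
  with point_count_frequency[OF Ssets] show ?thesis
  proof eventually_elim
    case (elim y)
    have pos: "\<forall>\<^sub>F n in sequentially. 0 < point_count y n S"
    proof -
      have "\<forall>\<^sub>F n in sequentially. 0 < real (point_count y n S) / real n"
        using elim(1) limit_measure_pos S(3) by (intro order_tendstoD) auto
      then show ?thesis by eventually_elim (auto intro: ccontr)
    qed
    show ?case
    proof (rule weak_conv_on_of_basis[OF B(2,1) S(1) _ \<nu>(1,2)])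
      show "\<forall>\<^sub>F n in sequentially. prob_space (normalize_measure (N y n)) \<and>
          sets (normalize_measure (N y n)) = sets (restrict_space borel S)"
        using pos
      proof eventually_elim
        case (elim n)
        have "prob_space (normalize_measure (N y n))"
          by (rule normalize_counting(1)[OF Ssets N(1,2), where c = "point_count y n"]) (use N(3) elim in auto)
        then show ?case by (simp add: normalize_measure_def N(2))
      qed
      \<comment> \<open>The factors \<open>1 / n\<close> cancel in the normalization.\<close>
      fix F assume "finite F" "F \<subseteq> B"
      then have F: "F \<in> \<F>" by (simp add: \<F>_def)
      let ?U = "\<Union>F \<inter> S"
      have "(\<lambda>n. (real (point_count y n ?U) / real n) / (real (point_count y n S) / real n))
          \<longlonglongrightarrow> measure limit_measure ?U / measure limit_measure S"
        using elim F limit_measure_pos S(3) by (intro tendsto_divide) auto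
      moreover have "\<forall>\<^sub>F n in sequentially. (real (point_count y n ?U) / real n) / (real (point_count y n S) / real n)
          = measure (normalize_measure (N y n)) ?U"
        using pos eventually_gt_at_top[of 0]
      proof eventually_elim
        case (elim n)
        have "measure (normalize_measure (N y n)) ?U = real (point_count y n ?U) / real (point_count y n S)"
          by (rule normalize_counting(2)[OF Ssets N(1,2), where c = "point_count y n"]) (use N(3) elim U[OF F] in auto)
        then show ?case using elim by simp
      qed
      ultimately have "(\<lambda>n. measure (normalize_measure (N y n)) ?U)
          \<longlonglongrightarrow> measure limit_measure ?U / measure limit_measure S"
        by (rule Lim_transform_eventually)
      then show "(\<lambda>n. measure (normalize_measure (N y n)) ?U) \<longlonglongrightarrow> measure \<nu> ?U"
        using \<nu>(3)[OF U[OF F]] S(3) by simp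
    qed
  qed
qed

end

section \<open>From the random variables to the shift on sequences\<close>

text \<open>Stationarity in terms of the events that generate the product \<open>\<sigma>\<close>-algebra.\<close>
lemma stationary_cylinder:
  assumes X: "\<And>i. 1 \<le> i \<Longrightarrow> X i \<in> borel_measurable M" and stat: "stationary_seq M X"
    and J: "finite J" and A: "\<And>j. j \<in> J \<Longrightarrow> A j \<in> sets borel"
  shows "emeasure M {\<omega> \<in> space M. \<forall>j\<in>J. X (Suc j + h) \<omega> \<in> A j} =
    emeasure M {\<omega> \<in> space M. \<forall>j\<in>J. X (Suc j) \<omega> \<in> A j}"
proof -
  let ?J = "Suc ` J" and ?A = "\<lambda>j. A (j - 1)"
  have "emeasure (distr M (Pi\<^sub>M ?J (\<lambda>_. borel)) (\<lambda>\<omega>. \<lambda>j\<in>?J. X (j + h) \<omega>)) (Pi\<^sub>E ?J ?A) =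
      emeasure M {\<omega> \<in> space M. \<forall>j\<in>J. X (Suc j + h) \<omega> \<in> A j}" for h
  proof -
    have "(\<lambda>\<omega>. \<lambda>j\<in>?J. X (j + h) \<omega>) \<in> measurable M (Pi\<^sub>M ?J (\<lambda>_. borel))"
      by (rule measurable_restrict) (auto intro: X)
    moreover have "Pi\<^sub>E ?J ?A \<in> sets (Pi\<^sub>M ?J (\<lambda>_. borel))"
      using J A by (intro sets_PiM_I_finite) auto
    moreover have "(\<lambda>\<omega>. \<lambda>j\<in>?J. X (j + h) \<omega>) -` Pi\<^sub>E ?J ?A \<inter> space M =
        {\<omega> \<in> space M. \<forall>j\<in>J. X (Suc j + h) \<omega> \<in> A j}"
      by (auto simp: PiE_iff)
    ultimately show ?thesis by (simp add: emeasure_distr)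
  qed
  note cylinder = this
  have "?J \<subseteq> {1..}" by auto
  then have "distr M (Pi\<^sub>M ?J (\<lambda>_. borel)) (\<lambda>\<omega>. \<lambda>j\<in>?J. X (j + h) \<omega>) =
      distr M (Pi\<^sub>M ?J (\<lambda>_. borel)) (\<lambda>\<omega>. \<lambda>j\<in>?J. X (j + 0) \<omega>)"
    using stat J unfolding stationary_seq_def by simp
  with cylinder[of h] cylinder[of 0] show ?thesis by simp
qed

lemma ergodic_sequence_law:
  fixes X :: "nat \<Rightarrow> 'w \<Rightarrow> real"
  assumes ps: "prob_space M" and X: "\<And>i. 1 \<le> i \<Longrightarrow> X i \<in> borel_measurable M"
    and stat: "stationary_seq M X" and erg: "ergodic_seq M X"
    and no_atom: "\<And>a. measure M {\<omega> \<in> space M. X 1 \<omega> = a} = 0"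
    and distinct: "measure M {\<omega> \<in> space M. X 1 \<omega> = X 2 \<omega>} = 0"
  shows "ergodic_sequence (distr M (Pi\<^sub>M UNIV (\<lambda>_. borel)) (\<lambda>\<omega> i. X (Suc i) \<omega>))"
proof -
  let ?P = "Pi\<^sub>M (UNIV :: nat set) (\<lambda>_. borel :: real measure)"
  let ?Y = "\<lambda>\<omega> i. X (Suc i) \<omega>"
  let ?Q = "distr M ?P ?Y"
  interpret M: prob_space M by fact
  have Y [measurable]: "?Y \<in> measurable M ?P"
    by (rule measurable_PiM_single') (auto simp: X)
  have coord: "(\<lambda>y. y i) \<in> borel_measurable ?P" for i
    by (rule measurable_component_singleton) simp
  have shift_P: "shift_seq \<in> measurable ?P ?P"
    unfolding shift_seq_def[abs_def] by (rule measurable_PiM_single') (auto simp: coord)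
  interpret Q: prob_space ?Q by (rule M.prob_space_distr) fact
  show ?thesis
  proof
    show "shift_seq \<in> measurable ?Q ?Q" using shift_P by simp
    have emb: "prod_emb UNIV (\<lambda>_. borel) J (Pi\<^sub>E J A) = {y. \<forall>j\<in>J. y j \<in> A j}"
      for J :: "nat set" and A :: "nat \<Rightarrow> real set"
      by (auto simp: prod_emb_def PiE_iff space_PiM)
    show "distr ?Q ?Q shift_seq = ?Q"
    proof (rule measure_eqI_PiM_infinite[symmetric])
      fix A :: "nat \<Rightarrow> real set" and J :: "nat set"
      assume J: "finite J" "J \<subseteq> UNIV" and A: "\<And>i. i \<in> J \<Longrightarrow> A i \<in> sets borel"
      let ?C = "{y. \<forall>j\<in>J. y j \<in> A j}"
      have C: "?C \<in> sets ?P"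
        using sets_PiM_I[OF J, of A "\<lambda>_. borel"] A by (simp add: emb)
      have "emeasure (distr ?Q ?Q shift_seq) ?C = emeasure M {\<omega> \<in> space M. \<forall>j\<in>J. X (Suc j + 1) \<omega> \<in> A j}"
      proof -
        have "emeasure (distr ?Q ?Q shift_seq) ?C = emeasure ?Q (shift_seq -` ?C \<inter> space ?Q)"
          using C shift_P by (subst emeasure_distr) auto
        also have "\<dots> = emeasure M (?Y -` (shift_seq -` ?C \<inter> space ?P) \<inter> space M)"
          using measurable_sets[OF shift_P C] Y by (simp add: emeasure_distr)
        also have "?Y -` (shift_seq -` ?C \<inter> space ?P) \<inter> space M =
            {\<omega> \<in> space M. \<forall>j\<in>J. X (Suc j + 1) \<omega> \<in> A j}"
          by (auto simp: space_PiM)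
        finally show ?thesis .
      qed
      also have "\<dots> = emeasure M {\<omega> \<in> space M. \<forall>j\<in>J. X (Suc j) \<omega> \<in> A j}"
        by (rule stationary_cylinder[OF X stat J(1) A])
      also have "\<dots> = emeasure ?Q ?C"
      proof -
        have "?Y -` ?C \<inter> space M = {\<omega> \<in> space M. \<forall>j\<in>J. X (Suc j) \<omega> \<in> A j}" by auto
        then show ?thesis using C Y by (simp add: emeasure_distr)
      qed
      finally show "emeasure ?Q (prod_emb UNIV (\<lambda>_. borel) J (Pi\<^sub>E J A)) =
          emeasure (distr ?Q ?Q shift_seq) (prod_emb UNIV (\<lambda>_. borel) J (Pi\<^sub>E J A))"
        by (simp only: emb)
    qed (simp_all add: Q.finite_measure_axioms)
    show "Q.prob B \<in> {0, 1}"
      if B: "B \<in> sets ?Q" and inv: "AE y in ?Q. y \<in> B \<longleftrightarrow> shift_seq y \<in> B" for B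
    proof -
      have B': "B \<in> sets ?P" using B by simp
      have "AE \<omega> in M. ?Y \<omega> \<in> B \<longleftrightarrow> shift_seq (?Y \<omega>) \<in> B" by (rule AE_distrD[OF Y inv])
      then have "AE \<omega> in M. (\<lambda>i. X (i + 1) \<omega>) \<in> B \<longleftrightarrow> (\<lambda>i. X (i + 2) \<omega>) \<in> B"
        by (simp add: shift_seq_def)
      then have "measure M {\<omega> \<in> space M. (\<lambda>i. X (i + 1) \<omega>) \<in> B} \<in> {0, 1}"
        using erg B' unfolding ergodic_seq_def by blast
      moreover have "?Y -` B \<inter> space M = {\<omega> \<in> space M. (\<lambda>i. X (i + 1) \<omega>) \<in> B}" by auto
      ultimately show ?thesis using B' Y by (simp add: measure_distr)
    qed
    show "sets ?Q = sets ?P" by simp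
    have transfer: "Q.prob {y \<in> space ?Q. R y} = measure M {\<omega> \<in> space M. R (?Y \<omega>)}"
      if R: "{y \<in> space ?P. R y} \<in> sets ?P" for R
    proof -
      have "?Y -` {y \<in> space ?P. R y} \<inter> space M = {\<omega> \<in> space M. R (?Y \<omega>)}"
        using measurable_space[OF Y] by auto
      then show ?thesis using measure_distr[OF Y R] by simp
    qed
    show "Q.prob {y \<in> space ?Q. y 0 = a} = 0" for a
    proof -
      have "{y \<in> space ?P. y 0 = a} \<in> sets ?P"
        by (intro borel_measurable_eq coord borel_measurable_const)
      from transfer[OF this] show ?thesis using no_atom[of a] by simp
    qed
    show "Q.prob {y \<in> space ?Q. y 0 = y 1} = 0"
    proof -
      have "{y \<in> space ?P. y 0 = y 1} \<in> sets ?P" by (intro borel_measurable_eq coord)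
      from transfer[OF this] show ?thesis using distinct by (simp add: numeral_2_eq_2)
    qed
  qed
qed

lemma xi0_cong:
  assumes "\<And>k. 1 \<le> k \<Longrightarrow> x k = x' k"
  shows "xi0 x n = xi0 x' n" and "xi0_fin x n = xi0_fin x' n"
proof -
  have "trunc_seq x n = trunc_seq x' n" using assms by (auto simp: trunc_seq_def fun_eq_iff)
  then have "sublevel_complex x n = sublevel_complex x' n" by (simp add: sublevel_complex_def[abs_def])
  then show "xi0 x n = xi0 x' n" by (simp add: xi0_def)
  then show "xi0_fin x n = xi0_fin x' n" by (simp add: xi0_fin_def)
qed

theorem theorem3p1:
  fixes M :: "'w measure" and X :: "nat \<Rightarrow> 'w \<Rightarrow> real" and F f :: "real \<Rightarrow> real"
  assumes "prob_space M"
    and "\<And>i. i \<ge> 1 \<Longrightarrow> X i \<in> borel_measurable M"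
    and "stationary_seq M X"
    and "ergodic_seq M X"
    and "\<And>i. i \<ge> 1 \<Longrightarrow> cdf (distr M borel (X i)) = F"
    and "\<And>x. f x \<ge> 0"
    and "\<And>i. i \<ge> 1 \<Longrightarrow> distributed M lborel (X i) (\<lambda>x. ennreal (f x))"
    and "measure M {\<omega> \<in> space M. X 1 \<omega> = X 2 \<omega>} = 0"
  shows "\<exists>\<xi> :: (ereal \<times> ereal) measure.
    prob_space \<xi> \<and> sets \<xi> = sets (restrict_space borel Delta) \<and>
    (AE \<omega> in M. weak_conv_on Delta
       (\<lambda>n. normalize_measure (xi0 (\<lambda>k. X k \<omega>) n)) \<xi>) \<and>
    (AE \<omega> in M. weak_conv_on Delta_fin
       (\<lambda>n. normalize_measure (xi0_fin (\<lambda>k. X k \<omega>) n)) (restrict_space \<xi> Delta_fin))"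
proof -
  let ?P = "Pi\<^sub>M (UNIV :: nat set) (\<lambda>_. borel :: real measure)"
  let ?Y = "\<lambda>\<omega> i. X (Suc i) \<omega>"
  have no_atom: "measure M {\<omega> \<in> space M. X 1 \<omega> = a} = 0" for a
  proof -
    have "measure M {\<omega> \<in> space M. X 1 \<omega> = a} = measure (distr M lborel (X 1)) {a}"
      using assms(2)[of 1] by (subst measure_distr) (auto simp: vimage_def Int_def conj_commute)
    also have "distr M lborel (X 1) = density lborel (\<lambda>x. ennreal (f x))"
      using assms(7)[of 1] by (simp add: distributed_def)
    also have "measure \<dots> {a} = 0"
    proof -
      have "AE x in lborel. x \<notin> {a}" by (rule AE_not_in) (simp add: finite_imp_null_set_lborel)
      then have "AE x in lborel. x \<in> {a} \<longrightarrow> ennreal (f x) = 0" by eventually_elim simp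
      then have "{a} \<in> null_sets (density lborel (\<lambda>x. ennreal (f x)))"
        using assms(7)[of 1] by (subst null_sets_density_iff) (simp_all add: distributed_def)
      then show ?thesis by (simp add: measure_eq_0_null_sets)
    qed
    finally show ?thesis .
  qed
  interpret ergodic_sequence "distr M ?P ?Y"
    by (rule ergodic_sequence_law) (use assms no_atom in auto)
  have Y: "?Y \<in> measurable M ?P"
    by (rule measurable_PiM_single') (auto simp: assms(2))
  have sub: "Delta_fin \<subseteq> Delta" by (auto simp: Delta_fin_def)
  have "AE y in distr M ?P ?Y. weak_conv_on Delta
      (\<lambda>n. normalize_measure (xi0 (\<lambda>k. y (k - 1)) n)) limit_diagram"
    by (rule normalized_counts_weak_conv[OF open_Delta order_refl limit_measure_Delta prob_space_limit_diagram
          sets_limit_diagram measure_limit_diagram space_xi0 sets_xi0])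
      (simp_all add: xi0_emeasure)
  from AE_distrD[OF Y this]
  have 1: "AE \<omega> in M. weak_conv_on Delta (\<lambda>n. normalize_measure (xi0 (\<lambda>k. X k \<omega>) n)) limit_diagram"
  proof eventually_elim
    case (elim \<omega>)
    have "xi0 (\<lambda>k. X (Suc (k - 1)) \<omega>) n = xi0 (\<lambda>k. X k \<omega>) n" for n by (rule xi0_cong) simp
    with elim show ?case by simp
  qed
  have "AE y in distr M ?P ?Y. weak_conv_on Delta_fin
      (\<lambda>n. normalize_measure (xi0_fin (\<lambda>k. y (k - 1)) n)) (restrict_space limit_diagram Delta_fin)"
  proof (rule normalized_counts_weak_conv[OF open_Delta_fin sub limit_measure_Delta_fin prob_space_limit_diagram_fin
        _ _ space_xi0_fin sets_xi0_fin])
    have "sets (restrict_space limit_diagram Delta_fin) = sets (restrict_space (restrict_space borel Delta) Delta_fin)"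
      by (rule sets_restrict_space_cong) (rule sets_limit_diagram)
    also have "\<dots> = sets (restrict_space borel Delta_fin)"
      using sub by (subst sets_restrict_restrict_space) (simp add: Int_absorb1 sets_restrict_space)
    finally show "sets (restrict_space limit_diagram Delta_fin) = sets (restrict_space borel Delta_fin)" .
    fix U assume U: "U \<in> sets borel" "U \<subseteq> Delta_fin"
    have "Delta_fin \<in> sets limit_diagram"
      using sub Delta_borel by (auto simp: sets_limit_diagram sets_restrict_space_iff)
    then have "measure (restrict_space limit_diagram Delta_fin) U = measure limit_diagram U"
      using U sub by (subst measure_restrict_space) (auto simp: space_limit_diagram Int_absorb2)
    then show "measure (restrict_space limit_diagram Delta_fin) U =
        measure limit_measure U / measure limit_measure UNIV"
      using measure_limit_diagram[of U] U sub by simp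
  qed (simp_all add: xi0_fin_emeasure)
  from AE_distrD[OF Y this]
  have 2: "AE \<omega> in M. weak_conv_on Delta_fin (\<lambda>n. normalize_measure (xi0_fin (\<lambda>k. X k \<omega>) n))
      (restrict_space limit_diagram Delta_fin)"
  proof eventually_elim
    case (elim \<omega>)
    have "xi0_fin (\<lambda>k. X (Suc (k - 1)) \<omega>) n = xi0_fin (\<lambda>k. X k \<omega>) n" for n by (rule xi0_cong) simp
    with elim show ?case by simp
  qed
  show ?thesis
    using prob_space_limit_diagram sets_limit_diagram 1 2 by blast
qed

end
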